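(* For all Coxeter groups $W$ one has factorizations $\underline{\mathbf{H}}(W)=\underline{\mathbf{D}}(W)\cdot\mathbb{Z}W$ and $\mathbf{H}(W)=\mathbf{D}(W)\cdot\mathbb{Z}W$ (i.e., the multiplication maps define isomorphisms of $\mathbb{Z}$-modules $\underline{\mathbf{D}}(W)\otimes_{\mathbb{Z}}\mathbb{Z}W\to\underline{\mathbf{H}}(W)$ and $\mathbf{D}(W)\otimes_{\mathbb{Z}}\mathbb{Z}W\to\mathbf{H}(W)$), where $\underline{\mathbf{D}}(W)$, $\mathbf{D}(W)$ are respectively the images of $\hat{\mathbf{D}}(W)$ under the projections $\hat{\mathbf{H}}(W)\twoheadrightarrow\underline{\mathbf{H}}(W)$, $\hat{\mathbf{H}}(W)\twoheadrightarrow\mathbf{H}(W)$.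
   Context: A Coxeter group $W$ is generated by $s_i$, $i\in I$, subject to relations $(s_is_j)^{m_{ij}}=1$, where $m_{ij}=m_{ji}\in\mathbb{Z}_{\ge 0}$ are such that $m_{ij}=1$ iff $i=j$ ($m_{ij}=0$ imposes no relation). $\hat{\mathbf{H}}(W)$ is the (unital associative) $\mathbb{Z}$-algebra generated by $s_i,D_i$, $i\in I$, subject to relations: (i) $s_i^2=1$, $D_i^2=D_i$, $s_iD_i+D_is_i=s_i-1$ for $i\in I$; (ii) $(s_is_j)^{m_{ij}}=1$; (iii) $\underbrace{D_is_js_i\cdots s_{j'}}_{m_{ij}}=\underbrace{s_j\cdots s_{i'}s_{j'}D_{i'}}_{m_{ij}}$ for all distinct $i,j\in I$ with $m_{ij}\ne 0$, where $i'=i$ if $m_{ij}$ is even, $i'=j$ if $m_{ij}$ is odd, and $\{i',j'\}=\{i,j\}$ (each side has $m_{ij}$ factors with indices alternating between $i$ and $j$). It is a Hopf algebra over $\mathbb{Z}$ with $\Delta(s_i)=s_i\otimes s_i$, $\Delta(D_i)=D_i\otimes 1+s_i\otimes D_i$, $\varepsilon(s_i)=1$, $\varepsilon(D_i)=0$. $\mathcal{S}:=\{ws_iw^{-1}\mid w\in W,i\in I\}$. For each $s\in\mathcal{S}$ there is a unique $D_s\in\hat{\mathbf{H}}(W)$ such that $D_{s_i}=D_i$ for $i\in I$ and $D_{s_iss_i}=s_iD_ss_i$ for any $i\in I$, $s\in\mathcal{S}\setminus\{s_i\}$. $\hat{\mathbf{D}}(W)$ is the subalgebra of $\hat{\mathbf{H}}(W)$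 generated by all $D_s$, $s\in\mathcal{S}$, and $\mathbf{K}(W):=\bigcap_{w\in W}w\hat{\mathbf{D}}(W)w^{-1}$. The lower Hecke-Hopf algebra is $\underline{\mathbf{H}}(W)=\hat{\mathbf{H}}(W)/\mathbf{J}(W)$, where $\mathbf{J}(W)$ is the ideal generated by $\mathbf{K}(W)\cap\operatorname{Ker}\varepsilon$. For $J\subset I$, $W_J$ is the (Coxeter) subgroup generated by $s_j$, $j\in J$; $\hat{\mathbf{D}}(W_J)$ is identified with the subalgebra of $\hat{\mathbf{D}}(W)$ generated by all $D_s$ with $s\in\mathcal{S}\cap W_J$. $\hat{\mathbf{D}}(W)$ is filtered by $\deg D_s=1$ (degree at most $r$ means: lies in the $\mathbb{Z}$-span of products of at most $r$ of the $D_s$). For distinct $i,j\in I$, $\mathbf{K}_{ij}(W)$ is the set of all elements of $\mathbf{K}(W_{\{i,j\}})\cap\operatorname{Ker}\varepsilon$ having degree at most $m_{ij}$. The Hecke-Hopf algebra is $\mathbf{H}(W)=\hat{\mathbf{H}}(W)/\underline{\mathbf{J}}(W)$, where $\underline{\mathbf{J}}(W)$ is the ideal generated by all $\mathbf{K}_{ij}(W)$, $i\ne j$. The group ring $\mathbb{Z}W$ maps to these algebras via $s_i\mapsto s_i$. *)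

theory Defs
  imports "HOL-Algebra.Algebra"
begin

section \<open>Coxeter groups\<close>

text \<open>The value \<open>m i j = 0\<close> stands for the absence of a relation (\<open>m = \<infinity>\<close>).\<close>

definition coxeter_matrix :: "'i set \<Rightarrow> ('i \<Rightarrow> 'i \<Rightarrow> nat) \<Rightarrow> bool" where
  "coxeter_matrix I m \<longleftrightarrow>
     (\<forall>i\<in>I. \<forall>j\<in>I. m i j = m j i \<and> (m i j = 1 \<longleftrightarrow> i = j))"

text \<open>
  Group presentations: a word is a list of letters \<open>(x, b)\<close>, where \<open>(x, True)\<close> stands for the
  generator \<open>x\<close> and \<open>(x, False)\<close> for its formal inverse.  Two words are identified when they are
  connected by insertions and deletions of relators and of cancelling pairs of letters.
\<close>

type_synonym 'x gword = "('x \<times> bool) list"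

definition gwords :: "'x set \<Rightarrow> 'x gword set" where
  "gwords A = lists (A \<times> UNIV)"

definition gword_step :: "'x set \<Rightarrow> 'x gword set \<Rightarrow> ('x gword \<times> 'x gword) set" where
  "gword_step A R =
     {(u @ r @ v, u @ v) | u r v.
        u \<in> gwords A \<and> v \<in> gwords A \<and> r \<in> R \<union> {[(x, b), (x, \<not> b)] | x b. x \<in> A}}"

definition gword_eq :: "'x set \<Rightarrow> 'x gword set \<Rightarrow> ('x gword \<times> 'x gword) set" where
  "gword_eq A R = (gword_step A R \<union> (gword_step A R)\<inverse>)\<^sup>*"

definition presented_group :: "'x set \<Rightarrow> 'x gword set \<Rightarrow> 'x gword set monoid" where
  "presented_group A R =
     \<lparr>carrier = gwords A // gword_eq A R,
      monoid.mult = (\<lambda>P Q. \<Union>a\<in>P. \<Union>b\<in>Q. gword_eq A R `` {a @ b}),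
      one = gword_eq A R `` {[]}\<rparr>"

definition coxeter_relators :: "'i set \<Rightarrow> ('i \<Rightarrow> 'i \<Rightarrow> nat) \<Rightarrow> 'i gword set" where
  "coxeter_relators I m =
     {concat (replicate (m i j) [(i, True), (j, True)]) | i j. i \<in> I \<and> j \<in> I}"

definition cox :: "'i set \<Rightarrow> ('i \<Rightarrow> 'i \<Rightarrow> nat) \<Rightarrow> 'i gword set monoid" where
  "cox I m = presented_group I (coxeter_relators I m)"

definition cox_s :: "'i set \<Rightarrow> ('i \<Rightarrow> 'i \<Rightarrow> nat) \<Rightarrow> 'i \<Rightarrow> 'i gword set" where
  "cox_s I m i = gword_eq I (coxeter_relators I m) `` {[(i, True)]}"

definition reflections :: "'i set \<Rightarrow> ('i \<Rightarrow> 'i \<Rightarrow> nat) \<Rightarrow> 'i gword set set" where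
  "reflections I m =
     {w \<otimes>\<^bsub>cox I m\<^esub> cox_s I m i \<otimes>\<^bsub>cox I m\<^esub> inv\<^bsub>cox I m\<^esub> w | w i.
        w \<in> carrier (cox I m) \<and> i \<in> I}"

definition parabolic :: "'i set \<Rightarrow> ('i \<Rightarrow> 'i \<Rightarrow> nat) \<Rightarrow> 'i set \<Rightarrow> 'i gword set set" where
  "parabolic I m J = generate (cox I m) (cox_s I m ` J)"

section \<open>Integral monoid rings and tensor products of abelian groups\<close>

text \<open>
  \<open>monoid_ring M\<close> is \<open>\<int>[M]\<close>.  It is the group ring when \<open>M\<close> is a group, and the free unital
  associative ring on \<open>A\<close> when \<open>M\<close> is the free monoid on \<open>A\<close>.
\<close>

definition monoid_ring :: "('a, 'b) monoid_scheme \<Rightarrow> ('a \<Rightarrow>\<^sub>0 int) ring" where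
  "monoid_ring M =
     \<lparr>carrier = {f. Poly_Mapping.keys f \<subseteq> carrier M},
      monoid.mult = (\<lambda>f g. frag_extend (\<lambda>a. frag_extend (\<lambda>b. frag_of (a \<otimes>\<^bsub>M\<^esub> b)) g) f),
      one = frag_of \<one>\<^bsub>M\<^esub>, ring.zero = 0, ring.add = (+)\<rparr>"

definition free_monoid :: "'x set \<Rightarrow> 'x list monoid" where
  "free_monoid A = \<lparr>carrier = lists A, monoid.mult = (@), one = []\<rparr>"

text \<open>
  The tensor product over \<open>\<int>\<close> of two abelian groups (written multiplicatively, as in
  \<open>free_Abelian_group\<close>): the free abelian group on pairs modulo biadditivity.
\<close>

definition tensor_rels ::
  "('a, 'c) monoid_scheme \<Rightarrow> ('b, 'd) monoid_scheme \<Rightarrow> ('a \<times> 'b \<Rightarrow>\<^sub>0 int) set" where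
  "tensor_rels A B =
     generate (free_Abelian_group (carrier A \<times> carrier B))
       ({frag_of (a \<otimes>\<^bsub>A\<^esub> a', b) - frag_of (a, b) - frag_of (a', b) | a a' b.
           a \<in> carrier A \<and> a' \<in> carrier A \<and> b \<in> carrier B} \<union>
        {frag_of (a, b \<otimes>\<^bsub>B\<^esub> b') - frag_of (a, b) - frag_of (a, b') | a b b'.
           a \<in> carrier A \<and> b \<in> carrier B \<and> b' \<in> carrier B})"

definition tensor ::
  "('a, 'c) monoid_scheme \<Rightarrow> ('b, 'd) monoid_scheme \<Rightarrow> ('a \<times> 'b \<Rightarrow>\<^sub>0 int) set monoid" where
  "tensor A B = free_Abelian_group (carrier A \<times> carrier B) Mod tensor_rels A B"

definition pure_tensor ::
  "('a, 'c) monoid_scheme \<Rightarrow> ('b, 'd) monoid_scheme \<Rightarrow> 'a \<Rightarrow> 'b \<Rightarrow> ('a \<times> 'b \<Rightarrow>\<^sub>0 int) set" where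
  "pure_tensor A B a b =
     tensor_rels A B #>\<^bsub>free_Abelian_group (carrier A \<times> carrier B)\<^esub> frag_of (a, b)"

text \<open>
  \<open>factorization H D A \<phi>\<close> says \<open>H = D \<cdot> A\<close>, where the ring \<open>A\<close> acts through \<open>\<phi> : A \<rightarrow> H\<close>: the
  multiplication map \<open>D \<otimes> A \<rightarrow> H\<close> is an isomorphism.  As pure tensors generate the tensor
  product, the map \<open>f\<close> below can only be the multiplication map.
\<close>

definition factorization ::
  "('h, 'x) ring_scheme \<Rightarrow> 'h set \<Rightarrow> ('a, 'y) ring_scheme \<Rightarrow> ('a \<Rightarrow> 'h) \<Rightarrow> bool" where
  "factorization H D A \<phi> \<longleftrightarrow>
     (\<exists>f \<in> iso (tensor (add_monoid (H\<lparr>carrier := D\<rparr>)) (add_monoid A)) (add_monoid H).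
        \<forall>d\<in>D. \<forall>x\<in>carrier A.
          f (pure_tensor (add_monoid (H\<lparr>carrier := D\<rparr>)) (add_monoid A) d x) = d \<otimes>\<^bsub>H\<^esub> \<phi> x)"

section \<open>The algebra \<open>hat H(W)\<close>\<close>

datatype 'i hgen = GS 'i | GD 'i

type_synonym 'i pre_hat = "'i hgen list \<Rightarrow>\<^sub>0 int"
type_synonym 'i hat = "'i pre_hat set"

definition hat_free :: "'i set \<Rightarrow> 'i pre_hat ring" where
  "hat_free I = monoid_ring (free_monoid (GS ` I \<union> GD ` I))"

text \<open>
  The two sides of the braid relation between \<open>D\<close> and \<open>s\<close>: the indices alternate, starting with \<open>i\<close> on the left
  and with \<open>j\<close> on the right; the only \<open>D\<close> is the first factor on the left and the last one on the
  right.
\<close>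

definition braid_lhs :: "'i \<Rightarrow> 'i \<Rightarrow> nat \<Rightarrow> 'i hgen list" where
  "braid_lhs i j n = map (\<lambda>k. (if k = 0 then GD else GS) (if even k then i else j)) [0..<n]"

definition braid_rhs :: "'i \<Rightarrow> 'i \<Rightarrow> nat \<Rightarrow> 'i hgen list" where
  "braid_rhs i j n = map (\<lambda>k. (if Suc k = n then GD else GS) (if even k then j else i)) [0..<n]"

definition hat_rels :: "'i set \<Rightarrow> ('i \<Rightarrow> 'i \<Rightarrow> nat) \<Rightarrow> 'i pre_hat set" where
  "hat_rels I m =
     {frag_of [GS i, GS i] - frag_of [] | i. i \<in> I} \<union>
     {frag_of [GD i, GD i] - frag_of [GD i] | i. i \<in> I} \<union>
     {frag_of [GS i, GD i] + frag_of [GD i, GS i] - (frag_of [GS i] - frag_of []) | i. i \<in> I} \<union>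
     {frag_of (concat (replicate (m i j) [GS i, GS j])) - frag_of [] | i j. i \<in> I \<and> j \<in> I} \<union>
     {frag_of (braid_lhs i j (m i j)) - frag_of (braid_rhs i j (m i j)) | i j.
        i \<in> I \<and> j \<in> I \<and> i \<noteq> j \<and> m i j \<noteq> 0}"

definition hat_ideal :: "'i set \<Rightarrow> ('i \<Rightarrow> 'i \<Rightarrow> nat) \<Rightarrow> 'i pre_hat set" where
  "hat_ideal I m = Idl\<^bsub>hat_free I\<^esub> (hat_rels I m)"

definition hat_H :: "'i set \<Rightarrow> ('i \<Rightarrow> 'i \<Rightarrow> nat) \<Rightarrow> 'i hat ring" where
  "hat_H I m = hat_free I Quot hat_ideal I m"

definition hat_s :: "'i set \<Rightarrow> ('i \<Rightarrow> 'i \<Rightarrow> nat) \<Rightarrow> 'i \<Rightarrow> 'i hat" where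
  "hat_s I m i = hat_ideal I m +>\<^bsub>hat_free I\<^esub> frag_of [GS i]"

definition hat_d :: "'i set \<Rightarrow> ('i \<Rightarrow> 'i \<Rightarrow> nat) \<Rightarrow> 'i \<Rightarrow> 'i hat" where
  "hat_d I m i = hat_ideal I m +>\<^bsub>hat_free I\<^esub> frag_of [GD i]"

definition counit :: "'i set \<Rightarrow> ('i \<Rightarrow> 'i \<Rightarrow> nat) \<Rightarrow> 'i hat \<Rightarrow> int" where
  "counit I m =
     (THE e. e \<in> ring_hom (hat_H I m) int_ring \<inter> extensional (carrier (hat_H I m)) \<and>
             (\<forall>i\<in>I. e (hat_s I m i) = 1 \<and> e (hat_d I m i) = 0))"

definition ker_counit :: "'i set \<Rightarrow> ('i \<Rightarrow> 'i \<Rightarrow> nat) \<Rightarrow> 'i hat set" where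
  "ker_counit I m = a_kernel (hat_H I m) int_ring (counit I m)"

abbreviation ZW :: "'i set \<Rightarrow> ('i \<Rightarrow> 'i \<Rightarrow> nat) \<Rightarrow> ('i gword set \<Rightarrow>\<^sub>0 int) ring" where
  "ZW I m \<equiv> monoid_ring (cox I m)"

text \<open>The ring homomorphism \<open>\<int>W \<rightarrow> R\<close> which sends \<open>s\<^sub>i\<close> to \<open>t i\<close>.\<close>

definition ZW_map ::
  "'i set \<Rightarrow> ('i \<Rightarrow> 'i \<Rightarrow> nat) \<Rightarrow> ('r, 'x) ring_scheme \<Rightarrow> ('i \<Rightarrow> 'r) \<Rightarrow>
   ('i gword set \<Rightarrow>\<^sub>0 int) \<Rightarrow> 'r" where
  "ZW_map I m R t =
     (THE \<phi>. \<phi> \<in> ring_hom (ZW I m) R \<inter> extensional (carrier (ZW I m)) \<and>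
             (\<forall>i\<in>I. \<phi> (frag_of (cox_s I m i)) = t i))"

definition hat_w :: "'i set \<Rightarrow> ('i \<Rightarrow> 'i \<Rightarrow> nat) \<Rightarrow> 'i gword set \<Rightarrow> 'i hat" where
  "hat_w I m w = ZW_map I m (hat_H I m) (hat_s I m) (frag_of w)"

text \<open>\<open>D_refl I m s\<close> is the element \<open>D\<^sub>s\<close>, for a reflection \<open>s\<close>.\<close>

definition D_refl :: "'i set \<Rightarrow> ('i \<Rightarrow> 'i \<Rightarrow> nat) \<Rightarrow> 'i gword set \<Rightarrow> 'i hat" where
  "D_refl I m =
     (THE D. D \<in> reflections I m \<rightarrow>\<^sub>E carrier (hat_H I m) \<and>
        (\<forall>i\<in>I. D (cox_s I m i) = hat_d I m i) \<and>
        (\<forall>i\<in>I. \<forall>s \<in> reflections I m - {cox_s I m i}.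
           D (cox_s I m i \<otimes>\<^bsub>cox I m\<^esub> s \<otimes>\<^bsub>cox I m\<^esub> cox_s I m i) =
             hat_s I m i \<otimes>\<^bsub>hat_H I m\<^esub> D s \<otimes>\<^bsub>hat_H I m\<^esub> hat_s I m i))"

text \<open>
  For a subgroup \<open>G\<close> of \<open>W\<close>: \<open>hat_D I m G\<close> is generated by the \<open>D\<^sub>s\<close> with \<open>s\<close> a reflection in \<open>G\<close>, and \<open>hat_K I m G\<close>
  is the intersection of its conjugates by elements of \<open>G\<close>.  So \<open>G = W\<close> gives \<open>hat D(W)\<close> and
  \<open>K(W)\<close>, and \<open>G = W\<^sub>J\<close> gives \<open>hat D(W\<^sub>J)\<close> and \<open>K(W\<^sub>J)\<close>, as subsets of \<open>hat H(W)\<close>.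
\<close>

definition hat_D :: "'i set \<Rightarrow> ('i \<Rightarrow> 'i \<Rightarrow> nat) \<Rightarrow> 'i gword set set \<Rightarrow> 'i hat set" where
  "hat_D I m G = generate_ring (hat_H I m) (D_refl I m ` (reflections I m \<inter> G))"

definition hat_K :: "'i set \<Rightarrow> ('i \<Rightarrow> 'i \<Rightarrow> nat) \<Rightarrow> 'i gword set set \<Rightarrow> 'i hat set" where
  "hat_K I m G =
     (\<Inter>w\<in>G. (\<lambda>x. hat_w I m w \<otimes>\<^bsub>hat_H I m\<^esub> x \<otimes>\<^bsub>hat_H I m\<^esub> hat_w I m (inv\<^bsub>cox I m\<^esub> w)) `
               hat_D I m G)"

definition hat_D_deg_le :: "'i set \<Rightarrow> ('i \<Rightarrow> 'i \<Rightarrow> nat) \<Rightarrow> nat \<Rightarrow> 'i hat set" where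
  "hat_D_deg_le I m r =
     generate (add_monoid (hat_H I m))
       {foldr (\<otimes>\<^bsub>hat_H I m\<^esub>) (map (D_refl I m) ss) \<one>\<^bsub>hat_H I m\<^esub> | ss.
          set ss \<subseteq> reflections I m \<and> length ss \<le> r}"

definition K_pair :: "'i set \<Rightarrow> ('i \<Rightarrow> 'i \<Rightarrow> nat) \<Rightarrow> 'i \<Rightarrow> 'i \<Rightarrow> 'i hat set" where
  "K_pair I m i j =
     hat_K I m (parabolic I m {i, j}) \<inter> ker_counit I m \<inter> hat_D_deg_le I m (m i j)"

section \<open>The lower Hecke-Hopf algebra and the Hecke-Hopf algebra\<close>

text \<open>
  Both are quotients of \<open>hat H(W)\<close> by an ideal \<open>J\<close>, so the image of \<open>hat D(W)\<close> and the map from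
  \<open>\<int>W\<close> are introduced for any \<open>J\<close>.
\<close>

definition quot_D :: "'i set \<Rightarrow> ('i \<Rightarrow> 'i \<Rightarrow> nat) \<Rightarrow> 'i hat set \<Rightarrow> 'i hat set set" where
  "quot_D I m J = (\<lambda>x. J +>\<^bsub>hat_H I m\<^esub> x) ` hat_D I m (carrier (cox I m))"

definition quot_ZW ::
  "'i set \<Rightarrow> ('i \<Rightarrow> 'i \<Rightarrow> nat) \<Rightarrow> 'i hat set \<Rightarrow> ('i gword set \<Rightarrow>\<^sub>0 int) \<Rightarrow> 'i hat set" where
  "quot_ZW I m J =
     ZW_map I m (hat_H I m Quot J) (\<lambda>i. J +>\<^bsub>hat_H I m\<^esub> hat_s I m i)"

definition lower_J :: "'i set \<Rightarrow> ('i \<Rightarrow> 'i \<Rightarrow> nat) \<Rightarrow> 'i hat set" where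
  "lower_J I m = Idl\<^bsub>hat_H I m\<^esub> (hat_K I m (carrier (cox I m)) \<inter> ker_counit I m)"

definition lower_H :: "'i set \<Rightarrow> ('i \<Rightarrow> 'i \<Rightarrow> nat) \<Rightarrow> 'i hat set ring" where
  "lower_H I m = hat_H I m Quot lower_J I m"

definition hecke_J :: "'i set \<Rightarrow> ('i \<Rightarrow> 'i \<Rightarrow> nat) \<Rightarrow> 'i hat set" where
  "hecke_J I m = Idl\<^bsub>hat_H I m\<^esub> (\<Union>i\<in>I. \<Union>j\<in>I - {i}. K_pair I m i j)"

definition hecke_H :: "'i set \<Rightarrow> ('i \<Rightarrow> 'i \<Rightarrow> nat) \<Rightarrow> 'i hat set ring" where
  "hecke_H I m = hat_H I m Quot hecke_J I m"

end

theory Submission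
  imports Defs Complex_Main "HOL-Library.Function_Algebras"
begin

text \<open>
  The action of \<open>W\<close> on reflections with signs gives a cocycle \<open>neg w s\<close>, which tells whether \<open>w\<close> makes
  the root of \<open>s\<close> negative.  An element that sends one simple root to another is a product of
  dihedral elements with the same property, so the relations (iii) show that \<open>w D\<^sub>s w\<inverse>\<close> is
  \<open>D\<close> of the conjugate reflection unless \<open>neg w s\<close>; hence \<open>hat H(W)\<close> is the sum of the \<open>hat D(W) w\<close>.
  The sum is direct because \<open>hat H(W)\<close> acts on functions on pairs of a word in the reflections and an
  element of \<open>W\<close> in such a way that the elements \<open>D\<^sub>s \<cdots> D\<^sub>t w\<close> with adjacent reflections
  distinct are linearly independent.

  All conjugates of a subset of \<open>K(W)\<close> lie in \<open>hat D(W)\<close>, so the ideal \<open>J\<close> which it generates is the sum of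
  the \<open>(J \<inter> hat D(W)) w\<close>, and the decomposition passes to the quotient by \<open>J\<close>.  By minimal coset
  representatives \<open>K(W\<^sub>J)\<close> is contained in \<open>K(W)\<close> for all \<open>J\<close>, so both algebras are such quotients.
\<close>

section \<open>Monoid rings\<close>

text \<open>The algebra is given by generators and relations, while the claim is about its size.
  Relation (iii) only says that an alternating word of length \<open>m i j - 1\<close> carries one D
  to another. To use it for every element that sends a simple root to a simple root, the dihedral
  factors must have exactly this length. For that the order of a product of two generators must be
  known to be \<open>m i j\<close>, and this is why the geometric representation appears. Linear
  independence is seen in a model rather than by rewriting: a rational change of variables turns the
  idempotents D_s into elements of square zero which W permutes up to sign. The relations are then
  easy to check, and the original products are recognized by their leading terms. In the quotients
  the point is that the ideal splits along W. Left multiplication by a generator s_i does not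
  preserve the summands, but it passes a conjugate y of a generator of the ideal as s_i y = (s_i y
  s_i) s_i, where s_i y s_i is again such a conjugate.\<close>

abbreviation "keys \<equiv> Poly_Mapping.keys"

lemma frag_extend_fun_add: "frag_extend (\<lambda>a. f a + g a) x = frag_extend f x + frag_extend g x"
  by (simp add: frag_extend_def frag_cmul_distrib2 sum.distrib)

lemma frag_extend_fun_minus: "frag_extend (\<lambda>a. - f a) x = - frag_extend f x"
  using frag_extend_fun_add[of f "\<lambda>a. - f a" x] 
  by (simp add: frag_extend_def eq_neg_iff_add_eq_0 add.commute)

lemma frag_extend_fun_diff: "frag_extend (\<lambda>a. f a - g a) x = frag_extend f x - frag_extend g x"
  using frag_extend_fun_add[of f "\<lambda>a. - g a" x] by (simp add: frag_extend_fun_minus)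

lemma frag_extend_fun_0: "frag_extend (\<lambda>a. 0) x = 0"
  by (simp add: frag_extend_def)

text \<open>This identification makes the universal property of \<open>free_Abelian_group\<close>
  available for additive maps out of a monoid ring.\<close>

lemma add_monoid_monoid_ring: "add_monoid (monoid_ring M) = free_Abelian_group (carrier M)"
  by (simp add: monoid_ring_def free_Abelian_group_def)

lemma monoid_ring_simps:
  "x \<in> carrier (monoid_ring M) \<longleftrightarrow> keys x \<subseteq> carrier M"
  "x \<oplus>\<^bsub>monoid_ring M\<^esub> y = x + y" "\<zero>\<^bsub>monoid_ring M\<^esub> = 0" "\<one>\<^bsub>monoid_ring M\<^esub> = frag_of \<one>\<^bsub>M\<^esub>"
  "frag_of a \<otimes>\<^bsub>monoid_ring M\<^esub> frag_of b = frag_of (a \<otimes>\<^bsub>M\<^esub> b)"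
  "frag_of a \<in> carrier (monoid_ring M) \<longleftrightarrow> a \<in> carrier M"
  by (auto simp: monoid_ring_def)

lemma monoid_ring_mult_diff:
  "(x - y) \<otimes>\<^bsub>monoid_ring M\<^esub> z = x \<otimes>\<^bsub>monoid_ring M\<^esub> z - y \<otimes>\<^bsub>monoid_ring M\<^esub> z"
  "z \<otimes>\<^bsub>monoid_ring M\<^esub> (x - y) = z \<otimes>\<^bsub>monoid_ring M\<^esub> x - z \<otimes>\<^bsub>monoid_ring M\<^esub> y"
  "(x + y) \<otimes>\<^bsub>monoid_ring M\<^esub> z = x \<otimes>\<^bsub>monoid_ring M\<^esub> z + y \<otimes>\<^bsub>monoid_ring M\<^esub> z"
  "z \<otimes>\<^bsub>monoid_ring M\<^esub> (x + y) = z \<otimes>\<^bsub>monoid_ring M\<^esub> x + z \<otimes>\<^bsub>monoid_ring M\<^esub> y"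
  "0 \<otimes>\<^bsub>monoid_ring M\<^esub> z = 0" "z \<otimes>\<^bsub>monoid_ring M\<^esub> 0 = 0"
  by (simp_all add: monoid_ring_def frag_extend_diff frag_extend_fun_diff frag_extend_add
      frag_extend_fun_add frag_extend_fun_0)

text \<open>The product is biadditive by \<open>monoid_ring_mult_diff\<close>, so
  \<open>frag_induction\<close> in each argument reduces closure, associativity and the unit laws to
  the axioms of \<open>M\<close> on basis elements.\<close>

lemma ring_monoid_ring:
  assumes "monoid M" shows "ring (monoid_ring M)"
proof -
  interpret M: monoid M by fact
  let ?R = "monoid_ring M"
  have cl: "keys (x \<otimes>\<^bsub>?R\<^esub> y) \<subseteq> carrier M"
    if "keys x \<subseteq> carrier M" "keys y \<subseteq> carrier M" for x y
    using that(1)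
  proof (induction x rule: frag_induction)
    case (one a)
    show ?case using that(2)
    proof (induction y rule: frag_induction)
      case (diff b c)
      then show ?case using keys_diff[of "frag_of a \<otimes>\<^bsub>?R\<^esub> b" "frag_of a \<otimes>\<^bsub>?R\<^esub> c"]
        by (auto simp: monoid_ring_mult_diff)
    qed (use one in \<open>auto simp: monoid_ring_simps monoid_ring_mult_diff\<close>)
  next
    case (diff b c)
    then show ?case using keys_diff[of "b \<otimes>\<^bsub>?R\<^esub> y" "c \<otimes>\<^bsub>?R\<^esub> y"]
      by (auto simp: monoid_ring_mult_diff)
  qed (auto simp: monoid_ring_mult_diff)
  have assoc: "x \<otimes>\<^bsub>?R\<^esub> y \<otimes>\<^bsub>?R\<^esub> z = x \<otimes>\<^bsub>?R\<^esub> (y \<otimes>\<^bsub>?R\<^esub> z)"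
    if "keys x \<subseteq> carrier M" "keys y \<subseteq> carrier M"
      "keys z \<subseteq> carrier M" for x y z
    using that(1)
  proof (induction x rule: frag_induction)
    case (one a)
    show ?case using that(2)
    proof (induction y rule: frag_induction)
      case (one b)
      show ?case using that(3)
        by (induction z rule: frag_induction)
          (use one \<open>a \<in> _\<close> in \<open>auto simp: monoid_ring_simps monoid_ring_mult_diff M.m_assoc\<close>)
    qed (auto simp: monoid_ring_mult_diff)
  qed (auto simp: monoid_ring_mult_diff)
  have l1: "\<one>\<^bsub>?R\<^esub> \<otimes>\<^bsub>?R\<^esub> x = x" "x \<otimes>\<^bsub>?R\<^esub> \<one>\<^bsub>?R\<^esub> = x" if "keys x \<subseteq> carrier M" for x
    using that
    by (induction x rule: frag_induction) (auto simp: monoid_ring_simps monoid_ring_mult_diff)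
  have "comm_group (add_monoid ?R)"
    unfolding add_monoid_monoid_ring by (rule abelian_free_Abelian_group)
  then have "abelian_group ?R"
    by (rule comm_group_abelian_groupI)
  then show ?thesis
    by (rule ringI) (unfold_locales, auto simp: monoid_ring_simps monoid_ring_mult_diff cl assoc
        l1[unfolded monoid_ring_simps])
qed

lemma a_inv_monoid_ring:
  assumes "x \<in> carrier (monoid_ring M)"
  shows "\<ominus>\<^bsub>monoid_ring M\<^esub> x = - x"
proof -
  have "\<ominus>\<^bsub>monoid_ring M\<^esub> x = inv\<^bsub>free_Abelian_group (carrier M)\<^esub> x"
    unfolding a_inv_def add_monoid_monoid_ring ..
  then show ?thesis using assms by (simp add: monoid_ring_simps)
qed

text \<open>Stated for differences because the induction step of \<open>frag_induction\<close> is a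
  difference; only additivity is asked for, so that it also serves maps that are not
  multiplicative.\<close>

lemma additive_diff:
  assumes "abelian_group R" "h \<in> hom (free_Abelian_group S) (add_monoid R)"
    "keys x \<subseteq> S" "keys y \<subseteq> S"
  shows "h (x - y) = h x \<ominus>\<^bsub>R\<^esub> h y"
proof -
  interpret R: abelian_group R by fact
  interpret group_hom "free_Abelian_group S" "add_monoid R" h
    using assms R.a_group by (simp add: group_hom_def group_hom_axioms_def)
  have "h (x + (-y)) = h x \<oplus>\<^bsub>R\<^esub> h (-y)"
    using hom_mult[of x "-y"] assms by simp
  moreover have "h (-y) = \<ominus>\<^bsub>R\<^esub> h y"
    using hom_inv[of y] assms by (simp add: a_inv_def)
  ultimately show ?thesis by (simp add: a_minus_def)
qed

lemma additive_zero:
  assumes "abelian_group R" "h \<in> hom (free_Abelian_group S) (add_monoid R)"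
  shows "h 0 = \<zero>\<^bsub>R\<^esub>"
  using hom_one[OF assms(2) _ abelian_group.a_group[OF assms(1)]] by simp

lemma additive_sum:
  assumes "abelian_group R" "h \<in> hom (free_Abelian_group S) (add_monoid R)" "finite A"
    "\<And>i. i \<in> A \<Longrightarrow> keys (f i) \<subseteq> S"
  shows "keys (sum f A) \<subseteq> S" "h (sum f A) = (\<Oplus>\<^bsub>R\<^esub>i\<in>A. h (f i))"
proof -
  interpret R: abelian_group R by fact
  interpret group_hom "free_Abelian_group S" "add_monoid R" h
    using assms R.a_group by (simp add: group_hom_def group_hom_axioms_def)
  have "keys (sum f A) \<subseteq> S \<and> h (sum f A) = (\<Oplus>\<^bsub>R\<^esub>i\<in>A. h (f i))" using assms(3,4)
  proof (induction A)
    case (insert a A)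
    then have k: "keys (f a) \<subseteq> S" "keys (sum f A) \<subseteq> S" by auto
    have "h (f a + sum f A) = h (f a) \<oplus>\<^bsub>R\<^esub> h (sum f A)" using hom_mult[of "f a" "sum f A"] k by simp
    moreover have "(\<Oplus>\<^bsub>R\<^esub>i\<in>insert a A. h (f i)) = h (f a) \<oplus>\<^bsub>R\<^esub> (\<Oplus>\<^bsub>R\<^esub>i\<in>A. h (f i))"
      using insert hom_closed by (intro R.finsum_insert) auto
    ultimately show ?case using insert k keys_add[of "f a" "sum f A"] by auto
  qed (simp add: additive_zero[OF assms(1,2)])
  then show "keys (sum f A) \<subseteq> S" "h (sum f A) = (\<Oplus>\<^bsub>R\<^esub>i\<in>A. h (f i))" by auto
qed

lemma ring_hom_additive:
  assumes "h \<in> ring_hom (monoid_ring M) R"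
  shows "h \<in> hom (free_Abelian_group (carrier M)) (add_monoid R)"
  using assms by (auto simp: ring_hom_def hom_def monoid_ring_def free_Abelian_group_def)

lemma monoid_ring_hom_unique:
  assumes "abelian_group R" "h \<in> hom (free_Abelian_group S) (add_monoid R)"
    "h' \<in> hom (free_Abelian_group S) (add_monoid R)"
    "\<And>a. a \<in> S \<Longrightarrow> h (frag_of a) = h' (frag_of a)" "keys x \<subseteq> S"
  shows "h x = h' x"
proof -
  \<comment> \<open>The support bound is proved along with the equation, as the \<open>diff\<close>
    case of \<open>frag_induction\<close> says nothing about the keys of the two parts. The same
    device recurs below.\<close>
  have "keys x \<subseteq> S \<and> h x = h' x" using assms(5)
  proof (induction x rule: frag_induction)
    case (diff a b)
    then show ?case
      using keys_diff[of a b] additive_diff[OF assms(1,2)] additive_diff[OF assms(1,3)]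
      by (auto 4 3)
  qed (use assms in \<open>auto simp: additive_zero[OF assms(1)]\<close>)
  then show ?thesis by simp
qed

text \<open>The additive extension of \<open>f\<close> comes from the free abelian group. Both sides
  of multiplicativity are biadditive, so it is enough to compare them on pairs of basis
  elements.\<close>

lemma monoid_ring_universal:
  assumes "monoid M" "ring R" "\<And>a. a \<in> carrier M \<Longrightarrow> f a \<in> carrier R"
    "\<And>a b. a \<in> carrier M \<Longrightarrow> b \<in> carrier M \<Longrightarrow> f (a \<otimes>\<^bsub>M\<^esub> b) = f a \<otimes>\<^bsub>R\<^esub> f b"
    "f \<one>\<^bsub>M\<^esub> = \<one>\<^bsub>R\<^esub>"
  obtains h where "h \<in> ring_hom (monoid_ring M) R" "\<And>a. a \<in> carrier M \<Longrightarrow> h (frag_of a) = f a"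
proof -
  interpret M: monoid M by fact
  interpret R: ring R by fact
  have "f ` carrier M \<subseteq> carrier (add_monoid R)" using assms by auto
  then obtain h where h: "h \<in> hom (free_Abelian_group (carrier M)) (add_monoid R)"
    and of: "\<And>a. a \<in> carrier M \<Longrightarrow> h (frag_of a) = f a"
    using comm_group.free_Abelian_group_universal[OF R.a_comm_group] by blast
  note ad = additive_diff[OF R.is_abelian_group h] and az = additive_zero[OF R.is_abelian_group h]
  have cl: "keys x \<subseteq> carrier M \<Longrightarrow> h x \<in> carrier R" for x
    using h by (auto simp: hom_def Pi_def free_Abelian_group_def)
  let ?S = "monoid_ring M"
  interpret S: ring ?S by (rule ring_monoid_ring) fact
  have kc: "keys (x \<otimes>\<^bsub>?S\<^esub> y) \<subseteq> carrier M"
    if "keys x \<subseteq> carrier M" "keys y \<subseteq> carrier M" for x y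
    using S.m_closed[of x y] that by (simp add: monoid_ring_simps)
  have kd: "keys (x - y) \<subseteq> carrier M"
    if "keys x \<subseteq> carrier M" "keys y \<subseteq> carrier M" for x y :: "'a \<Rightarrow>\<^sub>0 int"
    using keys_diff[of x y] that by blast
  have mult: "keys x \<subseteq> carrier M \<and> h (x \<otimes>\<^bsub>?S\<^esub> y) = h x \<otimes>\<^bsub>R\<^esub> h y"
    if x: "keys x \<subseteq> carrier M" and y: "keys y \<subseteq> carrier M" for x y
    using x
  proof (induction x rule: frag_induction)
    case (one a)
    have "keys y \<subseteq> carrier M \<and> h (frag_of a \<otimes>\<^bsub>?S\<^esub> y) = h (frag_of a) \<otimes>\<^bsub>R\<^esub> h y"
      using y
    proof (induction y rule: frag_induction)
      case (one b) then show ?case using \<open>a \<in> _\<close> assms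
        by (auto simp: monoid_ring_simps of)
    next
      case (diff b c)
      then show ?case using \<open>a \<in> _\<close> assms
        by (auto simp: monoid_ring_mult_diff ad kc kd cl of a_minus_def R.r_distr R.r_minus)
    qed (use assms one in \<open>auto simp: monoid_ring_mult_diff az of\<close>)
    then show ?case using one by auto
  next
    case (diff b c)
    then show ?case
      by (auto simp: monoid_ring_mult_diff ad kc kd cl y a_minus_def R.l_distr R.l_minus)
  qed (use y in \<open>auto simp: monoid_ring_mult_diff az cl\<close>)
  have "h \<in> ring_hom ?S R"
  proof (rule ring_hom_memI)
    fix x y assume "x \<in> carrier ?S" "y \<in> carrier ?S"
    then show "h (x \<otimes>\<^bsub>?S\<^esub> y) = h x \<otimes>\<^bsub>R\<^esub> h y" "h (x \<oplus>\<^bsub>?S\<^esub> y) = h x \<oplus>\<^bsub>R\<^esub> h y"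
      using mult[of x y] hom_mult[OF h, of x y] by (auto simp: monoid_ring_simps)
  qed (use assms in \<open>auto simp: monoid_ring_simps of cl\<close>)
  then show ?thesis using of that by blast
qed

section \<open>Combinations and factorizations\<close>

text \<open>\<open>D\<close> is only a set and the sums run over finite subsets of \<open>W\<close>:
  the coefficients will be taken from hat D(W), from its image in a quotient and from its
  intersection with an ideal.\<close>

definition comb :: "('h, 'x) ring_scheme \<Rightarrow> 'h set \<Rightarrow> ('w \<Rightarrow> 'h) \<Rightarrow> 'w set \<Rightarrow> 'h set" where
  "comb H D u W = {finsum H (\<lambda>w. \<delta> w \<otimes>\<^bsub>H\<^esub> u w) F | F \<delta>. finite F \<and> F \<subseteq> W \<and> \<delta> \<in> F \<rightarrow> D}"

context ring begin

text \<open>Two combinations with different supports can be added or compared after padding both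
  with zero coefficients to the union of the supports.\<close>

lemma finsum_extend_zero:
  assumes "finite F" "F \<subseteq> G" "finite G" "\<delta> \<in> F \<rightarrow> carrier R" "u \<in> G \<rightarrow> carrier R"
  shows "(\<Oplus>w\<in>F. \<delta> w \<otimes> u w) = (\<Oplus>w\<in>G. (if w \<in> F then \<delta> w else \<zero>) \<otimes> u w)"
  by (rule add.finprod_mono_neutral_cong_left) (use assms in \<open>auto simp: Pi_iff\<close>)

lemma comb_add:
  assumes "additive_subgroup D R" "u \<in> W \<rightarrow> carrier R" "x \<in> comb R D u W" "y \<in> comb R D u W"
  shows "x \<oplus> y \<in> comb R D u W"
proof -
  interpret D: additive_subgroup D R by fact
  obtain F \<delta> G \<epsilon> where F: "finite F" "F \<subseteq> W" "\<delta> \<in> F \<rightarrow> D" "x = (\<Oplus>w\<in>F. \<delta> w \<otimes> u w)"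
    and G: "finite G" "G \<subseteq> W" "\<epsilon> \<in> G \<rightarrow> D" "y = (\<Oplus>w\<in>G. \<epsilon> w \<otimes> u w)"
    using assms(3,4) by (auto simp: comb_def)
  have Dc: "\<And>d. d \<in> D \<Longrightarrow> d \<in> carrier R" using D.a_subset by auto
  let ?\<delta> = "\<lambda>w. if w \<in> F then \<delta> w else \<zero>" and ?\<epsilon> = "\<lambda>w. if w \<in> G then \<epsilon> w else \<zero>"
  have x: "x = (\<Oplus>w\<in>F \<union> G. ?\<delta> w \<otimes> u w)" and y: "y = (\<Oplus>w\<in>F \<union> G. ?\<epsilon> w \<otimes> u w)"
    using F G assms(2) Dc by (auto simp: Pi_iff subset_iff intro!: finsum_extend_zero)
  have "x \<oplus> y = (\<Oplus>w\<in>F \<union> G. ?\<delta> w \<otimes> u w \<oplus> ?\<epsilon> w \<otimes> u w)"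
    unfolding x y by (rule finsum_addf[symmetric]) (use F G assms(2) Dc in \<open>auto simp: Pi_iff subset_iff\<close>)
  also have "\<dots> = (\<Oplus>w\<in>F \<union> G. (?\<delta> w \<oplus> ?\<epsilon> w) \<otimes> u w)"
    by (rule finsum_cong') (use F G assms(2) Dc in \<open>auto simp: Pi_iff subset_iff l_distr\<close>)
  finally show ?thesis unfolding comb_def using F G
    by (intro CollectI exI[of _ "F \<union> G"] exI[of _ "\<lambda>w. ?\<delta> w \<oplus> ?\<epsilon> w"])
      (auto simp: Pi_iff intro!: D.a_closed)
qed

lemma comb_incl:
  assumes "d \<in> D" "w \<in> W" "D \<subseteq> carrier R" "u \<in> W \<rightarrow> carrier R"
  shows "d \<otimes> u w \<in> comb R D u W"
  unfolding comb_def using assms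
  by (intro CollectI exI[of _ "{w}"] exI[of _ "\<lambda>_. d"]) (auto simp: Pi_iff subset_iff)

lemma comb_induct:
  assumes "x \<in> comb R D u W" "D \<subseteq> carrier R" "u \<in> W \<rightarrow> carrier R" "P \<zero>"
    "\<And>d w. d \<in> D \<Longrightarrow> w \<in> W \<Longrightarrow> P (d \<otimes> u w)"
    "\<And>x y. x \<in> carrier R \<Longrightarrow> y \<in> carrier R \<Longrightarrow> P x \<Longrightarrow> P y \<Longrightarrow> P (x \<oplus> y)"
  shows "P x"
proof -
  obtain F \<delta> where F: "finite F" "F \<subseteq> W" "\<delta> \<in> F \<rightarrow> D" "x = (\<Oplus>w\<in>F. \<delta> w \<otimes> u w)"
    using assms(1) by (auto simp: comb_def)
  have "P (\<Oplus>w\<in>F. \<delta> w \<otimes> u w)" using F(1-3)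
  proof (induction F)
    case empty then show ?case using assms by simp
  next
    case (insert a F)
    then have "(\<Oplus>w\<in>insert a F. \<delta> w \<otimes> u w) = \<delta> a \<otimes> u a \<oplus> (\<Oplus>w\<in>F. \<delta> w \<otimes> u w)"
      using assms(2,3) by (intro finsum_insert) (auto simp: Pi_iff subset_iff)
    moreover have "(\<Oplus>w\<in>F. \<delta> w \<otimes> u w) \<in> carrier R"
      using insert assms(2,3) by (intro finsum_closed) (auto simp: Pi_iff subset_iff)
    moreover have "\<delta> a \<otimes> u a \<in> carrier R" using insert assms(2,3) by (auto simp: Pi_iff subset_iff)
    ultimately show ?case using insert assms(5,6) by (simp add: Pi_iff)
  qed
  then show ?thesis using F by simp
qed

lemma comb_zero: "\<zero> \<in> comb R D u W"
  unfolding comb_def by (intro CollectI exI[of _ "{}"]) auto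

end

text \<open>Modulo the tensor relations every element is a sum of
  \<open>\<delta> w \<otimes> w\<close> over basis elements \<open>w\<close> of the monoid ring. If
  the multiplication map kills it, \<open>direct\<close> makes all \<open>\<delta> w\<close> zero,
  so the kernel is exactly the group of relations. With \<open>span\<close> for surjectivity, the
  first isomorphism theorem gives the factorization.\<close>

lemma (in ring) factorization_monoid_ringI:
  assumes D: "additive_subgroup D R" and M: "monoid M" and \<phi>: "\<phi> \<in> ring_hom (monoid_ring M) R"
    and span: "carrier R \<subseteq> comb R D (\<lambda>w. \<phi> (frag_of w)) (carrier M)"
    and direct: "\<And>F \<delta>. finite F \<Longrightarrow> F \<subseteq> carrier M \<Longrightarrow> \<delta> \<in> F \<rightarrow> D \<Longrightarrow>
      (\<Oplus>w\<in>F. \<delta> w \<otimes> \<phi> (frag_of w)) = \<zero> \<Longrightarrow> \<forall>w\<in>F. \<delta> w = \<zero>"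
  shows "factorization R D (monoid_ring M) \<phi>"
proof -
  interpret D: additive_subgroup D R by fact
  interpret A: ring "monoid_ring M" by (rule ring_monoid_ring) fact
  let ?A = "monoid_ring M" and ?DR = "add_monoid (R\<lparr>carrier := D\<rparr>)"
  let ?S = "D \<times> carrier ?A"
  let ?F = "free_Abelian_group ?S"
  define T where "T = tensor_rels ?DR (add_monoid ?A)"
  have Dc: "\<And>d. d \<in> D \<Longrightarrow> d \<in> carrier R" using D.a_subset by auto
  have \<phi>c: "\<And>x. x \<in> carrier ?A \<Longrightarrow> \<phi> x \<in> carrier R" using \<phi> by (rule ring_hom_closed)
  have "(\<lambda>(d, x). d \<otimes> \<phi> x) ` ?S \<subseteq> carrier (add_monoid R)" using Dc \<phi>c by auto
  note univ = comm_group.free_Abelian_group_universal[OF a_comm_group this]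
  obtain g where g: "g \<in> hom ?F (add_monoid R)"
    and of': "\<And>p. p \<in> ?S \<Longrightarrow> g (frag_of p) = (\<lambda>(d, x). d \<otimes> \<phi> x) p"
    using univ by blast
  have of: "g (frag_of (d, x)) = d \<otimes> \<phi> x" if "d \<in> D" "x \<in> carrier ?A" for d x
    using of' that by auto
  note ad = additive_diff[OF is_abelian_group g] and az = additive_zero[OF is_abelian_group g]
  have gc: "g c \<in> carrier R" if "keys c \<subseteq> ?S" for c
    using g that by (auto simp: hom_def Pi_def)
  interpret g: group_hom ?F "add_monoid R" g
    using g by (simp add: group_hom_def group_hom_axioms_def a_group)
  define rels where "rels = {frag_of (a \<oplus> a', b) - frag_of (a, b) - frag_of (a', b) | a a' b.
           a \<in> D \<and> a' \<in> D \<and> b \<in> carrier ?A} \<union>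
        {frag_of (a, b + b') - frag_of (a, b) - frag_of (a, b') | a b b'.
           a \<in> D \<and> b \<in> carrier ?A \<and> b' \<in> carrier ?A}"
  have T: "T = generate ?F rels"
    unfolding T_def tensor_rels_def rels_def by (simp add: monoid_ring_simps)
  have kd: "keys (x - y) \<subseteq> ?S"
    if "keys x \<subseteq> ?S" "keys y \<subseteq> ?S" for x y :: "'a \<times> ('c \<Rightarrow>\<^sub>0 int) \<Rightarrow>\<^sub>0 int"
    using keys_diff[of x y] that by blast
  have cancel: "x \<oplus> y \<ominus> x \<ominus> y = \<zero>" if "x \<in> carrier R" "y \<in> carrier R" for x y
    using that by algebra
  have rk: "rels \<subseteq> kernel ?F (add_monoid R) g"
  proof
    fix r assume "r \<in> rels"
    then consider a a' b where "r = frag_of (a \<oplus> a', b) - frag_of (a, b) - frag_of (a', b)"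
        "a \<in> D" "a' \<in> D" "b \<in> carrier ?A"
      | a b b' where "r = frag_of (a, b + b') - frag_of (a, b) - frag_of (a, b')"
        "a \<in> D" "b \<in> carrier ?A" "b' \<in> carrier ?A"
      unfolding rels_def by blast
    then show "r \<in> kernel ?F (add_monoid R) g"
    proof cases
      case 1
      have "g r = (a \<oplus> a') \<otimes> \<phi> b \<ominus> a \<otimes> \<phi> b \<ominus> a' \<otimes> \<phi> b"
        using 1 by (simp add: ad kd of)
      also have "\<dots> = \<zero>" using 1 Dc \<phi>c[of b] by (simp add: l_distr cancel)
      finally show ?thesis using 1 kd[OF kd, of "frag_of (a \<oplus> a', b)" "frag_of (a, b)" "frag_of (a', b)"]
        by (simp add: kernel_def)
    next
      case 2
      have bb: "b + b' \<in> carrier ?A" using 2 A.a_closed[of b b'] by (simp add: monoid_ring_simps)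
      have "\<phi> (b + b') = \<phi> b \<oplus> \<phi> b'"
        using ring_hom_add[OF \<phi>, of b b'] 2 by (simp add: monoid_ring_simps)
      then have "g r = a \<otimes> (\<phi> b \<oplus> \<phi> b') \<ominus> a \<otimes> \<phi> b \<ominus> a \<otimes> \<phi> b'"
        using 2 bb by (simp add: ad kd of)
      also have "\<dots> = \<zero>" using 2 Dc \<phi>c[of b] \<phi>c[of b'] by (simp add: r_distr cancel)
      finally show ?thesis using 2 bb kd[OF kd, of "frag_of (a, b + b')" "frag_of (a, b)" "frag_of (a, b')"]
        by (simp add: kernel_def)
    qed
  qed
  have relsF: "rels \<subseteq> carrier ?F" using rk by (auto simp: kernel_def)
  have Tsub: "subgroup T ?F" unfolding T by (rule group.generate_is_subgroup[OF group_free_Abelian_group]) fact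
  have Tk: "T \<subseteq> kernel ?F (add_monoid R) g"
    unfolding T by (rule group.generate_subgroup_incl[OF group_free_Abelian_group rk g.subgroup_kernel])
  have T0: "0 \<in> T" using subgroup.one_closed[OF Tsub] by simp
  have Tadd: "x + y \<in> T" if "x \<in> T" "y \<in> T" for x y
    using subgroup.m_closed[OF Tsub that] by simp
  have TF: "keys x \<subseteq> ?S" if "x \<in> T" for x
    using subsetD[OF subgroup.subset[OF Tsub] that] by (simp only: carrier_free_Abelian_group_iff)
  have Tneg: "- x \<in> T" if "x \<in> T" for x
    using subgroup.m_inv_closed[OF Tsub that] TF[OF that] by simp
  have Tdiff: "x - y \<in> T" if "x \<in> T" "y \<in> T" for x y
    using Tadd[OF that(1) Tneg[OF that(2)]] by simp
  have Tsum: "(\<Sum>i\<in>K. f i) \<in> T" if "finite K" "\<And>i. i \<in> K \<Longrightarrow> f i \<in> T"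
    for K and f :: "'c \<Rightarrow> _" using that by (induction K) (auto simp: T0 Tadd)
  have relT: "r \<in> T" if "r \<in> rels" for r unfolding T using that by (rule generate.incl)
  have Tl: "frag_of (a \<oplus> a', b) - frag_of (a, b) - frag_of (a', b) \<in> T"
    if "a \<in> D" "a' \<in> D" "b \<in> carrier ?A" for a a' b using relT that unfolding rels_def by blast
  have Tr: "frag_of (a, b + b') - frag_of (a, b) - frag_of (a, b') \<in> T"
    if "a \<in> D" "b \<in> carrier ?A" "b' \<in> carrier ?A" for a b b' using relT that unfolding rels_def by blast
  have Tl0: "frag_of (\<zero>, b) \<in> T" if "b \<in> carrier ?A" for b
    using Tneg[OF Tl[of \<zero> \<zero> b]] that by simp
  have Tr0: "frag_of (a, 0) \<in> T" if "a \<in> D" for a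
    using Tneg[OF Tr[of a 0 0]] that by (simp add: monoid_ring_simps)
  \<comment> \<open>Differences again, to match the \<open>diff\<close> case of the inductions that
    follow.\<close>
  have Tlm: "frag_of (a \<ominus> a', b) - (frag_of (a, b) - frag_of (a', b)) \<in> T"
    if "a \<in> D" "a' \<in> D" "b \<in> carrier ?A" for a a' b
  proof -
    have "a \<ominus> a' \<in> D" using that by (simp add: a_minus_def)
    moreover have "a \<ominus> a' \<oplus> a' = a" using Dc[OF that(1)] Dc[OF that(2)] by algebra
    ultimately have "frag_of (a, b) - frag_of (a \<ominus> a', b) - frag_of (a', b) \<in> T"
      using Tl[of "a \<ominus> a'" a' b] that by simp
    then show ?thesis using Tneg by (fastforce simp: algebra_simps)
  qed
  have Trm: "frag_of (a, b - b') - (frag_of (a, b) - frag_of (a, b')) \<in> T"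
    if "a \<in> D" "b \<in> carrier ?A" "b' \<in> carrier ?A" for a b b'
  proof -
    have "b - b' \<in> carrier ?A" using that keys_diff[of b b'] by (auto simp: monoid_ring_simps)
    then have "frag_of (a, b) - frag_of (a, b - b') - frag_of (a, b') \<in> T"
      using Tr[of a "b - b'" b'] that by simp
    then show ?thesis using Tneg by (fastforce simp: algebra_simps)
  qed
  define \<sigma> where "\<sigma> \<delta> F = (\<Sum>w\<in>F. frag_of (\<delta> w, frag_of w))" for \<delta> :: "'c \<Rightarrow> 'a" and F
  \<comment> \<open>Asking for the congruence for every finite \<open>G\<close> that contains
    \<open>F\<close> says that the coefficients outside \<open>F\<close> contribute nothing modulo
    \<open>T\<close>; two such normal forms can then be subtracted on the union of their
    supports.\<close>
  define Q where "Q c \<longleftrightarrow> (\<exists>F \<delta>. finite F \<and> F \<subseteq> carrier M \<and> range \<delta> \<subseteq> D \<and>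
      (\<forall>G. finite G \<and> F \<subseteq> G \<and> G \<subseteq> carrier M \<longrightarrow> c - \<sigma> \<delta> G \<in> T))" for c
  have Qdiff: "Q (c - c')" if "Q c" "Q c'" for c c'
  proof -
    obtain F \<delta> where F: "finite F" "F \<subseteq> carrier M" "range \<delta> \<subseteq> D"
      "\<forall>G. finite G \<and> F \<subseteq> G \<and> G \<subseteq> carrier M \<longrightarrow> c - \<sigma> \<delta> G \<in> T"
      using \<open>Q c\<close> unfolding Q_def by (elim exE conjE)
    obtain F' \<epsilon> where F': "finite F'" "F' \<subseteq> carrier M" "range \<epsilon> \<subseteq> D"
      "\<forall>G. finite G \<and> F' \<subseteq> G \<and> G \<subseteq> carrier M \<longrightarrow> c' - \<sigma> \<epsilon> G \<in> T"
      using \<open>Q c'\<close> unfolding Q_def by (elim exE conjE)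
    have "c - c' - \<sigma> (\<lambda>w. \<delta> w \<ominus> \<epsilon> w) G \<in> T" if G: "finite G" "F \<union> F' \<subseteq> G" "G \<subseteq> carrier M" for G
    proof -
      have "(\<Sum>w\<in>G. frag_of (\<delta> w \<ominus> \<epsilon> w, frag_of w) -
          (frag_of (\<delta> w, frag_of w) - frag_of (\<epsilon> w, frag_of w))) \<in> T"
        using F(3) F'(3) G by (intro Tsum Tlm) (auto simp: monoid_ring_simps)
      moreover have "c - \<sigma> \<delta> G \<in> T" "c' - \<sigma> \<epsilon> G \<in> T" using F(4) F'(4) G by simp_all
      ultimately show ?thesis using Tdiff[OF Tdiff, of "c - \<sigma> \<delta> G" "c' - \<sigma> \<epsilon> G"]
        by (fastforce simp: \<sigma>_def sum_subtractf sum.distrib algebra_simps)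
    qed
    moreover have "range (\<lambda>w. \<delta> w \<ominus> \<epsilon> w) \<subseteq> D"
      using F(3) F'(3) by (auto simp: a_minus_def intro!: D.a_closed)
    ultimately show ?thesis unfolding Q_def using F(1,2) F'(1,2)
      by (intro exI[of _ "F \<union> F'"] exI[of _ "\<lambda>w. \<delta> w \<ominus> \<epsilon> w"]) auto
  qed
  have \<sigma>0: "\<sigma> \<delta> F \<in> T" if "finite F" "F \<subseteq> carrier M" "\<And>w. w \<in> F \<Longrightarrow> \<delta> w = \<zero>" for \<delta> F
    unfolding \<sigma>_def using that by (intro Tsum) (auto simp: monoid_ring_simps intro!: Tl0)
  have Q0: "Q 0" unfolding Q_def
    by (intro exI[of _ "{}"] exI[of _ "\<lambda>_. \<zero>"]) (auto intro!: Tneg \<sigma>0)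
  have QT: "Q c" if "c - c' \<in> T" "Q c'" for c c'
  proof -
    have "c - x \<in> T" if "c' - x \<in> T" for x
      using Tadd[OF \<open>c - c' \<in> T\<close> that] by simp
    then show ?thesis using \<open>Q c'\<close> unfolding Q_def by meson
  qed
  have Qof: "keys x \<subseteq> carrier M \<and> Q (frag_of (d, x))"
    if "d \<in> D" "keys x \<subseteq> carrier M" for d x using that(2)
  proof (induction x rule: frag_induction)
    case zero then show ?case using QT[of "frag_of (d, 0)" 0] Tr0 that Q0 by auto
  next
    case (one w)
    let ?\<delta> = "\<lambda>v. if v = w then d else \<zero>"
    have "frag_of (d, frag_of w) - \<sigma> ?\<delta> G \<in> T" if G: "finite G" "{w} \<subseteq> G" "G \<subseteq> carrier M" for G
    proof -
      have "\<sigma> ?\<delta> G = frag_of (d, frag_of w) + \<sigma> ?\<delta> (G - {w})"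
        using G by (simp add: \<sigma>_def sum.remove)
      moreover have "\<sigma> ?\<delta> (G - {w}) \<in> T" using G by (intro \<sigma>0) auto
      ultimately show ?thesis using Tneg by simp
    qed
    then show ?case unfolding Q_def using one \<open>d \<in> D\<close>
      by (auto intro!: exI[of _ "{w}"] exI[of _ ?\<delta>])
  next
    case (diff a b)
    then show ?case using QT[OF Trm[of d a b] Qdiff] that keys_diff[of a b]
      by (auto simp: monoid_ring_simps)
  qed
  have Qall: "Q c" if "keys c \<subseteq> ?S" for c using that
    by (induction c rule: frag_induction) (auto simp: Q0 Qdiff Qof monoid_ring_simps)
  have ker: "kernel ?F (add_monoid R) g \<subseteq> T"
  proof
    fix c assume c: "c \<in> kernel ?F (add_monoid R) g"
    then have ck: "keys c \<subseteq> ?S" "g c = \<zero>" by (auto simp: kernel_def)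
    obtain F \<delta> where F: "finite F" "F \<subseteq> carrier M" "range \<delta> \<subseteq> D" "c - \<sigma> \<delta> F \<in> T"
      using Qall[OF ck(1)] unfolding Q_def by (elim exE conjE) simp
    have \<delta>: "\<delta> w \<in> D" for w using F(3) by blast
    have \<delta>c: "\<delta> w \<otimes> \<phi> (frag_of w) \<in> carrier R" "keys (frag_of (\<delta> w, frag_of w)) \<subseteq> ?S"
      "g (frag_of (\<delta> w, frag_of w)) = \<delta> w \<otimes> \<phi> (frag_of w)" if "w \<in> F" for w
      using \<delta> Dc[OF \<delta>] \<phi>c[of "frag_of w"] that F(2) by (auto simp: of monoid_ring_simps)
    have gs: "keys (\<sigma> \<delta> F) \<subseteq> ?S" "g (\<sigma> \<delta> F) = (\<Oplus>w\<in>F. g (frag_of (\<delta> w, frag_of w)))"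
      unfolding \<sigma>_def by (rule additive_sum[OF is_abelian_group g F(1)], erule \<delta>c(2))+
    have "g (\<sigma> \<delta> F) = (\<Oplus>w\<in>F. \<delta> w \<otimes> \<phi> (frag_of w))"
      unfolding gs(2) using \<delta>c by (intro finsum_cong') auto
    moreover have "g (c - \<sigma> \<delta> F) = \<zero>" using F(4) Tk by (auto simp: kernel_def)
    ultimately have "\<zero> \<ominus> (\<Oplus>w\<in>F. \<delta> w \<otimes> \<phi> (frag_of w)) = \<zero>" using ad[OF ck(1) gs(1)] ck(2) by simp
    moreover have "(\<Oplus>w\<in>F. \<delta> w \<otimes> \<phi> (frag_of w)) \<in> carrier R"
      using \<delta>c by (intro finsum_closed) auto
    ultimately have "(\<Oplus>w\<in>F. \<delta> w \<otimes> \<phi> (frag_of w)) = \<zero>" by (simp add: a_minus_def)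
    then have "\<forall>w\<in>F. \<delta> w = \<zero>" using \<delta> by (intro direct F(1,2)) auto
    then have "\<sigma> \<delta> F \<in> T" using F(1,2) by (intro \<sigma>0) auto
    from Tadd[OF F(4) this] show "c \<in> T" by simp
  qed
  then have TK: "T = kernel ?F (add_monoid R) g" using Tk by (rule antisym[rotated])
  have "carrier R \<subseteq> g ` carrier ?F"
  proof
    fix x assume "x \<in> carrier R"
    then have "x \<in> comb R D (\<lambda>w. \<phi> (frag_of w)) (carrier M)" using span by auto
    then show "x \<in> g ` carrier ?F"
    proof (rule comb_induct)
      show "\<zero> \<in> g ` carrier ?F" using az by force
      show "d \<otimes> \<phi> (frag_of w) \<in> g ` carrier ?F" if "d \<in> D" "w \<in> carrier M" for d w
        by (rule image_eqI[of _ _ "frag_of (d, frag_of w)"]) (use that of in \<open>auto simp: monoid_ring_simps\<close>)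
      show "x \<oplus> y \<in> g ` carrier ?F" if xy: "x \<in> g ` carrier ?F" "y \<in> g ` carrier ?F" for x y
      proof -
        obtain a b where "x = g a" "y = g b" "a \<in> carrier ?F" "b \<in> carrier ?F" using xy by (elim imageE)
        moreover from this have "g (a + b) = x \<oplus> y" "a + b \<in> carrier ?F"
          using g.hom_mult[of a b] keys_add[of a b] by auto
        ultimately show ?thesis by (metis imageI)
      qed
    qed (auto simp: Dc \<phi>c monoid_ring_simps)
  qed
  then have "g ` carrier ?F = carrier (add_monoid R)" using gc by auto
  \<comment> \<open>The kernel of \<open>g\<close> is \<open>T\<close>, so the quotient in the first
    isomorphism theorem is the tensor product itself; it remains to evaluate the induced map on the
    coset of a single pair.\<close>
  from g.FactGroup_iso_set[OF this]
  have iso: "(\<lambda>C. the_elem (g ` C)) \<in> iso (tensor ?DR (add_monoid ?A)) (add_monoid R)"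
    unfolding tensor_def TK[symmetric] by (simp add: T_def)
  have "the_elem (g ` pure_tensor ?DR (add_monoid ?A) d x) = d \<otimes> \<phi> x"
    if "d \<in> D" "x \<in> carrier ?A" for d x
  proof -
    have "pure_tensor ?DR (add_monoid ?A) d x = T #>\<^bsub>?F\<^esub> frag_of (d, x)"
      unfolding pure_tensor_def T_def by simp
    also have "g ` \<dots> = {d \<otimes> \<phi> x}"
    proof -
      have "g (t + frag_of (d, x)) = d \<otimes> \<phi> x" if "t \<in> T" for t
        using g.hom_mult[of t "frag_of (d, x)"] TF[OF \<open>t \<in> T\<close>] Tk that \<open>d \<in> D\<close> \<open>x \<in> _\<close>
        by (auto simp: kernel_def of Dc \<phi>c)
      then have "(\<lambda>t. g (t + frag_of (d, x))) ` T = (\<lambda>t. d \<otimes> \<phi> x) ` T"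
        by (rule image_cong[OF refl])
      also have "\<dots> = {d \<otimes> \<phi> x}" using T0 by (rule image_constant)
      finally show ?thesis by (simp add: r_coset_def UNION_singleton_eq_range image_image)
    qed
    finally show ?thesis by simp
  qed
  then show ?thesis unfolding factorization_def
    by (intro bexI[OF _ iso] ballI)
qed

section \<open>Presented groups\<close>

lemma gwords_simps [simp]:
  "[] \<in> gwords A" "p # u \<in> gwords A \<longleftrightarrow> fst p \<in> A \<and> u \<in> gwords A"
  "u @ v \<in> gwords A \<longleftrightarrow> u \<in> gwords A \<and> v \<in> gwords A"
  by (auto simp: gwords_def mem_Times_iff)

locale presentation =
  fixes A :: "'x set" and R :: "'x gword set"
  assumes relators: "R \<subseteq> gwords A"
begin

abbreviation cls :: "'x gword \<Rightarrow> 'x gword set" where "cls u \<equiv> gword_eq A R `` {u}"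

lemma gword_eq_refl: "(u, u) \<in> gword_eq A R"
  by (simp add: gword_eq_def)

lemma gword_eq_trans: "(u, v) \<in> gword_eq A R \<Longrightarrow> (v, w) \<in> gword_eq A R \<Longrightarrow> (u, w) \<in> gword_eq A R"
  unfolding gword_eq_def by (rule rtrancl_trans)

lemma gword_eq_sym: "(u, v) \<in> gword_eq A R \<Longrightarrow> (v, u) \<in> gword_eq A R"
proof -
  have "sym (gword_step A R \<union> (gword_step A R)\<inverse>)" by (auto simp: sym_def)
  then show "(u, v) \<in> gword_eq A R \<Longrightarrow> (v, u) \<in> gword_eq A R"
    unfolding gword_eq_def by (meson sym_rtrancl symD)
qed

lemma gword_step_context:
  assumes "(u, v) \<in> gword_step A R" "a \<in> gwords A" "b \<in> gwords A"
  shows "(a @ u @ b, a @ v @ b) \<in> gword_step A R"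
proof -
  obtain p r q where "u = p @ r @ q" "v = p @ q" "p \<in> gwords A" "q \<in> gwords A"
    "r \<in> R \<union> {[(x, b), (x, \<not> b)] | x b. x \<in> A}"
    using assms(1) unfolding gword_step_def by blast
  then show ?thesis using assms(2,3) unfolding gword_step_def
    by (intro CollectI exI[of _ "a @ p"] exI[of _ r] exI[of _ "q @ b"]) auto
qed

lemma gword_eq_context:
  assumes "(u, v) \<in> gword_eq A R" "a \<in> gwords A" "b \<in> gwords A"
  shows "(a @ u @ b, a @ v @ b) \<in> gword_eq A R"
  using assms(1) unfolding gword_eq_def
proof (induction rule: rtrancl_induct)
  case (step v w)
  then have "(a @ v @ b, a @ w @ b) \<in> gword_step A R \<union> (gword_step A R)\<inverse>"
    using gword_step_context assms(2,3) by blast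
  with step.IH show ?case by (rule rtrancl_into_rtrancl)
qed auto

text \<open>The relation lives on all lists, but every step inserts or removes a relator or a
  cancelling pair over \<open>A\<close> between words over \<open>A\<close>, so the class of a word
  over \<open>A\<close> consists of such words.\<close>

lemma gword_eq_gwords:
  assumes "(u, v) \<in> gword_eq A R"
  shows "u \<in> gwords A \<longleftrightarrow> v \<in> gwords A"
  using assms unfolding gword_eq_def
proof (induction rule: rtrancl_induct)
  case (step v w)
  then have "v \<in> gwords A \<longleftrightarrow> w \<in> gwords A"
    using relators by (auto simp: gword_step_def)
  then show ?case using step.IH by simp
qed auto

lemma gword_eq_append:
  assumes "(u, u') \<in> gword_eq A R" "(v, v') \<in> gword_eq A R" "u \<in> gwords A" "v \<in> gwords A"
  shows "(u @ v, u' @ v') \<in> gword_eq A R"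
proof -
  have "u' \<in> gwords A" using gword_eq_gwords assms by blast
  then show ?thesis
    using gword_eq_trans[of "u @ v" "u' @ v" "u' @ v'"] gword_eq_context[OF assms(1), of "[]" v]
      gword_eq_context[OF assms(2), of u' "[]"] assms by simp
qed

lemma cls_eq_iff: "cls u = cls v \<longleftrightarrow> (u, v) \<in> gword_eq A R"
  using gword_eq_refl gword_eq_trans gword_eq_sym by blast

lemma carrier_presented: "carrier (presented_group A R) = cls ` gwords A"
  by (auto simp: presented_group_def quotient_def)

lemma one_presented: "\<one>\<^bsub>presented_group A R\<^esub> = cls []"
  by (simp add: presented_group_def)

lemma mult_presented:
  assumes "u \<in> gwords A" "v \<in> gwords A"
  shows "cls u \<otimes>\<^bsub>presented_group A R\<^esub> cls v = cls (u @ v)"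
proof -
  have eq: "cls (a @ b) = cls (u @ v)" if "a \<in> cls u" "b \<in> cls v" for a b
    using gword_eq_append[of u a v b] that assms by (simp add: cls_eq_iff gword_eq_sym)
  have "(\<Union>a\<in>cls u. \<Union>b\<in>cls v. cls (a @ b)) = (\<Union>a\<in>cls u. \<Union>b\<in>cls v. cls (u @ v))"
    using eq by (intro SUP_cong refl) 
  also have "\<dots> = cls (u @ v)" using gword_eq_refl by auto
  finally show ?thesis by (simp add: presented_group_def)
qed

lemma gword_eq_nil: "r \<in> R \<union> {[(x, b), (x, \<not> b)] | x b. x \<in> A} \<Longrightarrow> (r, []) \<in> gword_eq A R"
  unfolding gword_eq_def gword_step_def
  by (intro r_into_rtrancl UnI1 CollectI exI[of _ "[]"] exI[of _ r]) auto

lemma cls_cancel: "x \<in> A \<Longrightarrow> cls [(x, b), (x, \<not> b)] = cls []"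
  unfolding cls_eq_iff by (rule gword_eq_nil) blast

lemma cls_relator: "r \<in> R \<Longrightarrow> cls r = cls []"
  unfolding cls_eq_iff by (rule gword_eq_nil) blast

text \<open>A left inverse is built letter by letter: the flipped letter is appended to an inverse
  of the tail.\<close>

lemma group_presented: "group (presented_group A R)"
proof (rule groupI)
  let ?G = "presented_group A R"
  have inv: "\<exists>y\<in>gwords A. cls y \<otimes>\<^bsub>?G\<^esub> cls u = \<one>\<^bsub>?G\<^esub>" if "u \<in> gwords A" for u
    using that
  proof (induction u)
    case Nil then show ?case by (auto simp: one_presented mult_presented intro!: bexI[of _ "[]"])
  next
    case (Cons p u)
    obtain x b where p: "p = (x, b)" by force
    obtain y where y: "y \<in> gwords A" "cls (y @ u) = cls []"
      using Cons by (auto simp: mult_presented one_presented)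
    have "cls (y @ [(x, \<not> b)] @ (x, b) # u) = cls (y @ u)"
      using gword_eq_context[of "[(x, \<not> b), (x, \<not> \<not> b)]" "[]" y u] cls_cancel[of x "\<not> b"] Cons y p
      by (simp add: cls_eq_iff)
    then show ?case using y Cons p
      by (intro bexI[of _ "y @ [(x, \<not> b)]"]) (auto simp: mult_presented one_presented)
  qed
  show "\<exists>y\<in>carrier ?G. y \<otimes>\<^bsub>?G\<^esub> x = \<one>\<^bsub>?G\<^esub>" if "x \<in> carrier ?G" for x
    using that inv by (auto simp: carrier_presented)
qed (auto simp: carrier_presented mult_presented one_presented)

text \<open>Evaluation of words is unchanged by each step, so it descends to classes. The target may
  be a mere monoid because \<open>f\<close> also supplies the values on formal inverses; this admits
  the multiplicative monoid of a ring and the monoid of self-maps of a type.\<close>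

lemma presented_lift:
  assumes "monoid M" "\<And>x. x \<in> A \<Longrightarrow> f (x, True) \<in> carrier M" "\<And>x. x \<in> A \<Longrightarrow> f (x, False) \<in> carrier M"
    "\<And>x b. x \<in> A \<Longrightarrow> f (x, b) \<otimes>\<^bsub>M\<^esub> f (x, \<not> b) = \<one>\<^bsub>M\<^esub>"
    "\<And>r. r \<in> R \<Longrightarrow> foldr (\<lambda>p a. f p \<otimes>\<^bsub>M\<^esub> a) r \<one>\<^bsub>M\<^esub> = \<one>\<^bsub>M\<^esub>"
  obtains h where "\<And>u. u \<in> gwords A \<Longrightarrow> h (cls u) = foldr (\<lambda>p a. f p \<otimes>\<^bsub>M\<^esub> a) u \<one>\<^bsub>M\<^esub>"
    "h \<in> hom (presented_group A R) M"
proof -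
  interpret M: monoid M by fact
  define ev where "ev u = foldr (\<lambda>p a. f p \<otimes>\<^bsub>M\<^esub> a) u \<one>\<^bsub>M\<^esub>" for u
  have fc: "f p \<in> carrier M" if "fst p \<in> A" for p
    using assms(2,3) that by (cases p; cases "snd p") auto
  have evc: "u \<in> gwords A \<Longrightarrow> ev u \<in> carrier M" for u
    by (induction u) (auto simp: ev_def fc)
  have ev_app: "u \<in> gwords A \<Longrightarrow> v \<in> gwords A \<Longrightarrow> ev (u @ v) = ev u \<otimes>\<^bsub>M\<^esub> ev v" for u v
  proof (induction u)
    case (Cons p u) then show ?case using evc[of u] evc[of v] fc[of p]
      by (simp add: ev_def M.m_assoc)
  qed (use evc[of v] in \<open>simp add: ev_def\<close>)
  have ev_mid: "ev (p @ r @ q) = ev (p @ q)"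
    if "p \<in> gwords A" "q \<in> gwords A" "r \<in> gwords A" "ev r = \<one>\<^bsub>M\<^esub>" for p q r
    using ev_app[of p "r @ q"] ev_app[of r q] ev_app[of p q] that evc[of q] by simp
  have ev_step: "ev u = ev v" if uv: "(u, v) \<in> gword_step A R" for u v
  proof -
    obtain p r q where r: "u = p @ r @ q" "v = p @ q" "p \<in> gwords A" "q \<in> gwords A"
      "r \<in> R \<or> (\<exists>x b. r = [(x, b), (x, \<not> b)] \<and> x \<in> A)"
      using uv unfolding gword_step_def by blast
    from r(5) have "r \<in> gwords A \<and> ev r = \<one>\<^bsub>M\<^esub>"
    proof
      assume "r \<in> R"
      then show ?thesis using assms(5)[of r] relators by (simp add: ev_def subset_iff)
    next
      assume "\<exists>x b. r = [(x, b), (x, \<not> b)] \<and> x \<in> A"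
      then obtain x b where "r = [(x, b), (x, \<not> b)]" "x \<in> A" by blast
      then show ?thesis using assms(4)[of x b] fc[of "(x, \<not> b)"] by (simp add: ev_def)
    qed
    then show ?thesis unfolding r(1,2) using ev_mid[OF r(3,4)] by blast
  qed
  have "ev u = ev v" if "(u, v) \<in> gword_eq A R" for u v
    using that unfolding gword_eq_def by (induction rule: rtrancl_induct) (auto dest: ev_step)
  then have ev_some: "ev (SOME v. v \<in> cls u) = ev u" for u
    using someI[of "\<lambda>v. v \<in> cls u" u] gword_eq_refl by auto
  define h where "h C = ev (SOME v. v \<in> C)" for C
  have h: "h (cls u) = ev u" for u unfolding h_def by (rule ev_some)
  have "h \<in> hom (presented_group A R) M"
    by (rule homI) (auto simp: carrier_presented mult_presented h evc ev_app)
  then show ?thesis by (rule that[rotated]) (simp add: h ev_def)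
qed

end

section \<open>Coxeter groups\<close>

fun alt :: "'a \<Rightarrow> 'a \<Rightarrow> nat \<Rightarrow> 'a list" where
  "alt a b 0 = []" | "alt a b (Suc n) = a # alt b a n"

lemma length_alt [simp]: "length (alt a b n) = n"
  by (induction a b n rule: alt.induct) auto

lemma set_alt: "set (alt a b n) \<subseteq> {a, b}"
  by (induction a b n rule: alt.induct) auto

lemma alt_snoc: "alt a b (Suc n) = alt a b n @ [if even n then a else b]"
  by (induction a b n rule: alt.induct) auto

lemma alt_append: "alt a b (n + k) = alt a b n @ (if even n then alt a b k else alt b a k)"
  by (induction a b n rule: alt.induct) auto

lemma alt_conv_map: "alt a b n = map (\<lambda>k. if even k then a else b) [0..<n]"
  by (induction n) (simp_all del: alt.simps(2) add: alt_snoc)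

text \<open>One step of the parity count that records the sign in
  \<open>sgact_braid\<close>.\<close>

lemma odd_card_Suc:
  "odd (card {k. k < Suc n \<and> P k}) \<longleftrightarrow> odd (card {k. k < n \<and> P k}) \<noteq> P n"
proof -
  have "{k. k < Suc n \<and> P k} = (if P n then insert n {k. k < n \<and> P k} else {k. k < n \<and> P k})"
    by (auto simp: less_Suc_eq)
  then show ?thesis by simp
qed

definition fun_monoid :: "('a \<Rightarrow> 'a) monoid" where
  "fun_monoid = \<lparr>carrier = UNIV, monoid.mult = (\<circ>), one = id\<rparr>"

lemma fun_monoid_simps [simp]:
  "f \<in> carrier fun_monoid" "f \<otimes>\<^bsub>fun_monoid\<^esub> g = f \<circ> g" "\<one>\<^bsub>fun_monoid\<^esub> = id"
  by (auto simp: fun_monoid_def)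

lemma monoid_fun_monoid: "monoid fun_monoid"
  by unfold_locales (auto simp: comp_assoc)

lemma pow_fun_monoid [simp]: "f [^]\<^bsub>fun_monoid\<^esub> (n::nat) = f ^^ n"
proof (induction n)
  case (Suc n)
  then show ?case using monoid.nat_pow_Suc[OF monoid_fun_monoid] by (simp add: funpow_swap1 fun_eq_iff)
qed (simp add: nat_pow_def)

lemma rev_in_lists_iff [simp]: "rev x \<in> lists A \<longleftrightarrow> x \<in> lists A"
  by (simp add: in_lists_conv_set)

section \<open>Words in the generators and the universal property of \<open>W\<close>\<close>

locale coxeter =
  fixes I :: "'i set" and m :: "'i \<Rightarrow> 'i \<Rightarrow> nat"
  assumes coxeter_matrix: "coxeter_matrix I m"
begin

lemma m_sym: "i \<in> I \<Longrightarrow> j \<in> I \<Longrightarrow> m i j = m j i"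
  using coxeter_matrix by (auto simp: coxeter_matrix_def)

lemma m_eq_1_iff: "i \<in> I \<Longrightarrow> j \<in> I \<Longrightarrow> m i j = 1 \<longleftrightarrow> i = j"
  using coxeter_matrix by (auto simp: coxeter_matrix_def)

abbreviation W :: "'i gword set monoid" where "W \<equiv> cox I m"
abbreviation s :: "'i \<Rightarrow> 'i gword set" where "s \<equiv> cox_s I m"
abbreviation wmult (infixl "\<star>" 70) where "u \<star> v \<equiv> u \<otimes>\<^bsub>W\<^esub> v"
abbreviation wone ("\<one>\<^sub>W") where "\<one>\<^sub>W \<equiv> \<one>\<^bsub>W\<^esub>"
abbreviation winv ("inv\<^sub>W _" [81] 80) where "inv\<^sub>W w \<equiv> inv\<^bsub>W\<^esub> w"
abbreviation wpow (infixr "[^]\<^sub>W" 75) where "w [^]\<^sub>W n \<equiv> w [^]\<^bsub>W\<^esub> (n::nat)"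

sublocale P: presentation I "coxeter_relators I m"
proof
  have "concat (replicate n [(i, True), (j, True)]) \<in> gwords I" if "i \<in> I" "j \<in> I" for i j n
    using that by (induction n) auto
  then show "coxeter_relators I m \<subseteq> gwords I" by (auto simp: coxeter_relators_def)
qed

sublocale W: group W
  unfolding cox_def by (rule P.group_presented)

definition word :: "'i list \<Rightarrow> 'i gword set" where
  "word x = foldr (\<lambda>i w. s i \<star> w) x \<one>\<^sub>W"

lemma s_closed [simp]: "i \<in> I \<Longrightarrow> s i \<in> carrier W"
  by (auto simp: cox_def P.carrier_presented cox_s_def)

lemma word_simps [simp]: "word [] = \<one>\<^sub>W" "word (i # x) = s i \<star> word x"
  by (auto simp: word_def)

lemma word_closed [simp]: "x \<in> lists I \<Longrightarrow> word x \<in> carrier W"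
  by (induction x) auto

lemma word_append [simp]: "x \<in> lists I \<Longrightarrow> y \<in> lists I \<Longrightarrow> word (x @ y) = word x \<star> word y"
  by (induction x) (auto simp: W.m_assoc)

lemma s_square [simp]: "i \<in> I \<Longrightarrow> s i \<star> s i = \<one>\<^sub>W"
proof -
  assume i: "i \<in> I"
  \<comment> \<open>As \<open>m i i = 1\<close>, the relator of the pair \<open>(i, i)\<close> is
    this word itself.\<close>
  then have "[(i, True), (i, True)] \<in> coxeter_relators I m"
    using m_eq_1_iff[of i i] by (force simp: coxeter_relators_def)
  then show ?thesis using P.cls_relator i
    by (simp add: cox_def cox_s_def P.mult_presented P.one_presented)
qed

lemma s_cancel [simp]: "i \<in> I \<Longrightarrow> w \<in> carrier W \<Longrightarrow> s i \<star> (s i \<star> w) = w"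
  by (simp flip: W.m_assoc)

lemma s_cancel_right [simp]: "i \<in> I \<Longrightarrow> w \<in> carrier W \<Longrightarrow> w \<star> s i \<star> s i = w"
  by (simp add: W.m_assoc)

lemma inv_s [simp]: "i \<in> I \<Longrightarrow> inv\<^sub>W s i = s i"
  by (simp add: W.inv_equality)

lemma inv_word: "x \<in> lists I \<Longrightarrow> inv\<^sub>W word x = word (rev x)"
  by (induction x) (simp_all add: W.inv_mult_group)

lemma cls_append: "u \<in> gwords I \<Longrightarrow> v \<in> gwords I \<Longrightarrow> P.cls (u @ v) = P.cls u \<star> P.cls v"
  by (simp add: cox_def P.mult_presented)

lemma cls_s: "P.cls [(i, True)] = s i"
  by (simp add: cox_s_def)

lemma cls_nil: "P.cls [] = \<one>\<^sub>W"
  by (simp add: cox_def P.one_presented)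

text \<open>Generators are involutions, so a formal inverse letter has the same class as the letter;
  from here on elements of \<open>W\<close> are written by lists of indices.\<close>

lemma cls_word: "u \<in> gwords I \<Longrightarrow> P.cls u = word (map fst u)"
proof (induction u)
  case Nil then show ?case by (simp add: cox_def P.one_presented)
next
  case (Cons p u)
  obtain i b where p: "p = (i, b)" by force
  have i: "i \<in> I" using Cons p by simp
  have "P.cls [(i, b)] = s i"
  proof (cases b)
    case False
    have "P.cls [(i, False)] \<star> s i = \<one>\<^sub>W"
      using P.cls_cancel[OF i, of False] i by (simp add: cox_def cox_s_def P.mult_presented P.one_presented)
    moreover have "P.cls [(i, False)] \<in> carrier W" using i by (auto simp: cox_def P.carrier_presented)
    ultimately show ?thesis using False i W.inv_equality[of "P.cls [(i, False)]" "s i"] by simp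
  qed (simp add: cox_s_def)
  moreover have "P.cls (p # u) = P.cls [(i, b)] \<star> P.cls u"
    using Cons p cls_append[of "[p]" u] by simp
  ultimately show ?case using Cons p by simp
qed

lemma carrier_eq_word: "carrier W = word ` lists I"
proof
  show "carrier W \<subseteq> word ` lists I"
  proof
    fix w assume "w \<in> carrier W"
    then obtain u where u: "u \<in> gwords I" "w = P.cls u" by (auto simp: cox_def P.carrier_presented)
    then show "w \<in> word ` lists I" using cls_word[of u]
      by (intro image_eqI[of _ _ "map fst u"]) (auto simp: gwords_def mem_Times_iff)
  qed
  show "word ` lists I \<subseteq> carrier W" by (rule image_subsetI) (rule word_closed)
qed

lemma W_induct [consumes 1, case_names one mult]:
  assumes "w \<in> carrier W" "P \<one>\<^sub>W" "\<And>i w. i \<in> I \<Longrightarrow> w \<in> carrier W \<Longrightarrow> P w \<Longrightarrow> P (s i \<star> w)"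
  shows "P w"
proof -
  obtain x where "x \<in> lists I" "w = word x" using assms(1) carrier_eq_word by auto
  moreover have "P (word x)" if "x \<in> lists I" for x using that
  proof (induction x)
    case (Cons i x)
    then show ?case using assms(3)[of i "word x"] by simp
  qed (simp add: assms)
  ultimately show ?thesis by simp
qed

lemma braid: "i \<in> I \<Longrightarrow> j \<in> I \<Longrightarrow> (s i \<star> s j) [^]\<^sub>W m i j = \<one>\<^sub>W"
proof -
  assume ij: "i \<in> I" "j \<in> I"
  have "P.cls (concat (replicate n [(i, True), (j, True)])) = (s i \<star> s j) [^]\<^sub>W n \<and>
     concat (replicate n [(i, True), (j, True)]) \<in> gwords I" for n
  proof (induction n)
    case 0 then show ?case by (simp add: cls_nil)
  next
    case (Suc n)
    have "P.cls ([(i, True)] @ [(j, True)] @ concat (replicate n [(i, True), (j, True)])) =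
       s i \<star> (s j \<star> (s i \<star> s j) [^]\<^sub>W n)"
      using ij Suc by (subst cls_append, simp, simp)+ (simp only: cls_s)
    also have "\<dots> = (s i \<star> s j) [^]\<^sub>W Suc n"
      using ij W.nat_pow_Suc2[of "s i \<star> s j" n] by (simp add: W.m_assoc)
    finally show ?case using Suc ij by simp
  qed
  moreover have "concat (replicate (m i j) [(i, True), (j, True)]) \<in> coxeter_relators I m"
    using ij by (auto simp: coxeter_relators_def)
  ultimately show ?thesis using P.cls_relator cls_nil by metis
qed

lemma W_lift:
  assumes "monoid M" "\<And>i. i \<in> I \<Longrightarrow> f i \<in> carrier M" "\<And>i. i \<in> I \<Longrightarrow> f i \<otimes>\<^bsub>M\<^esub> f i = \<one>\<^bsub>M\<^esub>"
    "\<And>i j. i \<in> I \<Longrightarrow> j \<in> I \<Longrightarrow> (f i \<otimes>\<^bsub>M\<^esub> f j) [^]\<^bsub>M\<^esub> m i j = \<one>\<^bsub>M\<^esub>"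
  obtains h where "h \<in> hom W M" "h \<one>\<^sub>W = \<one>\<^bsub>M\<^esub>" "\<And>i. i \<in> I \<Longrightarrow> h (s i) = f i"
proof -
  interpret M: monoid M by fact
  have pow: "foldr (\<lambda>p a. f (fst p) \<otimes>\<^bsub>M\<^esub> a) (concat (replicate n [(i, True), (j, True)])) \<one>\<^bsub>M\<^esub>
    = (f i \<otimes>\<^bsub>M\<^esub> f j) [^]\<^bsub>M\<^esub> n" if "i \<in> I" "j \<in> I" for i j n
  proof (induction n)
    case (Suc n)
    then show ?case using M.nat_pow_Suc2[of "f i \<otimes>\<^bsub>M\<^esub> f j" n] assms(2) that by (simp add: M.m_assoc)
  qed simp
  obtain h where h: "\<And>u. u \<in> gwords I \<Longrightarrow> h (P.cls u) = foldr (\<lambda>p a. f (fst p) \<otimes>\<^bsub>M\<^esub> a) u \<one>\<^bsub>M\<^esub>"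
    "h \<in> hom (presented_group I (coxeter_relators I m)) M"
    by (rule P.presented_lift[of M "\<lambda>p. f (fst p)"])
      (use assms pow in \<open>auto simp: coxeter_relators_def\<close>)
  have "h (s i) = f i" if "i \<in> I" for i
    using h(1)[of "[(i, True)]"] that assms(2) by (simp add: cox_s_def)
  moreover have "h \<one>\<^sub>W = \<one>\<^bsub>M\<^esub>" using h(1)[of "[]"] by (simp add: cox_def P.one_presented)
  ultimately show ?thesis using h(2) that by (simp add: cox_def)
qed

lemma W_act:
  fixes f :: "'i \<Rightarrow> 'a \<Rightarrow> 'a"
  assumes "\<And>i. i \<in> I \<Longrightarrow> f i \<circ> f i = id" "\<And>i j. i \<in> I \<Longrightarrow> j \<in> I \<Longrightarrow> (f i \<circ> f j) ^^ m i j = id"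
  obtains h where "\<And>v w. v \<in> carrier W \<Longrightarrow> w \<in> carrier W \<Longrightarrow> h (v \<star> w) = h v \<circ> h w"
    "h \<one>\<^sub>W = id" "\<And>i. i \<in> I \<Longrightarrow> h (s i) = f i"
proof -
  obtain h where "h \<in> hom W fun_monoid" "h \<one>\<^sub>W = \<one>\<^bsub>fun_monoid\<^esub>" "\<And>i. i \<in> I \<Longrightarrow> h (s i) = f i"
    by (rule W_lift[OF monoid_fun_monoid, of f]) (use assms in auto)
  then show ?thesis using that[of h] by (auto simp: hom_def)
qed

text \<open>This is the sign character: every generator acts on \<open>bool\<close> as
  \<open>Not\<close>, which is compatible with the relators because their lengths are even.\<close>

lemma even_length_cong:
  assumes "x \<in> lists I" "y \<in> lists I" "word x = word y"
  shows "even (length x) \<longleftrightarrow> even (length y)"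
proof -
  have n1: "\<And>i :: 'i. i \<in> I \<Longrightarrow> Not \<circ> Not = id" by (simp add: fun_eq_iff)
  have "(id :: bool \<Rightarrow> bool) ^^ n = id" for n by (induction n) simp_all
  then have n2: "\<And>i j. i \<in> I \<Longrightarrow> j \<in> I \<Longrightarrow> (Not \<circ> Not) ^^ m i j = id" by (simp add: n1)
  obtain h :: "_ \<Rightarrow> bool \<Rightarrow> bool" where h: "\<And>v w. v \<in> carrier W \<Longrightarrow> w \<in> carrier W \<Longrightarrow> h (v \<star> w) = h v \<circ> h w"
    "h \<one>\<^sub>W = id" "\<And>i. i \<in> I \<Longrightarrow> h (s i) = Not"
    by (rule W_act[of "\<lambda>_. Not", OF n1 n2 that])
  have "x \<in> lists I \<Longrightarrow> h (word x) True \<longleftrightarrow> even (length x)" for x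
    by (induction x) (auto simp: h)
  then show ?thesis using assms by metis
qed

subsection \<open>The order of a product of two generators\<close>

text \<open>The Tits form on the span of the simple roots, with the value -1 for a pair of infinite
  order.\<close>

definition gram :: "'i \<Rightarrow> 'i \<Rightarrow> real" where
  "gram i k = (if m i k = 0 then - 1 else - cos (pi / m i k))"

text \<open>\<open>f\<close> is a linear functional on the span of the simple roots, given by its
  values on them, and this is its composition with the reflection in the root of \<open>i\<close>.
  Working with the dual of the geometric representation avoids finite supports when \<open>I\<close>
  is infinite.\<close>

definition geo :: "'i \<Rightarrow> ('i \<Rightarrow> real) \<Rightarrow> 'i \<Rightarrow> real" where
  "geo i f = (\<lambda>k. f k - 2 * gram i k * f i)"

lemma gram_self [simp]: "i \<in> I \<Longrightarrow> gram i i = 1"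
  using m_eq_1_iff[of i i] by (simp add: gram_def)

lemma geo_invol: "i \<in> I \<Longrightarrow> geo i (geo i f) = f"
  by (auto simp: geo_def fun_eq_iff)

text \<open>A complex coordinate for the restriction of \<open>f\<close> to the plane of the roots
  of \<open>i\<close> and \<open>j\<close>. For \<open>m i j \<noteq> 0\<close>,
  \<open>geo i\<close> becomes complex conjugation and \<open>geo j\<close> conjugation followed by
  multiplication by \<open>cis (2 * (pi / m i j))\<close>, so the composite is a rotation.\<close>

definition rank2 :: "'i \<Rightarrow> 'i \<Rightarrow> ('i \<Rightarrow> real) \<Rightarrow> complex" where
  "rank2 i j f = of_real (f j) + of_real (f i) * cis (pi / m i j)"

lemma rank2_geo:
  assumes "i \<in> I" "j \<in> I" "m i j \<noteq> 0"
  shows "rank2 i j (geo i (geo j f)) = cis (- (2 * (pi / m i j))) * rank2 i j f"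
proof -
  let ?\<theta> = "pi / m i j"
  have g: "gram i j = - cos ?\<theta>" "gram j i = - cos ?\<theta>"
    using assms m_sym[of i j] by (auto simp: gram_def)
  have 1: "rank2 i j (geo i h) = cnj (rank2 i j h)" for h
    using assms by (simp add: rank2_def geo_def g complex_eq_iff algebra_simps)
  have c: "cos (2 * ?\<theta>) = 2 * cos ?\<theta> * cos ?\<theta> - 1" "sin (2 * ?\<theta>) = 2 * sin ?\<theta> * cos ?\<theta>"
    by (simp_all only: cos_double_cos sin_double power2_eq_square mult.assoc)
  have sc: "sin ?\<theta> * sin ?\<theta> = 1 - cos ?\<theta> * cos ?\<theta>"
    using sin_squared_eq[of ?\<theta>] by (simp only: power2_eq_square)
  have 2: "rank2 i j (geo j h) = cis (2 * ?\<theta>) * cnj (rank2 i j h)" for h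
  proof -
    have c1: "cis (2 * ?\<theta>) * cis (- ?\<theta>) = cis ?\<theta>" by (simp add: cis_mult)
    have c2: "2 * of_real (cos ?\<theta>) * cis ?\<theta> - 1 = cis (2 * ?\<theta>)"
      by (simp only: complex_eq_iff cis.sel c minus_complex.sel) simp
    have "rank2 i j (geo j h) =
        of_real (h j) * (2 * of_real (cos ?\<theta>) * cis ?\<theta> - 1) + of_real (h i) * cis ?\<theta>"
      using assms by (simp add: rank2_def geo_def g algebra_simps)
    also have "\<dots> = of_real (h j) * cis (2 * ?\<theta>) + of_real (h i) * (cis (2 * ?\<theta>) * cis (- ?\<theta>))"
      by (simp only: c1 c2)
    also have "\<dots> = cis (2 * ?\<theta>) * cnj (rank2 i j h)"
      by (simp add: rank2_def cis_cnj algebra_simps)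
    finally show ?thesis .
  qed
  show ?thesis by (simp add: 1 2 cis_cnj)
qed

lemma rank2_geo_pow:
  assumes "i \<in> I" "j \<in> I" "m i j \<noteq> 0"
  shows "rank2 i j (((geo i \<circ> geo j) ^^ n) f) = cis (- (2 * (pi / m i j))) ^ n * rank2 i j f"
  by (induction n) (simp_all add: rank2_geo[OF assms])

text \<open>Each application of \<open>geo i \<circ> geo j\<close> changes the coordinate at
  \<open>k\<close> by a fixed combination of the coordinates at \<open>i\<close> and
  \<open>j\<close>. These rotate by an \<open>m i j\<close>-th root of unity other than 1, so their
  sums over a full period vanish and every coordinate returns to its start. The values 0 and 1 of
  \<open>m i j\<close> are separate: there is no period in the one case and no plane in the
  other.\<close>

lemma geo_braid:
  assumes "i \<in> I" "j \<in> I"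
  shows "(geo i \<circ> geo j) ^^ m i j = id"
proof (cases "m i j \<le> 1")
  case True
  then consider "m i j = 0" | "m i j = 1" by linarith
  then show ?thesis
  proof cases
    case 2
    then have "i = j" using m_eq_1_iff assms by simp
    then show ?thesis using 2 assms by (auto simp: geo_invol fun_eq_iff)
  qed simp
next
  case False
  define \<theta> where "\<theta> = pi / m i j"
  define \<omega> where "\<omega> = cis (- (2 * \<theta>))"
  have \<theta>: "0 < \<theta>" "\<theta> < pi" using False by (auto simp: \<theta>_def field_simps)
  then have s0: "sin \<theta> \<noteq> 0" using sin_gt_zero by fastforce
  have "\<omega> \<noteq> 1"
  proof
    assume "\<omega> = 1"
    then have "cos (2 * \<theta>) = 1" by (simp add: \<omega>_def complex_eq_iff)
    then have "sin \<theta> ^ 2 = 0" by (simp add: cos_double_sin)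
    then show False using s0 by simp
  qed
  moreover have "\<omega> ^ m i j = 1"
  proof -
    have "\<omega> ^ m i j = cis (- (2 * pi))" using False by (simp add: \<omega>_def \<theta>_def Complex.DeMoivre)
    then show ?thesis by (simp add: complex_eq_iff)
  qed
  ultimately have sum0: "(\<Sum>t<m i j. \<omega> ^ t) = 0" by (simp add: geometric_sum)
  show ?thesis
  proof (intro ext)
    fix f k
    define \<rho> where "\<rho> t = ((geo i \<circ> geo j) ^^ t) f" for t
    \<comment> \<open>The coefficients of \<open>f i\<close> and \<open>f j\<close> in the value of
      \<open>geo i (geo j f)\<close> at \<open>k\<close>.\<close>
    define p q where "p = - 2 * gram i k" and "q = - 2 * gram j k + 4 * gram i k * gram j i"
    have "\<rho> n k = f k + p * (\<Sum>t<n. \<rho> t i) + q * (\<Sum>t<n. \<rho> t j)" for n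
    proof (induction n)
      case (Suc n)
      have "\<rho> (Suc n) k = \<rho> n k + p * \<rho> n i + q * \<rho> n j"
        using assms by (simp add: \<rho>_def geo_def p_def q_def algebra_simps)
      then show ?case using Suc by (simp add: algebra_simps)
    qed (simp add: \<rho>_def)
    moreover have "(\<Sum>t<m i j. \<rho> t i) = 0 \<and> (\<Sum>t<m i j. \<rho> t j) = 0"
    proof -
      have "(\<Sum>t<m i j. rank2 i j (\<rho> t)) = (\<Sum>t<m i j. \<omega> ^ t) * rank2 i j f"
        using rank2_geo_pow[OF assms] False by (simp add: \<rho>_def \<omega>_def \<theta>_def sum_distrib_right)
      then have "of_real (\<Sum>t<m i j. \<rho> t j) + of_real (\<Sum>t<m i j. \<rho> t i) * cis \<theta> = 0"
        by (simp add: sum0 rank2_def \<theta>_def sum.distrib sum_distrib_right)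
      then have "(\<Sum>t<m i j. \<rho> t i) * sin \<theta> = 0"
        "(\<Sum>t<m i j. \<rho> t j) + (\<Sum>t<m i j. \<rho> t i) * cos \<theta> = 0"
        by (simp_all add: complex_eq_iff)
      then show ?thesis using s0 by auto
    qed
    ultimately show "((geo i \<circ> geo j) ^^ m i j) f k = id f k" by (simp add: \<rho>_def)
  qed
qed

text \<open>The converse of the braid relation, read off from the dual geometric representation. If
  \<open>m i j = 0\<close>, the coordinate at \<open>j\<close> of a suitable functional grows like
  \<open>2 * n\<close>, which leaves only \<open>n = 0\<close>; otherwise a rotation by the angle
  \<open>2 * pi / m i j\<close> has order \<open>m i j\<close>.\<close>

lemma order_dvd:
  assumes "i \<in> I" "j \<in> I" "(s i \<star> s j) [^]\<^sub>W n = \<one>\<^sub>W"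
  shows "m i j dvd n"
proof -
  obtain h where h: "\<And>v w. v \<in> carrier W \<Longrightarrow> w \<in> carrier W \<Longrightarrow> h (v \<star> w) = h v \<circ> h w"
    "h \<one>\<^sub>W = id" "\<And>i. i \<in> I \<Longrightarrow> h (s i) = geo i"
    by (rule W_act[of geo]) (auto simp: geo_invol geo_braid fun_eq_iff)
  have "h ((s i \<star> s j) [^]\<^sub>W n) = (geo i \<circ> geo j) ^^ n" for n
    using assms by (induction n) (simp_all add: h funpow_swap1 fun_eq_iff)
  then have id: "(geo i \<circ> geo j) ^^ n = id" using assms(3) h by metis
  consider "i = j" | "i \<noteq> j" "m i j = 0" | "i \<noteq> j" "m i j \<noteq> 0" by blast
  then show ?thesis
  proof cases
    case 1 then show ?thesis using m_eq_1_iff[of i i] assms by simp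
  next
    case 2
    define f where "f = (\<lambda>k. if k = i then 1 else 0 :: real)"
    have g: "gram i j = - 1" "gram j i = - 1" using 2 assms m_sym[of i j] by (auto simp: gram_def)
    have "((geo i \<circ> geo j) ^^ n) f j = 2 * n \<and> ((geo i \<circ> geo j) ^^ n) f i = 1 - 2 * real n" for n
      using 2 assms by (induction n) (auto simp: f_def geo_def[abs_def] g)
    from this[of n] have "f j = 2 * n" unfolding id by simp
    then show ?thesis using 2 by (simp add: f_def)
  next
    case 3
    \<comment> \<open>The complex coordinate of this functional is 1, so the power of the rotation
      factor itself must be 1.\<close>
    define f where "f = (\<lambda>k. if k = j then 1 else 0 :: real)"
    have "cis (- (2 * (pi / m i j))) ^ n = 1"
      using rank2_geo_pow[OF assms(1,2) 3(2), of n f] 3 by (simp add: id rank2_def f_def)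
    then have "cos (n * (2 * (pi / m i j))) = 1"
      by (simp add: Complex.DeMoivre complex_eq_iff)
    then obtain l :: int where "n * (2 * (pi / m i j)) = real_of_int l * 2 * pi"
      using cos_one_2pi_int by blast
    then have "real n * (2 * (pi / m i j)) * m i j = real_of_int l * 2 * pi * m i j" by simp
    moreover have "real n * (2 * (pi / m i j)) * m i j = real n * 2 * pi" using 3 by simp
    ultimately have "real n * (2 * pi) = of_int l * real (m i j) * (2 * pi)"
      by (simp add: mult.assoc mult.left_commute)
    then have "real n = of_int l * real (m i j)" by (rule mult_right_cancel[THEN iffD1, rotated]) simp
    then have "real_of_int (int n) = real_of_int (l * int (m i j))" by simp
    then have "int n = l * int (m i j)" by (rule of_int_eq_iff[THEN iffD1])
    then show ?thesis by (metis dvd_triv_right int_dvd_int_iff)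
  qed
qed

lemma s_inj: "i \<in> I \<Longrightarrow> j \<in> I \<Longrightarrow> s i = s j \<longleftrightarrow> i = j"
  using order_dvd[of i j 1] m_eq_1_iff[of i j] by auto

lemma s_neq_one: "i \<in> I \<Longrightarrow> s i \<noteq> \<one>\<^sub>W"
  using even_length_cong[of "[i]" "[]"] by auto

lemma word_closed_set [simp]: "\<forall>i\<in>set x. i \<in> I \<Longrightarrow> word x \<in> carrier W"
  by (simp add: in_lists_conv_set)

subsection \<open>Signed reflections and the exchange property\<close>

definition sgact :: "'i \<Rightarrow> 'i gword set \<times> bool \<Rightarrow> 'i gword set \<times> bool" where
  "sgact i = (\<lambda>(t, b). if t \<in> carrier W then (s i \<star> t \<star> s i, b \<noteq> (t = s i)) else (t, b))"

lemma sgact_invol: "i \<in> I \<Longrightarrow> sgact i \<circ> sgact i = id"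
proof (intro ext, clarify)
  fix t b assume i: "i \<in> I"
  show "(sgact i \<circ> sgact i) (t, b) = id (t, b)"
  proof (cases "t \<in> carrier W")
    case True
    have "s i \<star> (s i \<star> t \<star> s i) \<star> s i = t" using True i by (simp add: W.m_assoc)
    then show ?thesis using True i by (auto simp: sgact_def)
  qed (simp add: sgact_def)
qed

text \<open>The sign of \<open>t\<close> is flipped as often as \<open>t\<close> occurs among
  \<open>r k\<close> for \<open>k < 2 * m i j\<close>, where \<open>r\<close> runs through the
  reflections of the dihedral group. Since \<open>r\<close> has period \<open>m i j\<close>, every
  element occurs there an even number of times.\<close>

lemma sgact_braid:
  assumes i: "i \<in> I" and j: "j \<in> I"
  shows "(sgact i \<circ> sgact j) ^^ m i j = id"
proof -
  define a b where "a = s i \<star> s j" and "b = s j \<star> s i"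
  have ab: "a \<in> carrier W" "b \<in> carrier W" using i j by (auto simp: a_def b_def)
  have inv_a: "inv\<^sub>W a = b" using i j by (simp add: a_def b_def W.inv_mult_group)
  define r where "r k = b [^]\<^sub>W (k::nat) \<star> s j" for k
  have sa: "s j \<star> a [^]\<^sub>W n = b [^]\<^sub>W n \<star> s j" for n :: nat
  proof (induction n)
    case (Suc n)
    have "s j \<star> a [^]\<^sub>W Suc n = s j \<star> a [^]\<^sub>W n \<star> a" using ab j by (simp add: W.m_assoc)
    also have "\<dots> = b [^]\<^sub>W n \<star> (s j \<star> a)" using Suc ab j by (simp add: W.m_assoc)
    also have "s j \<star> a = b \<star> s j" using i j by (simp add: a_def b_def W.m_assoc)
    finally show ?case using ab j by (simp add: W.m_assoc)
  qed (use j in simp)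
  have pow_inv: "inv\<^sub>W (a [^]\<^sub>W n) = b [^]\<^sub>W n" for n :: nat
    using ab by (simp add: W.nat_pow_inv flip: inv_a)
  have bs: "b [^]\<^sub>W n \<star> (b [^]\<^sub>W k \<star> s j) \<star> a [^]\<^sub>W n = r (n + k + n)" for n k :: nat
    using ab j by (simp add: r_def W.m_assoc sa W.nat_pow_mult[symmetric])
  have hit: "a [^]\<^sub>W n \<star> t \<star> b [^]\<^sub>W n = b [^]\<^sub>W k \<star> s j \<longleftrightarrow> t = r (n + k + n)"
    if "t \<in> carrier W" for n k :: nat and t
  proof -
    have ba: "b [^]\<^sub>W n \<star> a [^]\<^sub>W n = \<one>\<^sub>W" "a [^]\<^sub>W n \<star> b [^]\<^sub>W n = \<one>\<^sub>W"
      using ab by (simp_all flip: pow_inv)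
    have l: "b [^]\<^sub>W n \<star> (a [^]\<^sub>W n \<star> x) = x" "a [^]\<^sub>W n \<star> (b [^]\<^sub>W n \<star> x) = x"
      if "x \<in> carrier W" for x using ab that ba by (simp_all flip: W.m_assoc)
    show ?thesis
    proof
      assume eq: "a [^]\<^sub>W n \<star> t \<star> b [^]\<^sub>W n = b [^]\<^sub>W k \<star> s j"
      have "t = b [^]\<^sub>W n \<star> (a [^]\<^sub>W n \<star> t \<star> b [^]\<^sub>W n) \<star> a [^]\<^sub>W n"
        using that ab ba l by (simp add: W.m_assoc)
      then show "t = r (n + k + n)" unfolding eq bs .
    next
      assume "t = r (n + k + n)"
      then have "a [^]\<^sub>W n \<star> t \<star> b [^]\<^sub>W n =
        a [^]\<^sub>W n \<star> (b [^]\<^sub>W n \<star> (b [^]\<^sub>W k \<star> s j) \<star> a [^]\<^sub>W n) \<star> b [^]\<^sub>W n"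
        unfolding bs by simp
      also have "\<dots> = b [^]\<^sub>W k \<star> s j" using ab j ba l by (simp add: W.m_assoc)
      finally show "a [^]\<^sub>W n \<star> t \<star> b [^]\<^sub>W n = b [^]\<^sub>W k \<star> s j" .
    qed
  qed
  \<comment> \<open>Each further round makes two comparisons, of the current element with
    \<open>s j\<close> and of its conjugate with \<open>s i\<close>; in terms of the initial
    \<open>t\<close> these are \<open>t = r (2 * n)\<close> and
    \<open>t = r (Suc (2 * n))\<close>.\<close>
  have step: "((sgact i \<circ> sgact j) ^^ n) (t, e) =
      (a [^]\<^sub>W n \<star> t \<star> b [^]\<^sub>W n, e \<noteq> odd (card {k. k < 2 * n \<and> t = r k}))"
    if t: "t \<in> carrier W" for t n e
  proof (induction n)
    case 0 then show ?case using t by simp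
  next
    case (Suc n)
    define u where "u = a [^]\<^sub>W n \<star> t \<star> b [^]\<^sub>W n"
    have u: "u \<in> carrier W" using ab t by (simp add: u_def)
    have h1: "u = s j \<longleftrightarrow> t = r (2 * n)" using hit[OF t, of n 0] j by (simp add: u_def mult_2)
    have "s j \<star> u \<star> s j = s i \<longleftrightarrow> u = b [^]\<^sub>W (1::nat) \<star> s j"
    proof
      assume "s j \<star> u \<star> s j = s i"
      then have "s j \<star> (s j \<star> u \<star> s j) \<star> s j = s j \<star> s i \<star> s j" by simp
      then show "u = b [^]\<^sub>W (1::nat) \<star> s j" using u i j by (simp add: W.m_assoc b_def)
    next
      assume "u = b [^]\<^sub>W (1::nat) \<star> s j"
      then show "s j \<star> u \<star> s j = s i" using i j by (simp add: W.m_assoc b_def)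
    qed
    then have h2: "s j \<star> u \<star> s j = s i \<longleftrightarrow> t = r (Suc (2 * n))"
      using hit[OF t, of n 1] by (simp add: u_def mult_2)
    have "a [^]\<^sub>W Suc n = a \<star> a [^]\<^sub>W n" using ab(1) by (rule W.nat_pow_Suc2)
    then have c: "s i \<star> (s j \<star> u \<star> s j) \<star> s i = a [^]\<^sub>W Suc n \<star> t \<star> b [^]\<^sub>W Suc n"
      using ab t i j by (simp add: u_def a_def b_def W.m_assoc)
    have "((sgact i \<circ> sgact j) ^^ Suc n) (t, e) =
        sgact i (sgact j (u, e \<noteq> odd (card {k. k < 2 * n \<and> t = r k})))"
      unfolding funpow.simps comp_apply[of "sgact i \<circ> sgact j"] Suc by (simp add: u_def)
    also have "\<dots> = (s i \<star> (s j \<star> u \<star> s j) \<star> s i,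
        ((e \<noteq> odd (card {k. k < 2 * n \<and> t = r k})) \<noteq> (t = r (2 * n))) \<noteq> (t = r (Suc (2 * n))))"
      using u j i h1 h2 by (simp add: sgact_def)
    finally have eq: "((sgact i \<circ> sgact j) ^^ Suc n) (t, e) = (a [^]\<^sub>W Suc n \<star> t \<star> b [^]\<^sub>W Suc n,
        ((e \<noteq> odd (card {k. k < 2 * n \<and> t = r k})) \<noteq> (t = r (2 * n))) \<noteq> (t = r (Suc (2 * n))))"
      unfolding c .
    have "2 * Suc n = Suc (Suc (2 * n))" by simp
    then show ?case unfolding eq odd_card_Suc[of "Suc (2 * n)" "\<lambda>k. t = r k"]
      odd_card_Suc[of "2 * n" "\<lambda>k. t = r k"] by (simp only: odd_card_Suc) blast
  qed
  have "b [^]\<^sub>W m i j = \<one>\<^sub>W" "a [^]\<^sub>W m i j = \<one>\<^sub>W"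
    using braid[OF j i] braid[OF i j] m_sym[OF i j] by (simp_all add: a_def b_def)
  moreover have per: "r (m i j + k) = r k" for k
    using calculation ab j by (simp add: r_def W.nat_pow_mult[symmetric])
  have "odd (card {k. k < m i j + n \<and> t = r k}) \<longleftrightarrow>
      (odd (card {k. k < m i j \<and> t = r k}) \<noteq> odd (card {k. k < n \<and> t = r k}))" for n t
  proof (induction n)
    case (Suc n)
    then show ?case using odd_card_Suc[of "m i j + n" "\<lambda>k. t = r k"]
      odd_card_Suc[of n "\<lambda>k. t = r k"] per[of n] by auto
  qed simp
  from this[of "m i j"] have "\<not> odd (card {k. k < 2 * m i j \<and> t = r k})" for t
    by (simp add: mult_2)
  ultimately have "((sgact i \<circ> sgact j) ^^ m i j) (t, e) = (t, e)" if "t \<in> carrier W" for t e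
    using step[OF that] that by simp
  moreover have "((sgact i \<circ> sgact j) ^^ n) (t, e) = (t, e)" if "t \<notin> carrier W" for t e n
    using that by (induction n) (auto simp: sgact_def)
  ultimately have "((sgact i \<circ> sgact j) ^^ m i j) (t, e) = (t, e)" for t e
    by (cases "t \<in> carrier W") blast+
  then show ?thesis by (simp add: fun_eq_iff)
qed

text \<open>\<open>neg w t\<close> says that \<open>w\<close> sends the positive root of the reflection \<open>t\<close> to a negative root.\<close>

definition neg :: "'i gword set \<Rightarrow> 'i gword set \<Rightarrow> bool" where
  "neg = (SOME n. (\<forall>t\<in>carrier W. \<not> n \<one>\<^sub>W t) \<and> (\<forall>i\<in>I. \<forall>t\<in>carrier W. n (s i) t \<longleftrightarrow> t = s i) \<and>
     (\<forall>v\<in>carrier W. \<forall>w\<in>carrier W. \<forall>t\<in>carrier W.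
        n (v \<star> w) t \<longleftrightarrow> (n w t \<noteq> n v (w \<star> t \<star> inv\<^sub>W w))))"

text \<open>The action of \<open>w\<close> on signed reflections conjugates \<open>t\<close> and
  changes the sign by an amount that does not depend on the given sign. This amount is the cocycle,
  and multiplicativity of the action is the cocycle identity.\<close>

lemma neg_exists: "\<exists>n. (\<forall>t\<in>carrier W. \<not> n \<one>\<^sub>W t) \<and> (\<forall>i\<in>I. \<forall>t\<in>carrier W. n (s i) t \<longleftrightarrow> t = s i) \<and>
     (\<forall>v\<in>carrier W. \<forall>w\<in>carrier W. \<forall>t\<in>carrier W.
        n (v \<star> w) t \<longleftrightarrow> (n w t \<noteq> n v (w \<star> t \<star> inv\<^sub>W w)))"
proof -
  obtain h where h: "\<And>v w. v \<in> carrier W \<Longrightarrow> w \<in> carrier W \<Longrightarrow> h (v \<star> w) = h v \<circ> h w"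
    "h \<one>\<^sub>W = id" "\<And>i. i \<in> I \<Longrightarrow> h (s i) = sgact i"
    by (rule W_act[of sgact, OF sgact_invol sgact_braid that])
  have ex: "\<exists>N. \<forall>b. h w (t, b) = (w \<star> t \<star> inv\<^sub>W w, b \<noteq> N)"
    if "w \<in> carrier W" "t \<in> carrier W" for w t
    using that
  proof (induction w rule: W_induct)
    case one then show ?case by (auto simp: h intro: exI[of _ False])
  next
    case (mult i w)
    then obtain N where N: "\<And>b. h w (t, b) = (w \<star> t \<star> inv\<^sub>W w, b \<noteq> N)" by blast
    let ?u = "w \<star> t \<star> inv\<^sub>W w"
    have "h (s i \<star> w) (t, b) = (s i \<star> ?u \<star> s i, b \<noteq> (N \<noteq> (?u = s i)))" for b
      using mult.hyps mult.prems N[of b] by (auto simp: h sgact_def)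
    moreover have "s i \<star> ?u \<star> s i = s i \<star> w \<star> t \<star> inv\<^sub>W (s i \<star> w)"
      using mult.hyps mult.prems by (simp add: W.inv_mult_group W.m_assoc)
    ultimately have "\<forall>b. h (s i \<star> w) (t, b) =
        (s i \<star> w \<star> t \<star> inv\<^sub>W (s i \<star> w), b \<noteq> (N \<noteq> (?u = s i)))" by simp
    then show ?case by blast
  qed
  have h2: "h w (t, b) = (w \<star> t \<star> inv\<^sub>W w, b \<noteq> snd (h w (t, False)))"
    if wt: "w \<in> carrier W" "t \<in> carrier W" for w t b
  proof -
    obtain N where N: "\<And>b. h w (t, b) = (w \<star> t \<star> inv\<^sub>W w, b \<noteq> N)" using ex[OF wt] by blast
    show ?thesis using N[of b] N[of False] by simp
  qed
  show ?thesis
  proof (intro exI[of _ "\<lambda>w t. snd (h w (t, False))"] conjI ballI)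
    fix v w t assume "v \<in> carrier W" "w \<in> carrier W" "t \<in> carrier W"
    then have "h (v \<star> w) (t, False) = h v (w \<star> t \<star> inv\<^sub>W w, snd (h w (t, False)))"
      using h2[of w t False] by (simp add: h)
    also have "\<dots> = (v \<star> (w \<star> t \<star> inv\<^sub>W w) \<star> inv\<^sub>W v,
       snd (h w (t, False)) \<noteq> snd (h v (w \<star> t \<star> inv\<^sub>W w, False)))"
      using \<open>v \<in> _\<close> \<open>w \<in> _\<close> \<open>t \<in> _\<close> by (intro h2) auto
    finally show "snd (h (v \<star> w) (t, False)) \<longleftrightarrow>
       (snd (h w (t, False)) \<noteq> snd (h v (w \<star> t \<star> inv\<^sub>W w, False)))" by simp
  qed (simp_all add: h sgact_def)
qed

lemmas neg_props = someI_ex[OF neg_exists, folded neg_def]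

lemma neg_one [simp]: "t \<in> carrier W \<Longrightarrow> \<not> neg \<one>\<^sub>W t"
  and neg_s [simp]: "i \<in> I \<Longrightarrow> t \<in> carrier W \<Longrightarrow> neg (s i) t \<longleftrightarrow> t = s i"
  and neg_mult: "v \<in> carrier W \<Longrightarrow> w \<in> carrier W \<Longrightarrow> t \<in> carrier W \<Longrightarrow>
    neg (v \<star> w) t \<longleftrightarrow> (neg w t \<noteq> neg v (w \<star> t \<star> inv\<^sub>W w))"
  using neg_props by blast+

lemma neg_mult_s: "w \<in> carrier W \<Longrightarrow> i \<in> I \<Longrightarrow> neg (w \<star> s i) (s i) \<longleftrightarrow> \<not> neg w (s i)"
  by (simp add: neg_mult)

lemma neg_inv: "w \<in> carrier W \<Longrightarrow> t \<in> carrier W \<Longrightarrow> neg (inv\<^sub>W w) (w \<star> t \<star> inv\<^sub>W w) \<longleftrightarrow> neg w t"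
  using neg_mult[of "inv\<^sub>W w" w t] by simp

text \<open>The sign is accumulated letter by letter from the right, so some letter \<open>a\<close>
  must flip it, and it can do so only when the suffix \<open>z\<close> behind it conjugates
  \<open>t\<close> to \<open>s a\<close>.\<close>

lemma neg_witness:
  assumes "x \<in> lists I" "t \<in> carrier W" "neg (word x) t"
  shows "\<exists>y a z. x = y @ a # z \<and> word z \<star> t = s a \<star> word z"
  using assms(1,3)
proof (induction x)
  case Nil then show ?case using assms by simp
next
  case (Cons i x)
  have x: "word x \<in> carrier W" "i \<in> I" using Cons.hyps by simp_all
  show ?case
  proof (cases "neg (word x) t")
    case True
    then obtain y a z where "x = y @ a # z" "word z \<star> t = s a \<star> word z" using Cons.IH by blast
    then show ?thesis by (intro exI[of _ "i # y"] exI[of _ a] exI[of _ z]) simp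
  next
    case False
    then have "word x \<star> t \<star> inv\<^sub>W word x = s i"
      using Cons.prems neg_mult[of "s i" "word x" t] x assms(2) by simp
    then have "word x \<star> t \<star> inv\<^sub>W word x \<star> word x = s i \<star> word x" by simp
    then have "word x \<star> t = s i \<star> word x" using x assms(2) by (simp add: W.m_assoc)
    then show ?thesis by blast
  qed
qed

text \<open>The letter \<open>a\<close> found by \<open>neg_witness\<close> meets a second
  \<open>s a\<close>, and both cancel. The new word uses only letters of \<open>x\<close>, so the
  statement also serves parabolic subgroups.\<close>

lemma exchange:
  assumes "x \<in> lists J" "J \<subseteq> I" "t \<in> carrier W" "neg (word x) t"
  shows "\<exists>y\<in>lists J. length y < length x \<and> word x \<star> t = word y"
proof -
  have xI: "x \<in> lists I" using assms(1,2) by auto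
  obtain y a z where x: "x = y @ a # z" and eq: "word z \<star> t = s a \<star> word z"
    using neg_witness[OF xI assms(3,4)] by blast
  have yz: "y \<in> lists I" "a \<in> I" "z \<in> lists I" using xI by (simp_all add: x)
  have "word x \<star> t = word y \<star> (s a \<star> (word z \<star> t))"
    using yz assms(3) by (simp add: x W.m_assoc)
  also have "\<dots> = word (y @ z)" using yz by (simp add: eq)
  finally show ?thesis using assms(1) by (intro bexI[of _ "y @ z"]) (simp_all add: x)
qed

subsection \<open>Reduced words and minimal coset representatives\<close>

text \<open>Minimality is only among words over \<open>J\<close>, which spares a comparison of the
  length functions of W_J and \<open>W\<close>.\<close>

definition reduced :: "'i set \<Rightarrow> 'i list \<Rightarrow> bool" where
  "reduced J x \<longleftrightarrow> x \<in> lists J \<and> (\<forall>y\<in>lists J. word y = word x \<longrightarrow> length x \<le> length y)"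

lemma reduced_exists:
  assumes "w \<in> word ` lists J"
  obtains x where "reduced J x" "word x = w"
proof -
  obtain x where "x \<in> lists J \<and> word x = w" using assms by auto
  then obtain x where "x \<in> lists J \<and> word x = w"
    "\<forall>y. y \<in> lists J \<and> word y = w \<longrightarrow> length x \<le> length y"
    using ex_has_least_nat[of "\<lambda>x. x \<in> lists J \<and> word x = w" x length] by blast
  then show ?thesis using that[of x] by (auto simp: reduced_def)
qed

text \<open>Otherwise \<open>word x\<close> would be negative at \<open>s i\<close>, and the
  exchange would give a word for \<open>word (x @ [i])\<close> that is even shorter than
  \<open>x\<close>.\<close>

lemma reduced_snoc_neg:
  assumes "reduced J (x @ [i])" "J \<subseteq> I"
  shows "neg (word (x @ [i])) (s i)"
proof (rule ccontr)
  assume n: "\<not> neg (word (x @ [i])) (s i)"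
  have x: "x \<in> lists J" "i \<in> J" "x \<in> lists I" "i \<in> I" using assms by (auto simp: reduced_def)
  then have "neg (word x) (s i)" using n neg_mult_s[of "word x" i] by simp
  then obtain y where "y \<in> lists J" "length y < length x" "word x \<star> s i = word y"
    using exchange[OF x(1) assms(2) s_closed[OF x(4)]] by blast
  then show False using assms x by (auto simp: reduced_def)
qed

lemma reduced_tail: "reduced J (a # x) \<Longrightarrow> J \<subseteq> I \<Longrightarrow> reduced J x"
  unfolding reduced_def
proof (intro conjI ballI impI)
  fix y assume r: "a # x \<in> lists J \<and> (\<forall>y\<in>lists J. word y = word (a # x) \<longrightarrow> length (a # x) \<le> length y)"
    and y: "y \<in> lists J" "word y = word x"
  then have "a # y \<in> lists J" "word (a # y) = word (a # x)" by simp_all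
  then have "length (a # x) \<le> length (a # y)" using r by blast
  then show "length x \<le> length y" by simp
qed simp

lemma reduced_no_repeat: "reduced J (a # a # x) \<Longrightarrow> J \<subseteq> I \<Longrightarrow> False"
proof -
  assume r: "reduced J (a # a # x)" and J: "J \<subseteq> I"
  then have "x \<in> lists J" "a \<in> I" "x \<in> lists I" by (auto simp: reduced_def)
  then have "word x = word (a # a # x)" by simp
  then show False using r \<open>x \<in> lists J\<close> unfolding reduced_def
    by (metis Suc_n_not_le_n le_SucI length_Cons)
qed

lemma reduced_alt:
  assumes "reduced {i, j} x" "i \<in> I" "j \<in> I"
  shows "x = alt i j (length x) \<or> x = alt j i (length x)"
  using assms(1)
proof (induction x)
  case (Cons a x)
  have a: "a \<in> {i, j}" using Cons by (auto simp: reduced_def)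
  from Cons reduced_tail[of "{i, j}" a x] assms have IH: "x = alt i j (length x) \<or> x = alt j i (length x)"
    by auto
  show ?case
  proof (cases x)
    case (Cons b y)
    then have "a \<noteq> b" using reduced_no_repeat[of "{i, j}" a y] Cons.prems assms by auto
    then show ?thesis using IH a Cons by auto
  qed (use a in auto)
qed simp

lemma alt_lists [simp]: "a \<in> A \<Longrightarrow> b \<in> A \<Longrightarrow> alt a b n \<in> lists A"
  using set_alt[of a b n] by (auto simp: in_lists_conv_set)

text \<open>Peeling the first letter off both words exchanges their roles and leaves
  \<open>s i\<close> on the left and \<open>s j\<close> on the right; thus the parity of
  \<open>n\<close> does not enter.\<close>

lemma word_alt_inv:
  assumes "i \<in> I" "j \<in> I"
  shows "word (alt i j n) \<star> inv\<^sub>W word (alt j i n) = (s i \<star> s j) [^]\<^sub>W n"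
  using assms
proof (induction n arbitrary: i j)
  case (Suc n)
  have "word (alt i j (Suc n)) \<star> inv\<^sub>W word (alt j i (Suc n)) =
    s i \<star> (word (alt j i n) \<star> inv\<^sub>W word (alt i j n)) \<star> s j"
    using Suc.prems by (simp add: W.inv_mult_group W.m_assoc)
  also have "\<dots> = s i \<star> (s j \<star> s i) [^]\<^sub>W n \<star> s j"
    using Suc by simp
  also have "\<dots> = (s i \<star> s j) [^]\<^sub>W Suc n"
  proof -
    have "s i \<star> (s j \<star> s i) [^]\<^sub>W n = (s i \<star> s j) [^]\<^sub>W n \<star> s i" for n :: nat
    proof (induction n)
      case (Suc n)
      have "s i \<star> (s j \<star> s i) [^]\<^sub>W Suc n = s i \<star> (s j \<star> s i) [^]\<^sub>W n \<star> (s j \<star> s i)"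
        using \<open>i \<in> I\<close> \<open>j \<in> I\<close> by (simp add: W.m_assoc)
      then show ?case using Suc \<open>i \<in> I\<close> \<open>j \<in> I\<close> by (simp add: W.m_assoc)
    qed (use \<open>i \<in> I\<close> in simp)
    then show ?thesis using \<open>i \<in> I\<close> \<open>j \<in> I\<close> by (simp add: W.m_assoc)
  qed
  finally show ?case .
qed simp

lemma word_alt_eq_iff:
  assumes "i \<in> I" "j \<in> I"
  shows "word (alt i j n) = word (alt j i n) \<longleftrightarrow> m i j dvd n"
proof -
  have c: "word (alt i j n) \<in> carrier W" "word (alt j i n) \<in> carrier W" using assms by simp_all
  have "word (alt i j n) = word (alt j i n) \<longleftrightarrow>
      word (alt i j n) \<star> inv\<^sub>W word (alt j i n) = \<one>\<^sub>W"
    using c by (metis W.inv_closed W.inv_equality W.inv_inv W.r_inv)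
  also have "\<dots> \<longleftrightarrow> (s i \<star> s j) [^]\<^sub>W n = \<one>\<^sub>W" using word_alt_inv[OF assms] by simp
  also have "\<dots> \<longleftrightarrow> m i j dvd n"
  proof
    assume "m i j dvd n"
    then obtain k where "n = m i j * k" by (elim dvdE)
    then show "(s i \<star> s j) [^]\<^sub>W n = \<one>\<^sub>W"
      using braid[OF assms] assms by (simp flip: W.nat_pow_pow)
  qed (use order_dvd assms in blast)
  finally show ?thesis .
qed

text \<open>In a longer alternating word the first letter \<open>a\<close> is followed by at least
  \<open>m i j\<close> letters; the braid relation turns these into a word that begins with
  \<open>a\<close>, and the two cancel.\<close>

lemma reduced_length_le:
  assumes "reduced {i, j} x" "i \<in> I" "j \<in> I" "m i j \<noteq> 0"
  shows "length x \<le> m i j"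
proof (rule ccontr)
  assume n: "\<not> length x \<le> m i j"
  have "\<exists>a b. {a, b} = {i, j} \<and> x = alt a b (length x)"
    using reduced_alt[OF assms(1-3)] by (auto intro: exI[of _ i] exI[of _ j])
  then obtain a b where ab: "{a, b} = {i, j}" "x = alt a b (length x)" by blast
  have abI: "a \<in> I" "b \<in> I" and mab: "m a b = m i j" using ab assms m_sym by (auto simp: doubleton_eq_iff)
  obtain k where k: "length x = Suc (m i j + k)" using n by (metis add_Suc_right less_natE not_le)
  define z where "z = (if even (m i j) then alt b a k else alt a b k)"
  have abJ: "a \<in> {i, j}" "b \<in> {i, j}" using ab(1) by auto
  have z: "alt b a (m i j + k) = alt b a (m i j) @ z" "z \<in> lists {i, j}" "z \<in> lists I" "length z = k"
    using alt_append[of b a "m i j" k] alt_lists[OF abJ] alt_lists[OF abJ(2,1)]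
      alt_lists[OF abI] alt_lists[OF abI(2,1)] by (simp_all only: z_def if_split length_alt simp_thms split: if_split)
  obtain l where l: "m i j = Suc l" using assms(4) by (cases "m i j") auto
  have "word x = s a \<star> (word (alt b a (m i j)) \<star> word z)"
    using ab(2) k z abI by (metis alt.simps(2) alt_lists word_append word_simps(2))
  also have "word (alt b a (m i j)) = word (alt a b (m i j))"
    using word_alt_eq_iff[OF abI, of "m i j"] mab by simp
  also have "s a \<star> (word (alt a b (m i j)) \<star> word z) = word (alt b a l @ z)"
    using abI z by (simp add: l W.m_assoc)
  finally have "word (alt b a l @ z) = word x" by simp
  moreover have "alt b a l @ z \<in> lists {i, j}" using z alt_lists[OF abJ(2,1)] by simp
  ultimately have "length x \<le> length (alt b a l @ z)" using assms(1) unfolding reduced_def by blast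
  then show False using k l z by simp
qed

lemma word_lists_closed:
  assumes "J \<subseteq> I" "v \<in> word ` lists J" "w \<in> word ` lists J"
  shows "v \<star> w \<in> word ` lists J" "inv\<^sub>W v \<in> word ` lists J" "v \<in> carrier W"
proof -
  obtain x y where xy: "x \<in> lists J" "y \<in> lists J" "v = word x" "w = word y" using assms by auto
  then have I: "x \<in> lists I" "y \<in> lists I" using assms by auto
  show "v \<star> w \<in> word ` lists J" using xy I by (intro image_eqI[of _ _ "x @ y"]) auto
  show "inv\<^sub>W v \<in> word ` lists J" using xy I
    by (intro image_eqI[of _ _ "rev x"]) (simp_all add: inv_word)
  show "v \<in> carrier W" using xy I by simp
qed

text \<open>A shortest element \<open>u\<close> of the coset of \<open>w\<close> is positive on all
  of W_J, since the exchange would otherwise shorten it within the coset. The last clause keeps the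
  minimality itself, which makes the recursion in \<open>simple_root_induct\<close> descend.\<close>

lemma min_coset:
  assumes "J \<subseteq> I" "w \<in> carrier W"
  obtains u v x where "w = u \<star> v" "u \<in> carrier W" "v \<in> word ` lists J"
    "\<And>t. t \<in> word ` lists J \<Longrightarrow> \<not> neg u t"
    "x \<in> lists I" "word x = u"
    "\<And>y v. y \<in> lists I \<Longrightarrow> v \<in> word ` lists J \<Longrightarrow> word y = w \<star> v \<Longrightarrow> length x \<le> length y"
proof -
  let ?P = "\<lambda>x. x \<in> lists I \<and> (\<exists>v\<in>word ` lists J. word x = w \<star> v)"
  obtain x0 where "x0 \<in> lists I" "word x0 = w" using assms carrier_eq_word by auto
  moreover have "\<one>\<^sub>W \<in> word ` lists J" by (intro image_eqI[of _ _ "[]"]) auto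
  ultimately have "?P x0" using assms by (intro conjI bexI[of _ "\<one>\<^sub>W"]) simp_all
  then obtain x where x: "?P x" "\<forall>y. ?P y \<longrightarrow> length x \<le> length y"
    using ex_has_least_nat[of ?P x0 length] by blast
  then obtain v where v: "v \<in> word ` lists J" "word x = w \<star> v" by auto
  note cl = word_lists_closed[OF assms(1)]
  show ?thesis
  proof (rule that[of "word x" "inv\<^sub>W v" x])
    show "w = word x \<star> inv\<^sub>W v" using v cl(3)[OF v(1) v(1)] assms by (simp add: W.m_assoc)
    show "\<not> neg (word x) t" if t: "t \<in> word ` lists J" for t
    proof
      assume "neg (word x) t"
      then obtain y where y: "y \<in> lists I" "length y < length x" "word x \<star> t = word y"
        using exchange[of x I t] x cl(3)[OF t t] by auto
      then have "word y = w \<star> (v \<star> t)"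
        using v cl(3)[OF v(1) v(1)] cl(3)[OF t t] assms by (simp add: W.m_assoc)
      then have "?P y" using y cl(1)[OF v(1) t] by blast
      then have "length x \<le> length y" using x(2) by blast
      then show False using y(2) by simp
    qed
    show "length x \<le> length y" if "y \<in> lists I" "v \<in> word ` lists J" "word y = w \<star> v" for y v
      using x(2) that by blast
  qed (use conjunct1[OF x(1)] cl(2)[OF v(1) v(1)] in \<open>simp_all only: word_closed\<close>)
qed

subsection \<open>Elements sending a simple root to a simple root\<close>

text \<open>Let \<open>x\<close> be a nonempty reduced word for \<open>v\<close>. Then
  \<open>x @ [j]\<close> and \<open>k # x\<close> are reduced words for the same element. They
  alternate and begin with different letters, so their length is a multiple of \<open>m i j\<close>,
  and being reduced it is at most \<open>m i j\<close>. Hence \<open>x\<close> is the alternating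
  word of length \<open>m i j - 1\<close> of \<open>Q_alt\<close>. The predicate \<open>Q\<close> is
  abstract to keep the combinatorics apart from the algebra.\<close>

lemma dihedral_simple_root:
  assumes Q_one: "\<And>j. j \<in> I \<Longrightarrow> Q \<one>\<^sub>W j j"
    and Q_alt: "\<And>i j. i \<in> I \<Longrightarrow> j \<in> I \<Longrightarrow> i \<noteq> j \<Longrightarrow> m i j \<noteq> 0 \<Longrightarrow>
      Q (word (alt j i (m i j - 1))) (if even (m i j - 1) then j else i) i"
    and ij: "i \<in> I" "j \<in> I" "i \<noteq> j" and k: "k \<in> {i, j}" and v: "v \<in> word ` lists {i, j}"
    and eq: "v \<star> s j = s k \<star> v" and pos: "\<not> neg v (s j)"
  shows "Q v j k"
proof -
  obtain x where x: "reduced {i, j} x" "word x = v" using reduced_exists[OF v] by blast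
  have J: "{i, j} \<subseteq> I" and kI: "k \<in> I" using ij k by auto
  have xl: "x \<in> lists {i, j}" "x \<in> lists I" using x J by (auto simp: reduced_def)
  have vc: "v \<in> carrier W" using x xl by auto
  show ?thesis
  proof (cases x)
    case Nil
    then have "v = \<one>\<^sub>W" using x by simp
    then show ?thesis using eq s_inj[of j k] ij kI Q_one[of j] by simp
  next
    case (Cons c x')
    let ?n = "length x"
    have red1: "reduced {i, j} (x @ [j])"
      unfolding reduced_def
    proof (intro conjI ballI impI)
      show "x @ [j] \<in> lists {i, j}" using xl by simp
      fix y assume y: "y \<in> lists {i, j}" "word y = word (x @ [j])"
      show "length (x @ [j]) \<le> length y"
      proof (rule ccontr)
        \<comment> \<open>A shorter word would still be negative at \<open>s j\<close>, and the
          exchange would produce a word for \<open>v\<close> shorter than \<open>x\<close>.\<close>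
        assume short: "\<not> length (x @ [j]) \<le> length y"
        have yI: "y \<in> lists I" using y J by auto
        have wy: "word y = v \<star> s j" using y x xl ij by simp
        have "neg (word y) (s j)" using wy pos neg_mult_s vc ij by simp
        then obtain z where z: "z \<in> lists {i, j}" "length z < length y" "word y \<star> s j = word z"
          using exchange[OF y(1) J s_closed[OF ij(2)]] by blast
        then have "word z = word x" using wy vc ij x by simp
        then have "length x \<le> length z" using x z by (simp add: reduced_def)
        moreover have "even (length y) \<longleftrightarrow> even (length (x @ [j]))"
          using even_length_cong[of y "x @ [j]"] yI xl ij y(2) by simp
        ultimately show False using z short by auto
      qed
    qed
    have weq: "word (k # x) = word (x @ [j])" using x xl ij kI eq by simp
    have red2: "reduced {i, j} (k # x)"
      using red1 weq xl k by (simp add: reduced_def)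
    define l where "l = (if k = i then j else i)"
    have l: "l \<in> I" "l \<noteq> k" "{k, l} = {i, j}" "m k l = m i j"
      using k ij m_sym by (auto simp: l_def)
    have A: "k # x = alt k l (Suc ?n)"
      using reduced_alt[OF red2] ij k l by (auto simp: l_def split: if_splits)
    then have x_alt: "x = alt l k ?n" by simp
    \<comment> \<open>The two words begin differently: \<open>x\<close> begins with
      \<open>l\<close>, because \<open>k # x\<close> alternates.\<close>
    have "x @ [j] \<noteq> alt k l (Suc ?n)"
    proof
      assume "x @ [j] = alt k l (Suc ?n)"
      then have "c = k" using Cons by simp
      moreover have "c = l" using x_alt Cons by (metis alt.simps(2) length_Cons list.inject)
      ultimately show False using l by simp
    qed
    then have B: "x @ [j] = alt l k (Suc ?n)"
      using reduced_alt[OF red1] ij k l by (auto simp: l_def split: if_splits)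
    have "word (alt k l (Suc ?n)) = word (alt l k (Suc ?n))" using A B weq by metis
    then have dvd: "m k l dvd Suc ?n" using word_alt_eq_iff[OF kI l(1), of "Suc ?n"] by blast
    then have m0: "m k l \<noteq> 0" by (metis dvd_0_left_iff nat.distinct(1))
    have "length (k # x) \<le> m i j" using reduced_length_le[OF red2] ij m0 l by simp
    then have mn: "m k l = Suc ?n" using dvd l by (metis dvd_imp_le le_antisym length_Cons zero_less_Suc)
    have "alt l k (Suc ?n) = x @ [if even ?n then l else k]" using x_alt alt_snoc[of l k ?n] by simp
    then have "(if even ?n then l else k) = j" using B by simp
    then show ?thesis using Q_alt[OF kI l(1) l(2)[symmetric] m0] mn x_alt x(2) by simp
  qed
qed

text \<open>The step removes from \<open>w\<close> its component in the dihedral group generated by \<open>s j\<close> and a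
  descent \<open>s i\<close>: this component must itself send a simple root to a simple root.\<close>

lemma simple_root_induct:
  assumes Q_one: "\<And>j. j \<in> I \<Longrightarrow> Q \<one>\<^sub>W j j"
    and Q_mult: "\<And>v w j k l. v \<in> carrier W \<Longrightarrow> w \<in> carrier W \<Longrightarrow> j \<in> I \<Longrightarrow> k \<in> I \<Longrightarrow> l \<in> I \<Longrightarrow>
      Q v k l \<Longrightarrow> Q w j k \<Longrightarrow> Q (v \<star> w) j l"
    and Q_alt: "\<And>i j. i \<in> I \<Longrightarrow> j \<in> I \<Longrightarrow> i \<noteq> j \<Longrightarrow> m i j \<noteq> 0 \<Longrightarrow>
      Q (word (alt j i (m i j - 1))) (if even (m i j - 1) then j else i) i"
    and x: "x \<in> lists I" and jk: "j \<in> I" "k \<in> I"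
    and eq: "word x \<star> s j = s k \<star> word x" and pos: "\<not> neg (word x) (s j)"
  shows "Q (word x) j k"
  using x jk eq pos
proof (induction "length x" arbitrary: x j rule: less_induct)
  case less
  let ?w = "word x"
  have wc: "?w \<in> carrier W" using less by simp
  obtain y where y: "reduced I y" "word y = ?w" using reduced_exists[of ?w I] less by auto
  have yx: "length y \<le> length x" using y less by (auto simp: reduced_def)
  show ?case
  proof (cases y rule: rev_exhaust)
    case Nil
    then have "word x = \<one>\<^sub>W" using y by simp
    then show ?thesis using s_inj[of j k] less.prems Q_one[of j] by simp
  next
    case (snoc y' i)
    have i: "i \<in> I" "y' \<in> lists I" using y snoc by (auto simp: reduced_def)
    have "neg ?w (s i)" using reduced_snoc_neg[of I y' i] y snoc by simp
    \<comment> \<open>\<open>?w\<close> is negative at \<open>s i\<close> and positive at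
      \<open>s j\<close>.\<close>
    then have ij: "i \<noteq> j" using less.prems by blast
    let ?J = "{i, j}"
    have J: "?J \<subseteq> I" using i less by auto
    obtain u v z where w: "?w = u \<star> v" "u \<in> carrier W" "v \<in> word ` lists ?J"
      and upos: "\<And>t. t \<in> word ` lists ?J \<Longrightarrow> \<not> neg u t"
      and z: "z \<in> lists I" "word z = u"
      and min: "\<And>y v. y \<in> lists I \<Longrightarrow> v \<in> word ` lists ?J \<Longrightarrow> word y = ?w \<star> v \<Longrightarrow> length z \<le> length y"
      by (rule min_coset[OF J wc]) blast
    note cl = word_lists_closed[OF J]
    have sJ': "s a \<in> word ` lists ?J" if "a \<in> ?J" for a
    proof -
      have "a \<in> I" using that J by blast
      then show ?thesis using that by (intro image_eqI[of _ _ "[a]"]) simp_all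
    qed
    have sJ: "s i \<in> word ` lists ?J" "s j \<in> word ` lists ?J" using sJ' by blast+
    have vc: "v \<in> carrier W" using cl(3)[OF w(3) w(3)] .
    have "?w = word y' \<star> s i" using y(2) snoc i by simp
    then have "word y' = ?w \<star> s i" using i by simp
    then have "length z \<le> length y'" using min[OF i(2) sJ(1)] by simp
    then have zx: "length z < length x" using yx snoc by simp
    \<comment> \<open>The reflection which \<open>u\<close> conjugates to \<open>s k\<close>; the
      aim is to show that it is simple.\<close>
    define r where "r = v \<star> s j \<star> inv\<^sub>W v"
    have rJ: "r \<in> word ` lists ?J" unfolding r_def by (rule cl(1)[OF cl(1)[OF w(3) sJ(2)] cl(2)[OF w(3) w(3)]])
    have rc: "r \<in> carrier W" using cl(3)[OF rJ rJ] .
    have rv: "r \<star> v = v \<star> s j" using vc less by (simp add: r_def W.m_assoc)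
    have ur: "u \<star> r = s k \<star> u"
    proof -
      have "u \<star> r \<star> v = s k \<star> u \<star> v" using less.prems(4) w vc rv rc less.prems by (simp add: W.m_assoc)
      then show ?thesis using w vc rc less.prems by simp
    qed
    obtain q where q: "reduced ?J q" "word q = r" using reduced_exists[OF rJ] by blast
    have "q \<noteq> []"
    proof
      assume "q = []"
      then have "r = \<one>\<^sub>W" using q by simp
      then have "v = v \<star> s j" using rv vc by simp
      then show False using vc less.prems s_neq_one[of j] by (metis W.l_cancel_one' s_closed)
    qed
    then obtain q' a where qa: "q = q' @ [a]" by (cases q rule: rev_exhaust) auto
    have a: "a \<in> ?J" "a \<in> I" using q qa J by (auto simp: reduced_def)
    have saJ: "s a \<in> word ` lists ?J" using a sJ' by blast
    have na: "neg r (s a)" using reduced_snoc_neg[of ?J q' a] q qa J by simp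
    \<comment> \<open>As \<open>u\<close> is positive on the dihedral group, the negative sign of
      \<open>r\<close> at its last letter \<open>a\<close> survives in
      \<open>u \<star> r = s k \<star> u\<close>. There it can only come from \<open>s k\<close>, so
      \<open>u\<close> conjugates \<open>s a\<close> to \<open>s k\<close>, and
      \<open>r = s a\<close> follows.\<close>
    have "neg (u \<star> r) (s a)"
    proof -
      have "r \<star> s a \<star> inv\<^sub>W r \<in> word ` lists ?J" by (rule cl(1)[OF cl(1)[OF rJ saJ] cl(2)[OF rJ rJ]])
      then show ?thesis using neg_mult[of u r "s a"] upos na w rc a by simp
    qed
    then have "neg (s k) (u \<star> s a \<star> inv\<^sub>W u)"
      unfolding ur using neg_mult[of "s k" u "s a"] upos[OF saJ] w less.prems a by simp
    then have usa: "u \<star> s a \<star> inv\<^sub>W u = s k" using w less.prems a by simp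
    then have us: "u \<star> s a = s k \<star> u" using w(2) a less.prems by (metis W.inv_solve_right W.m_closed s_closed)
    then have ra: "r = s a" using ur w rc a by (metis W.l_cancel s_closed)
    have "Q u a k"
      using less.hyps[OF zx z(1) a(2)] z us upos[OF saJ] less.prems by simp
    moreover have "Q v j a"
    proof (rule dihedral_simple_root[of Q i j a v, OF Q_one Q_alt])
      show "v \<star> s j = s a \<star> v" using rv ra by simp
      have "v \<star> s j \<star> inv\<^sub>W v \<in> word ` lists ?J" using rJ r_def by simp
      then show "\<not> neg v (s j)" using less.prems(5) neg_mult[of u v "s j"] upos w vc less.prems by simp
    qed (use i less.prems ij a w in auto)
    ultimately show ?thesis unfolding w(1) using Q_mult w vc less.prems a by blast
  qed
qed

end

section \<open>The algebra \<open>hat H(W)\<close>\<close>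

lemma quotient_lift:
  assumes "ideal J R" "ring S" "h \<in> ring_hom R S" "\<And>x. x \<in> J \<Longrightarrow> h x = \<zero>\<^bsub>S\<^esub>"
  obtains h' where "h' \<in> ring_hom (R Quot J) S" "\<And>x. x \<in> carrier R \<Longrightarrow> h' (J +>\<^bsub>R\<^esub> x) = h x"
proof -
  interpret J: ideal J R by fact
  interpret S: ring S by fact
  interpret h: ring_hom_ring R S h
    by (rule ring_hom_ringI2) (use assms J.ring_axioms in auto)
  have const: "h y = h x" if "x \<in> carrier R" "y \<in> J +>\<^bsub>R\<^esub> x" for x y
    using that assms(4) J.a_subset by (auto simp: a_r_coset_def' subset_iff)
  define h' where "h' C = h (SOME x. x \<in> C)" for C
  have h': "h' (J +>\<^bsub>R\<^esub> x) = h x" if "x \<in> carrier R" for x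
    unfolding h'_def using const[OF that] someI[of "\<lambda>y. y \<in> J +>\<^bsub>R\<^esub> x", OF J.a_rcos_self[OF that]] by blast
  have "h' \<in> ring_hom (R Quot J) S"
  proof (rule ring_hom_memI)
    note hom = J.rcos_ring_hom
    have cos: "\<exists>x\<in>carrier R. C = J +>\<^bsub>R\<^esub> x" if "C \<in> carrier (R Quot J)" for C
      using that by (auto simp: FactRing_simps)
    fix A B assume A: "A \<in> carrier (R Quot J)" and B: "B \<in> carrier (R Quot J)"
    obtain x y where xy: "x \<in> carrier R" "y \<in> carrier R" "A = J +>\<^bsub>R\<^esub> x" "B = J +>\<^bsub>R\<^esub> y"
      using cos[OF A] cos[OF B] by blast
    show "h' A \<in> carrier S" using xy h' by simp
    show "h' (A \<otimes>\<^bsub>R Quot J\<^esub> B) = h' A \<otimes>\<^bsub>S\<^esub> h' B"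
      unfolding xy(3,4) ring_hom_mult[OF hom xy(1,2), symmetric] using xy h' by simp
    show "h' (A \<oplus>\<^bsub>R Quot J\<^esub> B) = h' A \<oplus>\<^bsub>S\<^esub> h' B"
      unfolding xy(3,4) ring_hom_add[OF hom xy(1,2), symmetric] using xy h' by simp
  next
    show "h' \<one>\<^bsub>R Quot J\<^esub> = \<one>\<^bsub>S\<^esub>" using h'[of "\<one>\<^bsub>R\<^esub>"] by (simp add: FactRing_def)
  qed
  then show ?thesis using that h' by blast
qed

section \<open>Relations and universal property of hat H(W)\<close>

lemma monoid_free_monoid: "monoid (free_monoid A)"
  by unfold_locales (auto simp: free_monoid_def)

text \<open>Together with \<open>braid_rhs_Suc\<close> this gives relation (iii) the form D_i v = v
  D_k, with the same alternating word v of length \<open>m i j - 1\<close> on both sides.\<close>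

lemma braid_lhs_Suc: "braid_lhs i j (Suc n) = GD i # map GS (alt j i n)"
  by (simp add: braid_lhs_def alt_conv_map upt_conv_Cons map_Suc_upt[symmetric] del: upt_Suc)

lemma braid_rhs_Suc: "braid_rhs i j (Suc n) = map GS (alt j i n) @ [GD (if even n then j else i)]"
  by (simp add: braid_rhs_def alt_conv_map)

context coxeter
begin

abbreviation H :: "'i hat ring" where "H \<equiv> hat_H I m"
abbreviation hs :: "'i \<Rightarrow> 'i hat" where "hs \<equiv> hat_s I m"
abbreviation hD :: "'i \<Rightarrow> 'i hat" where "hD \<equiv> hat_d I m"
abbreviation U :: "'i gword set \<Rightarrow> 'i hat" where "U \<equiv> hat_w I m"
abbreviation hmult (infixl "\<cdot>" 70) where "x \<cdot> y \<equiv> x \<otimes>\<^bsub>H\<^esub> y"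
abbreviation hadd (infixl "\<oplus>\<^sub>H" 65) where "x \<oplus>\<^sub>H y \<equiv> x \<oplus>\<^bsub>H\<^esub> y"
abbreviation hneg ("\<ominus>\<^sub>H _" [81] 80) where "\<ominus>\<^sub>H x \<equiv> \<ominus>\<^bsub>H\<^esub> x"
abbreviation hminus (infixl "\<ominus>\<^sub>H" 65) where "x \<ominus>\<^sub>H y \<equiv> x \<ominus>\<^bsub>H\<^esub> y"
abbreviation hone ("\<one>\<^sub>H") where "\<one>\<^sub>H \<equiv> \<one>\<^bsub>H\<^esub>"
abbreviation hzero ("\<zero>\<^sub>H") where "\<zero>\<^sub>H \<equiv> \<zero>\<^bsub>H\<^esub>"
abbreviation letters :: "'i hgen set" where "letters \<equiv> GS ` I \<union> GD ` I"

sublocale F: ring "hat_free I"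
  unfolding hat_free_def by (rule ring_monoid_ring[OF monoid_free_monoid])

lemma hat_free_simps:
  "x \<in> carrier (hat_free I) \<longleftrightarrow> keys x \<subseteq> lists letters"
  "x \<oplus>\<^bsub>hat_free I\<^esub> y = x + y" "\<zero>\<^bsub>hat_free I\<^esub> = 0" "\<one>\<^bsub>hat_free I\<^esub> = frag_of []"
  "frag_of a \<otimes>\<^bsub>hat_free I\<^esub> frag_of b = frag_of (a @ b)"
  by (simp_all add: hat_free_def monoid_ring_simps) (simp_all add: free_monoid_def)

lemma hat_free_diff:
  assumes "x \<in> carrier (hat_free I)" "y \<in> carrier (hat_free I)"
  shows "x - y \<in> carrier (hat_free I)" "x \<ominus>\<^bsub>hat_free I\<^esub> y = x - y"
proof -
  have "\<ominus>\<^bsub>hat_free I\<^esub> y = - y" using assms unfolding hat_free_def by (intro a_inv_monoid_ring)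
  then show "x \<ominus>\<^bsub>hat_free I\<^esub> y = x - y" by (simp add: a_minus_def hat_free_simps)
  then show "x - y \<in> carrier (hat_free I)" using assms F.minus_closed by metis
qed

lemma hat_free_lift:
  assumes "ring R" "\<And>g. g \<in> letters \<Longrightarrow> f g \<in> carrier R"
  obtains h where "h \<in> ring_hom (hat_free I) R"
    "\<And>x. x \<in> lists letters \<Longrightarrow> h (frag_of x) = foldr (\<lambda>g a. f g \<otimes>\<^bsub>R\<^esub> a) x \<one>\<^bsub>R\<^esub>"
proof -
  interpret R: ring R by fact
  let ?ev = "\<lambda>x. foldr (\<lambda>g a. f g \<otimes>\<^bsub>R\<^esub> a) x \<one>\<^bsub>R\<^esub>"
  have c: "x \<in> lists letters \<Longrightarrow> ?ev x \<in> carrier R" for x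
    by (induction x) (auto simp: assms)
  have ap: "?ev (x @ y) = ?ev x \<otimes>\<^bsub>R\<^esub> ?ev y" if "x \<in> lists letters" "y \<in> lists letters" for x y
    using that(1)
  proof (induction x)
    case (Cons g x)
    then show ?case using assms(2)[of g] c[of x] c[OF that(2)] by (simp add: R.m_assoc)
  qed (use c[OF that(2)] in simp)
  show ?thesis
    by (rule monoid_ring_universal[of "free_monoid letters" R ?ev])
      (use assms c ap that in \<open>auto simp: free_monoid_def hat_free_def monoid_free_monoid[unfolded free_monoid_def]\<close>)
qed

lemma hat_rels_carrier: "hat_rels I m \<subseteq> carrier (hat_free I)"
proof -
  have of: "frag_of x \<in> carrier (hat_free I)" if "x \<in> lists letters" for x :: "'i hgen list"
    using that by (simp add: hat_free_simps)
  have add: "x + y \<in> carrier (hat_free I)" if "x \<in> carrier (hat_free I)" "y \<in> carrier (hat_free I)" for x y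
    using F.a_closed[OF that] by (simp add: hat_free_simps)
  have l: "concat (replicate n [GS i, GS j]) \<in> lists letters" if "i \<in> I" "j \<in> I" for i j n
    using that by (induction n) auto
  have b: "braid_lhs i j n \<in> lists letters" "braid_rhs i j n \<in> lists letters" if "i \<in> I" "j \<in> I" for i j n
    using that by (auto simp: braid_lhs_def braid_rhs_def)
  show ?thesis unfolding hat_rels_def
    by (intro Un_least subsetI; clarify; intro hat_free_diff add of) (simp_all add: l b)
qed

sublocale J: ideal "hat_ideal I m" "hat_free I"
  unfolding hat_ideal_def by (rule F.genideal_ideal[OF hat_rels_carrier])

sublocale H: ring H
  unfolding hat_H_def by (rule J.quotient_is_ring)

abbreviation proj :: "'i pre_hat \<Rightarrow> 'i hat" where "proj \<equiv> (+>\<^bsub>hat_free I\<^esub>) (hat_ideal I m)"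

lemma proj_hom: "proj \<in> ring_hom (hat_free I) H"
  unfolding hat_H_def by (rule J.rcos_ring_hom)

lemma hs_closed [simp]: "i \<in> I \<Longrightarrow> hs i \<in> carrier H"
  and hd_closed [simp]: "i \<in> I \<Longrightarrow> hD i \<in> carrier H"
  using ring_hom_closed[OF proj_hom] by (simp_all add: hat_s_def hat_d_def hat_free_simps)

definition hgen :: "'i hgen \<Rightarrow> 'i hat" where
  "hgen g = (case g of GS i \<Rightarrow> hs i | GD i \<Rightarrow> hD i)"

definition hev :: "'i hgen list \<Rightarrow> 'i hat" where
  "hev x = foldr (\<lambda>g a. hgen g \<cdot> a) x \<one>\<^sub>H"

lemma hev_simps [simp]: "hev [] = \<one>\<^sub>H" "hev (GS i # x) = hs i \<cdot> hev x" "hev (GD i # x) = hD i \<cdot> hev x"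
  by (simp_all add: hev_def hgen_def)

lemma hev_closed: "x \<in> lists letters \<Longrightarrow> hev x \<in> carrier H"
  by (induction x) auto

lemma hev_append: "x \<in> lists letters \<Longrightarrow> y \<in> lists letters \<Longrightarrow> hev (x @ y) = hev x \<cdot> hev y"
proof (induction x)
  case (Cons g x) then show ?case using hev_closed[of x] hev_closed[of y] by (auto simp: H.m_assoc)
qed (simp add: hev_closed)

lemma proj_frag_of: "x \<in> lists letters \<Longrightarrow> proj (frag_of x) = hev x"
proof (induction x)
  case Nil then show ?case using ring_hom_one[OF proj_hom] by (simp add: hat_free_simps)
next
  case (Cons g x)
  have "frag_of (g # x) = frag_of [g] \<otimes>\<^bsub>hat_free I\<^esub> frag_of x" by (simp add: hat_free_simps)
  then have "proj (frag_of (g # x)) = proj (frag_of [g]) \<cdot> proj (frag_of x)"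
    using Cons ring_hom_mult[OF proj_hom, of "frag_of [g]" "frag_of x"] by (simp add: hat_free_simps)
  then show ?case using Cons by (auto simp: hat_s_def hat_d_def)
qed

lemma proj_diff:
  assumes "x \<in> carrier (hat_free I)" "y \<in> carrier (hat_free I)"
  shows "proj (x - y) = proj x \<ominus>\<^sub>H proj y"
proof -
  have "proj \<in> hom (free_Abelian_group (lists letters)) (add_monoid H)"
    using ring_hom_additive[OF proj_hom[unfolded hat_free_def]] by (simp add: free_monoid_def hat_free_def)
  then show ?thesis using additive_diff[OF H.is_abelian_group] assms by (simp add: hat_free_simps)
qed

lemma proj_eqI:
  assumes "x - y \<in> hat_rels I m" "x \<in> carrier (hat_free I)" "y \<in> carrier (hat_free I)"
  shows "proj x = proj y"
proof -
  have "x - y \<in> hat_ideal I m"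
    using F.genideal_self[OF hat_rels_carrier] assms(1) unfolding hat_ideal_def by blast
  then have "proj (x - y) = \<zero>\<^sub>H"
    using F.a_rcos_zero[OF J.is_ideal] by (simp add: hat_H_def FactRing_def)
  then show ?thesis using proj_diff[OF assms(2,3)] ring_hom_closed[OF proj_hom] assms
    by (simp add: H.r_right_minus_eq)
qed

lemma hs_square [simp]: "i \<in> I \<Longrightarrow> hs i \<cdot> hs i = \<one>\<^sub>H"
  using proj_eqI[of "frag_of [GS i, GS i]" "frag_of []"]
  by (auto simp: hat_rels_def proj_frag_of hat_free_simps)

lemma hd_idem: "i \<in> I \<Longrightarrow> hD i \<cdot> hD i = hD i"
  using proj_eqI[of "frag_of [GD i, GD i]" "frag_of [GD i]"]
  by (auto simp: hat_rels_def proj_frag_of hat_free_simps)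

lemma hs_hd:
  assumes "i \<in> I"
  shows "hs i \<cdot> hD i \<oplus>\<^sub>H hD i \<cdot> hs i = hs i \<ominus>\<^sub>H \<one>\<^sub>H"
proof -
  let ?f = "\<lambda>x. frag_of x :: 'i pre_hat"
  have c: "?f [GS i, GD i] \<in> carrier (hat_free I)" "?f [GD i, GS i] \<in> carrier (hat_free I)"
    "?f [GS i] \<in> carrier (hat_free I)" "?f [] \<in> carrier (hat_free I)"
    using assms by (auto simp: hat_free_simps)
  have "proj (?f [GS i, GD i] + ?f [GD i, GS i]) = proj (?f [GS i] - ?f [])"
    by (rule proj_eqI) (use assms c F.a_closed[OF c(1,2)] hat_free_diff(1) in
      \<open>auto simp: hat_rels_def hat_free_simps(2)\<close>)
  then show ?thesis using ring_hom_add[OF proj_hom c(1,2)] assms c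
    by (simp add: proj_diff proj_frag_of hat_free_simps(2))
qed

lemma hs_braid: "i \<in> I \<Longrightarrow> j \<in> I \<Longrightarrow> (hs i \<cdot> hs j) [^]\<^bsub>H\<^esub> m i j = \<one>\<^sub>H"
proof -
  assume ij: "i \<in> I" "j \<in> I"
  have l: "concat (replicate n [GS i, GS j]) \<in> lists letters" for n
    using ij by (induction n) auto
  have "hev (concat (replicate n [GS i, GS j])) = (hs i \<cdot> hs j) [^]\<^bsub>H\<^esub> n" for n
  proof (induction n)
    case (Suc n)
    then show ?case using ij H.nat_pow_Suc2[of "hs i \<cdot> hs j" n] by (simp add: H.m_assoc)
  qed simp
  moreover have "proj (frag_of (concat (replicate (m i j) [GS i, GS j]))) = proj (frag_of [])"
    by (rule proj_eqI) (use ij l in \<open>auto simp: hat_rels_def hat_free_simps\<close>)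
  ultimately show ?thesis using l by (simp add: proj_frag_of)
qed

text \<open>Monomials are built up from the left, so closure under left multiplication by the
  generators suffices besides closure under differences.\<close>

lemma H_induct [consumes 1, case_names zero one diff hs hd]:
  assumes "x \<in> carrier H" "P \<zero>\<^sub>H" "P \<one>\<^sub>H"
    "\<And>x y. x \<in> carrier H \<Longrightarrow> y \<in> carrier H \<Longrightarrow> P x \<Longrightarrow> P y \<Longrightarrow> P (x \<ominus>\<^sub>H y)"
    "\<And>i x. i \<in> I \<Longrightarrow> x \<in> carrier H \<Longrightarrow> P x \<Longrightarrow> P (hs i \<cdot> x)"
    "\<And>i x. i \<in> I \<Longrightarrow> x \<in> carrier H \<Longrightarrow> P x \<Longrightarrow> P (hD i \<cdot> x)"
  shows "P x"
proof -
  have hev: "P (hev y)" if "y \<in> lists letters" for y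
    using that
  proof (induction y)
    case (Cons g y) then show ?case using hev_closed[of y] assms(5,6) by auto
  qed (simp add: assms)
  obtain f where f: "f \<in> carrier (hat_free I)" "x = proj f"
    using assms(1) by (auto simp: hat_H_def FactRing_def A_RCOSETS_def')
  have "keys f \<subseteq> lists letters" using f(1) by (simp add: hat_free_simps)
  then have "keys f \<subseteq> lists letters \<and> P (proj f)"
  proof (induction f rule: frag_induction)
    case zero
    have "proj 0 = \<zero>\<^sub>H" using ring_hom_zero[OF proj_hom F.ring_axioms H.ring_axioms] by (simp add: hat_free_simps)
    then show ?case using assms(2) by simp
  next
    case (one y) then show ?case using hev proj_frag_of by simp
  next
    case (diff a b)
    then have ab: "a \<in> carrier (hat_free I)" "b \<in> carrier (hat_free I)" by (simp_all add: hat_free_simps)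
    then have "P (proj a \<ominus>\<^sub>H proj b)" using diff assms(4) ring_hom_closed[OF proj_hom] by blast
    then show ?case using ab hat_free_diff(1)[OF ab] proj_diff[OF ab] by (simp add: hat_free_simps)
  qed
  then show ?thesis using f by simp
qed

text \<open>The last assumption is relation (iii) in the form with a single alternating word on both
  sides.\<close>

lemma H_lift:
  assumes "ring R" "\<And>i. i \<in> I \<Longrightarrow> fs i \<in> carrier R" "\<And>i. i \<in> I \<Longrightarrow> fd i \<in> carrier R"
    "\<And>i. i \<in> I \<Longrightarrow> fs i \<otimes>\<^bsub>R\<^esub> fs i = \<one>\<^bsub>R\<^esub>" "\<And>i. i \<in> I \<Longrightarrow> fd i \<otimes>\<^bsub>R\<^esub> fd i = fd i"
    "\<And>i. i \<in> I \<Longrightarrow> fs i \<otimes>\<^bsub>R\<^esub> fd i \<oplus>\<^bsub>R\<^esub> fd i \<otimes>\<^bsub>R\<^esub> fs i = fs i \<ominus>\<^bsub>R\<^esub> \<one>\<^bsub>R\<^esub>"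
    "\<And>i j. i \<in> I \<Longrightarrow> j \<in> I \<Longrightarrow> (fs i \<otimes>\<^bsub>R\<^esub> fs j) [^]\<^bsub>R\<^esub> m i j = \<one>\<^bsub>R\<^esub>"
    "\<And>i j n. i \<in> I \<Longrightarrow> j \<in> I \<Longrightarrow> i \<noteq> j \<Longrightarrow> m i j = Suc n \<Longrightarrow>
      fd i \<otimes>\<^bsub>R\<^esub> foldr (\<lambda>k a. fs k \<otimes>\<^bsub>R\<^esub> a) (alt j i n) \<one>\<^bsub>R\<^esub> =
      foldr (\<lambda>k a. fs k \<otimes>\<^bsub>R\<^esub> a) (alt j i n) \<one>\<^bsub>R\<^esub> \<otimes>\<^bsub>R\<^esub> fd (if even n then j else i)"
  obtains h where "h \<in> ring_hom H R" "\<And>i. i \<in> I \<Longrightarrow> h (hs i) = fs i" "\<And>i. i \<in> I \<Longrightarrow> h (hD i) = fd i"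
proof -
  interpret R: ring R by fact
  let ?f = "\<lambda>g. case g of GS i \<Rightarrow> fs i | GD i \<Rightarrow> fd i"
  let ?ev = "\<lambda>x. foldr (\<lambda>g a. ?f g \<otimes>\<^bsub>R\<^esub> a) x \<one>\<^bsub>R\<^esub>"
  obtain h where h: "h \<in> ring_hom (hat_free I) R" and ev: "\<And>x. x \<in> lists letters \<Longrightarrow> h (frag_of x) = ?ev x"
    by (rule hat_free_lift[of R ?f]) (use assms in \<open>auto split: hgen.splits\<close>)
  interpret h: ring_hom_ring "hat_free I" R h
    by (rule ring_hom_ringI2[OF F.ring_axioms R.ring_axioms h])
  have hd: "h (x - y) = h x \<ominus>\<^bsub>R\<^esub> h y" if "x \<in> carrier (hat_free I)" "y \<in> carrier (hat_free I)" for x y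
    using that hat_free_diff(2)[OF that, symmetric] by (simp add: a_minus_def)
  have ha: "h (x + y) = h x \<oplus>\<^bsub>R\<^esub> h y" if "x \<in> carrier (hat_free I)" "y \<in> carrier (hat_free I)" for x y
    using h.hom_add[OF that] by (simp add: hat_free_simps)
  have of: "frag_of x \<in> carrier (hat_free I)" if "x \<in> lists letters" for x :: "'i hgen list"
    using that by (simp add: hat_free_simps)
  have zero: "h (frag_of x - frag_of y) = \<zero>\<^bsub>R\<^esub>" if "x \<in> lists letters" "y \<in> lists letters" "?ev x = ?ev y" for x y
    using that hd[OF of of] ev h.hom_closed[OF of[OF that(2)]] by simp
  have pw: "?ev (concat (replicate n [GS i, GS j])) = (fs i \<otimes>\<^bsub>R\<^esub> fs j) [^]\<^bsub>R\<^esub> n \<and>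
     concat (replicate n [GS i, GS j]) \<in> lists letters" if "i \<in> I" "j \<in> I" for i j n
  proof (induction n)
    case (Suc n)
    then show ?case using that assms(2) R.nat_pow_Suc2[of "fs i \<otimes>\<^bsub>R\<^esub> fs j" n] by (simp add: R.m_assoc)
  qed simp
  have evS: "?ev (map GS x) = foldr (\<lambda>k a. fs k \<otimes>\<^bsub>R\<^esub> a) x \<one>\<^bsub>R\<^esub>" for x by (induction x) auto
  have evSD: "?ev (map GS x @ [GD k]) = foldr (\<lambda>k a. fs k \<otimes>\<^bsub>R\<^esub> a) x \<one>\<^bsub>R\<^esub> \<otimes>\<^bsub>R\<^esub> fd k"
    if "x \<in> lists I" "k \<in> I" for x k
  proof -
    have c: "foldr (\<lambda>k a. fs k \<otimes>\<^bsub>R\<^esub> a) x \<one>\<^bsub>R\<^esub> \<in> carrier R" if "x \<in> lists I" for x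
      using that by (induction x) (auto simp: assms)
    show ?thesis using that(1)
    proof (induction x)
      case (Cons a x) then show ?case using c[of x] assms(2,3) that(2) by (simp add: R.m_assoc)
    qed (use assms(3) that(2) in simp)
  qed
  have br: "?ev (braid_lhs i j (m i j)) = ?ev (braid_rhs i j (m i j))"
    "braid_lhs i j (m i j) \<in> lists letters" "braid_rhs i j (m i j) \<in> lists letters"
    if ij: "i \<in> I" "j \<in> I" "i \<noteq> j" "m i j \<noteq> 0" for i j
  proof -
    obtain n where n: "m i j = Suc n" using ij(4) by (cases "m i j") auto
    have "(if even n then j else i) \<in> I" using ij by simp
    from evSD[OF alt_lists[OF ij(2,1), of n] this]
    show "?ev (braid_lhs i j (m i j)) = ?ev (braid_rhs i j (m i j))"
      using assms(8)[OF ij(1-3) n] evS[of "alt j i n"]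
      by (simp only: n braid_lhs_Suc braid_rhs_Suc foldr.simps comp_apply hgen.case)
    show "braid_lhs i j (m i j) \<in> lists letters" "braid_rhs i j (m i j) \<in> lists letters"
      using ij by (auto simp: braid_lhs_def braid_rhs_def)
  qed
  have hr: "h r = \<zero>\<^bsub>R\<^esub>" if rr: "r \<in> hat_rels I m" for r
  proof -
    consider (s) i where "i \<in> I" "r = frag_of [GS i, GS i] - frag_of []"
      | (d) i where "i \<in> I" "r = frag_of [GD i, GD i] - frag_of [GD i]"
      | (sd) i where "i \<in> I" "r = frag_of [GS i, GD i] + frag_of [GD i, GS i] - (frag_of [GS i] - frag_of [])"
      | (ss) i j where "i \<in> I" "j \<in> I" "r = frag_of (concat (replicate (m i j) [GS i, GS j])) - frag_of []"
      | (b) i j where "i \<in> I" "j \<in> I" "i \<noteq> j" "m i j \<noteq> 0"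
          "r = frag_of (braid_lhs i j (m i j)) - frag_of (braid_rhs i j (m i j))"
      using rr unfolding hat_rels_def by blast
    then show ?thesis
    proof cases
      case s then show ?thesis using assms by (simp add: zero)
    next
      case d then show ?thesis using assms by (simp add: zero)
    next
      case sd
      have c: "frag_of [GS i, GD i] \<in> carrier (hat_free I)" "frag_of [GD i, GS i] \<in> carrier (hat_free I)"
        "frag_of [GS i] \<in> carrier (hat_free I)" "frag_of [] \<in> carrier (hat_free I)"
        using sd by (simp_all add: of)
      have "frag_of [GS i, GD i] + frag_of [GD i, GS i] \<in> carrier (hat_free I)"
        using F.a_closed[OF c(1,2)] by (simp add: hat_free_simps(2))
      then have "h r = h (frag_of [GS i, GD i]) \<oplus>\<^bsub>R\<^esub> h (frag_of [GD i, GS i]) \<ominus>\<^bsub>R\<^esub>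
          (h (frag_of [GS i]) \<ominus>\<^bsub>R\<^esub> h (frag_of []))"
        using c hat_free_diff(1) unfolding sd(2) by (simp add: hd ha)
      then show ?thesis using sd(1) assms by (simp add: ev)
    next
      case ss
      have "?ev (concat (replicate (m i j) [GS i, GS j])) = ?ev []"
        using pw[OF ss(1,2), of "m i j"] assms(7)[OF ss(1,2)] by simp
      then show ?thesis unfolding ss(3) using pw[OF ss(1,2), of "m i j"] by (intro zero) auto
    next
      case b
      show ?thesis unfolding b(5) by (rule zero[OF br(2,3,1)]) (rule b)+
    qed
  qed
  have "hat_rels I m \<subseteq> a_kernel (hat_free I) R h"
  proof
    fix r assume r: "r \<in> hat_rels I m"
    show "r \<in> a_kernel (hat_free I) R h"
      unfolding a_kernel_def' using hr[OF r] subsetD[OF hat_rels_carrier r] by blast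
  qed
  then have "hat_ideal I m \<subseteq> a_kernel (hat_free I) R h"
    unfolding hat_ideal_def by (intro F.genideal_minimal h.kernel_is_ideal)
  then have hz: "h x = \<zero>\<^bsub>R\<^esub>" if "x \<in> hat_ideal I m" for x
    using that unfolding a_kernel_def' by blast
  obtain h' where h': "h' \<in> ring_hom (hat_free I Quot hat_ideal I m) R"
    "\<And>x. x \<in> carrier (hat_free I) \<Longrightarrow> h' (hat_ideal I m +>\<^bsub>hat_free I\<^esub> x) = h x"
    by (rule quotient_lift[OF J.is_ideal assms(1) h hz that])
  have "h' (hs i) = fs i" "h' (hD i) = fd i" if "i \<in> I" for i
    using that h'(2)[OF of] assms(2,3) by (simp_all add: hat_s_def hat_d_def ev)
  then show ?thesis using that[of h'] h'(1) by (simp add: hat_H_def)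
qed

subsection \<open>The group ring\<close>

text \<open>It justifies the definite description: existence comes from the universal properties of
  \<open>W\<close> and of the monoid ring, uniqueness from the generators on the carrier and from
  extensionality outside it.\<close>

lemma ZW_map_props:
  assumes "ring R" "\<And>i. i \<in> I \<Longrightarrow> t i \<in> carrier R" "\<And>i. i \<in> I \<Longrightarrow> t i \<otimes>\<^bsub>R\<^esub> t i = \<one>\<^bsub>R\<^esub>"
    "\<And>i j. i \<in> I \<Longrightarrow> j \<in> I \<Longrightarrow> (t i \<otimes>\<^bsub>R\<^esub> t j) [^]\<^bsub>R\<^esub> m i j = \<one>\<^bsub>R\<^esub>"
  shows "ZW_map I m R t \<in> ring_hom (ZW I m) R \<inter> extensional (carrier (ZW I m)) \<and>
      (\<forall>i\<in>I. ZW_map I m R t (frag_of (s i)) = t i)"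
  and ZW_map_eqI: "\<And>\<phi>. \<phi> \<in> ring_hom (ZW I m) R \<Longrightarrow> (\<And>i. i \<in> I \<Longrightarrow> \<phi> (frag_of (s i)) = t i) \<Longrightarrow>
      x \<in> carrier (ZW I m) \<Longrightarrow> ZW_map I m R t x = \<phi> x"
proof -
  interpret R: ring R by fact
  let ?P = "\<lambda>\<phi>. \<phi> \<in> ring_hom (ZW I m) R \<inter> extensional (carrier (ZW I m)) \<and>
             (\<forall>i\<in>I. \<phi> (frag_of (s i)) = t i)"
  have Z: "ring (ZW I m)" by (rule ring_monoid_ring) (rule W.is_monoid)
  obtain g where g: "g \<in> hom W R" "g \<one>\<^sub>W = \<one>\<^bsub>R\<^esub>" "\<And>i. i \<in> I \<Longrightarrow> g (s i) = t i"
    using W_lift[OF R.monoid_axioms assms(2-4)] by blast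
  obtain \<phi> where \<phi>: "\<phi> \<in> ring_hom (ZW I m) R" "\<And>w. w \<in> carrier W \<Longrightarrow> \<phi> (frag_of w) = g w"
    by (rule monoid_ring_universal[of W R g])
      (use assms g in \<open>auto simp: W.is_monoid hom_def Pi_def\<close>)
  have ex: "?P (restrict \<phi> (carrier (ZW I m)))"
    using \<phi> g(3) ring.ring_simprules(1,5,6)[OF Z]
    by (auto simp: ring_hom_def monoid_ring_simps(6))
  have uniq: "\<phi> x = \<psi> x" if P: "\<phi> \<in> ring_hom (ZW I m) R" "\<psi> \<in> ring_hom (ZW I m) R"
    "\<And>i. i \<in> I \<Longrightarrow> \<phi> (frag_of (s i)) = t i" "\<And>i. i \<in> I \<Longrightarrow> \<psi> (frag_of (s i)) = t i"
    "x \<in> carrier (ZW I m)" for \<phi> \<psi> x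
  proof (rule monoid_ring_hom_unique[OF R.is_abelian_group ring_hom_additive[OF P(1)] ring_hom_additive[OF P(2)]])
    show "keys x \<subseteq> carrier W" using P(5) by (simp add: monoid_ring_simps)
    fix w assume "w \<in> carrier W"
    then show "\<phi> (frag_of w) = \<psi> (frag_of w)"
    proof (induction w rule: W_induct)
      case one
      show ?case using ring_hom_one[OF P(1)] ring_hom_one[OF P(2)] by (simp add: monoid_ring_simps)
    next
      case (mult i w)
      then show ?case
        using ring_hom_mult[OF P(1), of "frag_of (s i)" "frag_of w"]
          ring_hom_mult[OF P(2), of "frag_of (s i)" "frag_of w"] P(3,4)
        by (simp add: monoid_ring_simps)
    qed
  qed
  have the: "ZW_map I m R t = restrict \<phi> (carrier (ZW I m))"
    unfolding ZW_map_def
  proof (rule the_equality)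
    show "?P (restrict \<phi> (carrier (ZW I m)))" by (rule ex)
    fix \<psi> assume \<psi>: "?P \<psi>"
    then have \<psi>': "\<psi> \<in> ring_hom (ZW I m) R" "\<And>i. i \<in> I \<Longrightarrow> \<psi> (frag_of (s i)) = t i" by blast+
    have ex': "restrict \<phi> (carrier (ZW I m)) \<in> ring_hom (ZW I m) R"
      "\<And>i. i \<in> I \<Longrightarrow> restrict \<phi> (carrier (ZW I m)) (frag_of (s i)) = t i" using ex by blast+
    show "\<psi> = restrict \<phi> (carrier (ZW I m))"
    proof (rule extensionalityI[of _ "carrier (ZW I m)"])
      fix x assume "x \<in> carrier (ZW I m)"
      then show "\<psi> x = restrict \<phi> (carrier (ZW I m)) x"
        using uniq[OF \<psi>'(1) ex'(1)] \<psi>'(2) ex'(2) by blast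
    qed (use \<psi> in \<open>simp_all only: Int_iff restrict_extensional\<close>)
  qed
  then show 1: "?P (ZW_map I m R t)" using ex by simp
  have 2: "ZW_map I m R t \<in> ring_hom (ZW I m) R"
    "\<And>i. i \<in> I \<Longrightarrow> ZW_map I m R t (frag_of (s i)) = t i" using 1 by blast+
  show "ZW_map I m R t x = \<psi> x" if "\<psi> \<in> ring_hom (ZW I m) R"
    "\<And>i. i \<in> I \<Longrightarrow> \<psi> (frag_of (s i)) = t i" "x \<in> carrier (ZW I m)" for \<psi>
    by (rule uniq[OF 2(1) that(1) 2(2) that(2,3)])
qed

lemmas hat_ZW = ZW_map_props[OF H.ring_axioms hs_closed hs_square hs_braid]

lemma hat_ZW_hom: "ZW_map I m H hs \<in> ring_hom (ZW I m) H"
  using hat_ZW by blast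

lemma U_closed [simp]: "w \<in> carrier W \<Longrightarrow> U w \<in> carrier H"
  using ring_hom_closed[OF hat_ZW_hom] by (simp add: hat_w_def monoid_ring_simps)

lemma U_one [simp]: "U \<one>\<^sub>W = \<one>\<^sub>H"
  using ring_hom_one[OF hat_ZW_hom] by (simp add: hat_w_def monoid_ring_simps)

lemma U_mult: "v \<in> carrier W \<Longrightarrow> w \<in> carrier W \<Longrightarrow> U (v \<star> w) = U v \<cdot> U w"
  using ring_hom_mult[OF hat_ZW_hom, of "frag_of v" "frag_of w"] by (simp add: hat_w_def monoid_ring_simps)

lemma U_s [simp]: "i \<in> I \<Longrightarrow> U (s i) = hs i"
  using hat_ZW by (simp add: hat_w_def)

lemma U_inv [simp]: "w \<in> carrier W \<Longrightarrow> U w \<cdot> U (inv\<^sub>W w) = \<one>\<^sub>H"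
  "w \<in> carrier W \<Longrightarrow> U (inv\<^sub>W w) \<cdot> U w = \<one>\<^sub>H"
  by (simp_all flip: U_mult)

lemma U_inv_cancel [simp]:
  "w \<in> carrier W \<Longrightarrow> x \<in> carrier H \<Longrightarrow> U w \<cdot> (U (inv\<^sub>W w) \<cdot> x) = x"
  "w \<in> carrier W \<Longrightarrow> x \<in> carrier H \<Longrightarrow> U (inv\<^sub>W w) \<cdot> (U w \<cdot> x) = x"
  by (simp_all flip: H.m_assoc)

lemma hev_map_GS: "x \<in> lists I \<Longrightarrow> hev (map GS x) = U (word x)"
  by (induction x) (auto simp: U_mult)

text \<open>Relation (iii), shaped as the premise \<open>Q_alt\<close> of
  \<open>simple_root_induct\<close> for the predicate
  \<open>U w \<cdot> hD j = hD k \<cdot> U w\<close>.\<close>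

lemma hd_braid:
  assumes "i \<in> I" "j \<in> I" "i \<noteq> j" "m i j \<noteq> 0"
  shows "U (word (alt j i (m i j - 1))) \<cdot> hD (if even (m i j - 1) then j else i) =
    hD i \<cdot> U (word (alt j i (m i j - 1)))"
proof -
  obtain n where n: "m i j = Suc n" using assms(4) by (cases "m i j") auto
  have l: "braid_lhs i j (Suc n) \<in> lists letters" "braid_rhs i j (Suc n) \<in> lists letters"
    using assms by (auto simp: braid_lhs_def braid_rhs_def)
  have a: "alt j i n \<in> lists I" using assms by simp
  then have aG: "map GS (alt j i n) \<in> lists letters" by (auto simp: in_lists_conv_set)
  have k: "[GD (if even n then j else i)] \<in> lists letters" using assms by auto
  have "proj (frag_of (braid_lhs i j (Suc n))) = proj (frag_of (braid_rhs i j (Suc n)))"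
    by (rule proj_eqI) (use assms l in \<open>auto simp: hat_rels_def hat_free_simps simp flip: n\<close>)
  then have "hev (braid_lhs i j (Suc n)) = hev (braid_rhs i j (Suc n))" using l by (simp add: proj_frag_of)
  then show ?thesis using hev_append[OF aG k] assms(1,2) hev_map_GS[OF a]
    by (simp add: n braid_lhs_Suc braid_rhs_Suc split: if_splits)
qed

text \<open>The intertwining relation passes to products, so it is enough to have it for the
  dihedral elements, where it is \<open>hd_braid\<close>.\<close>

lemma hd_simple_root:
  assumes "w \<in> carrier W" "j \<in> I" "k \<in> I" "w \<star> s j = s k \<star> w" "\<not> neg w (s j)"
  shows "U w \<cdot> hD j = hD k \<cdot> U w"
proof -
  obtain x where x: "x \<in> lists I" "w = word x" using assms(1) carrier_eq_word by auto
  show ?thesis unfolding x(2)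
  proof (rule simple_root_induct[where Q = "\<lambda>w j k. U w \<cdot> hD j = hD k \<cdot> U w"])
    fix v w j k l
    assume vw: "v \<in> carrier W" "w \<in> carrier W" "j \<in> I" "k \<in> I" "l \<in> I"
      "U v \<cdot> hD k = hD l \<cdot> U v" "U w \<cdot> hD j = hD k \<cdot> U w"
    have "U (v \<star> w) \<cdot> hD j = U v \<cdot> (U w \<cdot> hD j)"
      using vw(1-5) by (simp add: U_mult H.m_assoc)
    also have "\<dots> = U v \<cdot> hD k \<cdot> U w" using vw(1-5) by (simp add: vw(7) H.m_assoc)
    also have "\<dots> = hD l \<cdot> U (v \<star> w)" using vw(1-5) by (simp add: vw(6) U_mult H.m_assoc)
    finally show "U (v \<star> w) \<cdot> hD j = hD l \<cdot> U (v \<star> w)" .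
  qed (use assms x hd_braid in auto)
qed

subsection \<open>The elements \<open>D\<^sub>s\<close>\<close>

abbreviation T :: "'i gword set set" where "T \<equiv> reflections I m"
abbreviation D :: "'i gword set \<Rightarrow> 'i hat" where "D \<equiv> D_refl I m"

lemma T_iff: "t \<in> T \<longleftrightarrow> (\<exists>w\<in>carrier W. \<exists>i\<in>I. t = w \<star> s i \<star> inv\<^sub>W w)"
  by (auto simp: reflections_def)

lemma T_carrier: "t \<in> T \<Longrightarrow> t \<in> carrier W"
  by (auto simp: T_iff)

lemma s_in_T [simp]: "i \<in> I \<Longrightarrow> s i \<in> T"
  unfolding T_iff by (intro bexI[of _ "\<one>\<^sub>W"] bexI[of _ i]) auto

lemma T_conj: "t \<in> T \<Longrightarrow> w \<in> carrier W \<Longrightarrow> w \<star> t \<star> inv\<^sub>W w \<in> T"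
proof -
  assume "t \<in> T" and w: "w \<in> carrier W"
  then obtain v i where "v \<in> carrier W" "i \<in> I" "t = v \<star> s i \<star> inv\<^sub>W v" unfolding T_iff by blast
  then show ?thesis unfolding T_iff using w
    by (intro bexI[of _ "w \<star> v"] bexI[of _ i]) (simp_all add: W.inv_mult_group W.m_assoc)
qed

text \<open>Replacing \<open>w\<close> by \<open>w \<star> s i\<close> leaves the reflection
  unchanged and reverses the sign.\<close>

lemma T_positive:
  assumes "t \<in> T"
  obtains w i where "w \<in> carrier W" "i \<in> I" "t = w \<star> s i \<star> inv\<^sub>W w" "\<not> neg w (s i)"
proof -
  obtain w i where w: "w \<in> carrier W" "i \<in> I" "t = w \<star> s i \<star> inv\<^sub>W w"
    using assms unfolding T_iff by blast
  show ?thesis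
  proof (cases "neg w (s i)")
    case True
    have "t = (w \<star> s i) \<star> s i \<star> inv\<^sub>W (w \<star> s i)" using w by (simp add: W.inv_mult_group W.m_assoc)
    then show ?thesis using that[of "w \<star> s i" i] w neg_mult_s True by simp
  qed (use that w in blast)
qed

text \<open>This makes D_s independent of choices: if two positive conjugations give the same
  reflection, then \<open>inv\<^sub>W w \<star> v\<close> sends the simple root of \<open>j\<close>
  to that of \<open>k\<close>, and \<open>hd_simple_root\<close> applies.\<close>

lemma conj_hd_unique:
  assumes "v \<in> carrier W" "w \<in> carrier W" "j \<in> I" "k \<in> I" "\<not> neg v (s j)" "\<not> neg w (s k)"
    "v \<star> s j \<star> inv\<^sub>W v = w \<star> s k \<star> inv\<^sub>W w"
  shows "U v \<cdot> hD j \<cdot> U (inv\<^sub>W v) = U w \<cdot> hD k \<cdot> U (inv\<^sub>W w)"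
proof -
  let ?u = "inv\<^sub>W w \<star> v"
  have "inv\<^sub>W w \<star> (v \<star> s j \<star> inv\<^sub>W v) \<star> v = inv\<^sub>W w \<star> (w \<star> s k \<star> inv\<^sub>W w) \<star> v"
    using assms(7) by simp
  moreover have "inv\<^sub>W w \<star> (v \<star> s j \<star> inv\<^sub>W v) \<star> v = ?u \<star> s j"
    using assms(1-4) by (simp add: W.m_assoc)
  moreover have "inv\<^sub>W w \<star> (w \<star> s k \<star> inv\<^sub>W w) \<star> v = s k \<star> ?u"
    using assms(1-4) by (simp add: W.m_assoc flip: W.m_assoc[of "inv\<^sub>W w" w])
  ultimately have eq: "?u \<star> s j = s k \<star> ?u" by simp
  have "\<not> neg ?u (s j)"
    using assms neg_mult[of "inv\<^sub>W w" v "s j"] neg_inv[of w "s k"] by simp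
  then have "U ?u \<cdot> hD j = hD k \<cdot> U ?u" using assms eq by (intro hd_simple_root) auto
  then have "U w \<cdot> (U ?u \<cdot> hD j) \<cdot> U (inv\<^sub>W v) = U w \<cdot> (hD k \<cdot> U ?u) \<cdot> U (inv\<^sub>W v)" by simp
  then show ?thesis using assms by (simp add: U_mult H.m_assoc)
qed

text \<open>The conjugates of \<open>hD j\<close> along positive \<open>w\<close> meet the
  description of D_s. Uniqueness is an induction over the element that conjugates a simple
  reflection to the given one.\<close>

lemma D_refl_spec:
  "D \<in> T \<rightarrow>\<^sub>E carrier H"
  "w \<in> carrier W \<Longrightarrow> j \<in> I \<Longrightarrow> \<not> neg w (s j) \<Longrightarrow> D (w \<star> s j \<star> inv\<^sub>W w) = U w \<cdot> hD j \<cdot> U (inv\<^sub>W w)"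
proof -
  define P where "P t x \<longleftrightarrow> (\<exists>w\<in>carrier W. \<exists>i\<in>I. t = w \<star> s i \<star> inv\<^sub>W w \<and> \<not> neg w (s i) \<and>
     x = U w \<cdot> hD i \<cdot> U (inv\<^sub>W w))" for t x
  define E where "E = restrict (\<lambda>t. SOME x. P t x) T"
  have E: "E (w \<star> s j \<star> inv\<^sub>W w) = U w \<cdot> hD j \<cdot> U (inv\<^sub>W w)"
    if w: "w \<in> carrier W" "j \<in> I" "\<not> neg w (s j)" for w j
  proof -
    let ?t = "w \<star> s j \<star> inv\<^sub>W w"
    have t: "?t \<in> T" using w unfolding T_iff by blast
    have "P ?t (U w \<cdot> hD j \<cdot> U (inv\<^sub>W w))" unfolding P_def using w by blast
    then have "P ?t (SOME x. P ?t x)" by (rule someI)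
    then obtain v i where v: "v \<in> carrier W" "i \<in> I" "?t = v \<star> s i \<star> inv\<^sub>W v" "\<not> neg v (s i)"
      "(SOME x. P ?t x) = U v \<cdot> hD i \<cdot> U (inv\<^sub>W v)" unfolding P_def by blast
    have "U v \<cdot> hD i \<cdot> U (inv\<^sub>W v) = U w \<cdot> hD j \<cdot> U (inv\<^sub>W w)"
      by (rule conj_hd_unique) (use v w in auto)
    then show ?thesis using t v(5) by (simp add: E_def)
  qed
  have Ecl: "E t \<in> carrier H" if "t \<in> T" for t
  proof -
    obtain w i where "w \<in> carrier W" "i \<in> I" "t = w \<star> s i \<star> inv\<^sub>W w" "\<not> neg w (s i)"
      by (rule T_positive[OF \<open>t \<in> T\<close>])
    then show ?thesis using E by simp
  qed
  have Es: "E (s i) = hD i" if "i \<in> I" for i using E[of "\<one>\<^sub>W" i] that by simp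
  have Econj: "E (s i \<star> t \<star> s i) = hs i \<cdot> E t \<cdot> hs i" if "i \<in> I" "t \<in> T - {s i}" for i t
  proof -
    have t: "t \<in> T" "t \<noteq> s i" using that(2) by auto
    obtain w j where w: "w \<in> carrier W" "j \<in> I" "t = w \<star> s j \<star> inv\<^sub>W w" "\<not> neg w (s j)"
      by (rule T_positive[OF t(1)])
    \<comment> \<open>Here \<open>t \<noteq> s i\<close> enters: \<open>s i\<close> makes no other
      reflection negative.\<close>
    have "\<not> neg (s i \<star> w) (s j)" using neg_mult[of "s i" w "s j"] w that(1) t by simp
    then have "E (s i \<star> w \<star> s j \<star> inv\<^sub>W (s i \<star> w)) = U (s i \<star> w) \<cdot> hD j \<cdot> U (inv\<^sub>W (s i \<star> w))"
      using w that(1) by (intro E) auto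
    moreover have "s i \<star> w \<star> s j \<star> inv\<^sub>W (s i \<star> w) = s i \<star> t \<star> s i"
      using w that(1) by (simp add: W.inv_mult_group W.m_assoc)
    ultimately show ?thesis using E[OF w(1,2,4)] w that(1)
      by (simp add: U_mult H.m_assoc W.inv_mult_group)
  qed
  let ?Q = "\<lambda>D. D \<in> T \<rightarrow>\<^sub>E carrier H \<and> (\<forall>i\<in>I. D (s i) = hD i) \<and>
        (\<forall>i\<in>I. \<forall>t \<in> T - {s i}. D (s i \<star> t \<star> s i) = hs i \<cdot> D t \<cdot> hs i)"
  have QE: "?Q E" using Ecl Es Econj by (auto simp: E_def)
  have "D = E"
    unfolding D_refl_def
  proof (rule the_equality)
    show "?Q E" by (rule QE)
    fix D' assume Q: "?Q D'"
    show "D' = E"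
    proof (rule extensionalityI[of _ T])
      fix t assume "t \<in> T"
      then obtain w j where wj: "w \<in> carrier W" "j \<in> I" "t = w \<star> s j \<star> inv\<^sub>W w" unfolding T_iff by blast
      have "w \<star> s j \<star> inv\<^sub>W w \<in> T \<and> D' (w \<star> s j \<star> inv\<^sub>W w) = E (w \<star> s j \<star> inv\<^sub>W w)" using wj(1)
      proof (induction w rule: W_induct)
        case one then show ?case using Q QE wj(2) by simp
      next
        case (mult i w)
        let ?t = "w \<star> s j \<star> inv\<^sub>W w"
        have eq: "s i \<star> w \<star> s j \<star> inv\<^sub>W (s i \<star> w) = s i \<star> ?t \<star> s i"
          using mult wj by (simp add: W.inv_mult_group W.m_assoc)
        have T: "s i \<star> ?t \<star> s i \<in> T" using T_conj[of ?t "s i"] mult by simp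
        show ?case
        proof (cases "?t = s i")
          \<comment> \<open>Conjugating \<open>s i\<close> by itself gives \<open>s i\<close> again,
            where both families have the prescribed value \<open>hD i\<close>.\<close>
          case True then show ?thesis unfolding eq using Q QE mult by simp
        next
          case False then show ?thesis unfolding eq using Q QE mult T by simp
        qed
      qed
      then show "D' t = E t" using wj by simp
    qed (use Q QE in \<open>auto simp: PiE_def\<close>)
  qed
  then show "D \<in> T \<rightarrow>\<^sub>E carrier H"
    "w \<in> carrier W \<Longrightarrow> j \<in> I \<Longrightarrow> \<not> neg w (s j) \<Longrightarrow> D (w \<star> s j \<star> inv\<^sub>W w) = U w \<cdot> hD j \<cdot> U (inv\<^sub>W w)"
    using QE E by simp_all
qed

lemma D_closed [simp]: "t \<in> T \<Longrightarrow> D t \<in> carrier H"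
  using D_refl_spec(1) by auto

lemma D_s [simp]: "i \<in> I \<Longrightarrow> D (s i) = hD i"
  using D_refl_spec(2)[of "\<one>\<^sub>W" i] by simp

lemma D_conj:
  assumes "t \<in> T" "w \<in> carrier W" "\<not> neg w t"
  shows "D (w \<star> t \<star> inv\<^sub>W w) = U w \<cdot> D t \<cdot> U (inv\<^sub>W w)"
proof -
  obtain v j where v: "v \<in> carrier W" "j \<in> I" "t = v \<star> s j \<star> inv\<^sub>W v" "\<not> neg v (s j)"
    by (rule T_positive[OF assms(1)])
  have "\<not> neg (w \<star> v) (s j)" using neg_mult[of w v "s j"] assms v by simp
  then have "D (w \<star> v \<star> s j \<star> inv\<^sub>W (w \<star> v)) = U (w \<star> v) \<cdot> hD j \<cdot> U (inv\<^sub>W (w \<star> v))"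
    using assms v by (intro D_refl_spec) auto
  moreover have "w \<star> v \<star> s j \<star> inv\<^sub>W (w \<star> v) = w \<star> t \<star> inv\<^sub>W w"
    using assms v by (simp add: W.inv_mult_group W.m_assoc)
  ultimately show ?thesis using D_refl_spec(2)[OF v(1,2,4)] v assms(2)
    by (simp add: U_mult H.m_assoc W.inv_mult_group)
qed

lemma D_idem: "t \<in> T \<Longrightarrow> D t \<cdot> D t = D t"
proof -
  assume "t \<in> T"
  then obtain v j where v: "v \<in> carrier W" "j \<in> I" "t = v \<star> s j \<star> inv\<^sub>W v" "\<not> neg v (s j)"
    by (rule T_positive)
  have "D t = U v \<cdot> hD j \<cdot> U (inv\<^sub>W v)" using D_refl_spec(2) v by simp
  moreover have "hD j \<cdot> (hD j \<cdot> x) = hD j \<cdot> x" if "x \<in> carrier H" for x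
    using that v(2) by (simp add: hd_idem flip: H.m_assoc)
  ultimately show ?thesis using v by (simp add: H.m_assoc)
qed

end

section \<open>The ring of additive endomorphisms\<close>

definition end_ring :: "('a::ab_group_add \<Rightarrow> 'a) ring" where
  "end_ring = \<lparr>carrier = {h. \<forall>x y. h (x + y) = h x + h y}, monoid.mult = (\<circ>), one = id,
     ring.zero = (\<lambda>_. 0), ring.add = (\<lambda>f g x. f x + g x)\<rparr>"

lemma ring_end_ring: "ring end_ring"
proof (rule ringI)
  have neg: "\<exists>g\<in>carrier end_ring. (\<lambda>x. g x + f x) = (\<lambda>_. 0)" if "f \<in> carrier end_ring" for f :: "'a \<Rightarrow> 'a"
    using that by (intro bexI[of _ "\<lambda>x. - f x"]) (auto simp: end_ring_def)
  show "abelian_group (end_ring :: ('a \<Rightarrow> 'a) ring)"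
    by (rule abelian_groupI) (use neg in \<open>auto simp: end_ring_def algebra_simps\<close>)
  show "monoid (end_ring :: ('a \<Rightarrow> 'a) ring)"
    by unfold_locales (auto simp: end_ring_def)
  fix f g h :: "'a \<Rightarrow> 'a"
  assume "f \<in> carrier end_ring" "g \<in> carrier end_ring" "h \<in> carrier end_ring"
  then show "(f \<oplus>\<^bsub>end_ring\<^esub> g) \<otimes>\<^bsub>end_ring\<^esub> h = f \<otimes>\<^bsub>end_ring\<^esub> h \<oplus>\<^bsub>end_ring\<^esub> g \<otimes>\<^bsub>end_ring\<^esub> h"
    "h \<otimes>\<^bsub>end_ring\<^esub> (f \<oplus>\<^bsub>end_ring\<^esub> g) = h \<otimes>\<^bsub>end_ring\<^esub> f \<oplus>\<^bsub>end_ring\<^esub> h \<otimes>\<^bsub>end_ring\<^esub> g"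
    by (auto simp: end_ring_def)
qed

lemma end_ring_simps:
  "h \<in> carrier end_ring \<longleftrightarrow> (\<forall>x y. h (x + y) = h x + h y)" "f \<otimes>\<^bsub>end_ring\<^esub> g = f \<circ> g"
  "\<one>\<^bsub>end_ring\<^esub> = id" "\<zero>\<^bsub>end_ring\<^esub> = (\<lambda>_. 0)" "f \<oplus>\<^bsub>end_ring\<^esub> g = (\<lambda>x. f x + g x)"
  by (simp_all add: end_ring_def)

lemma end_ring_minus:
  assumes "f \<in> carrier end_ring" "g \<in> carrier end_ring"
  shows "f \<ominus>\<^bsub>end_ring\<^esub> g = (\<lambda>x. f x - g x)"
proof -
  interpret ring end_ring by (rule ring_end_ring)
  have "(\<lambda>x. - g x) \<in> carrier end_ring" using assms by (simp add: end_ring_simps)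
  moreover have "(\<lambda>x. - g x) \<oplus>\<^bsub>end_ring\<^esub> g = \<zero>\<^bsub>end_ring\<^esub>" by (simp add: end_ring_simps)
  ultimately have "\<ominus>\<^bsub>end_ring\<^esub> g = (\<lambda>x. - g x)" using assms minus_equality by blast
  then show ?thesis by (simp add: a_minus_def end_ring_simps)
qed

context coxeter
begin

section \<open>A representation of \<open>hat H(W)\<close>\<close>

text \<open>Over the rationals put \<open>X\<^sub>s = D\<^sub>s - (1 - s) / 2\<close>.  The relations become
  \<open>X\<^sub>s\<^sup>2 = 0\<close> and \<open>w X\<^sub>s w\<inverse> = \<plusminus>X\<^bsub>w s w\<inverse>\<^esub>\<close> with the sign of \<^const>\<open>neg\<close>, so \<open>W\<close> acts by signed
  permutations on words in the \<open>X\<^sub>s\<close>.  The operators below act on functions on pairs of such a word and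
  an element of \<open>W\<close>; pairs with entries outside \<open>W\<close> are fixed by \<open>act\<close> and killed by \<open>X\<close>.\<close>

definition cj :: "'i gword set \<Rightarrow> 'i gword set \<Rightarrow> 'i gword set" where
  "cj w t = w \<star> t \<star> inv\<^sub>W w"

definition sgn_word :: "'i gword set \<Rightarrow> 'i gword set list \<Rightarrow> rat" where
  "sgn_word w ts = prod_list (map (\<lambda>t. if neg w t then - 1 else 1) ts)"

definition valid :: "'i gword set list \<Rightarrow> 'i gword set \<Rightarrow> bool" where
  "valid ts u \<longleftrightarrow> set ts \<subseteq> carrier W \<and> u \<in> carrier W"

type_synonym 'j model = "'j gword set list \<times> 'j gword set \<Rightarrow> rat"

text \<open>On the indicator function of a valid pair this is the signed permutation that applies
  \<open>w\<close> to both entries; the inverses appear because functions are transformed by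
  substitution.\<close>

definition act :: "'i gword set \<Rightarrow> 'i model \<Rightarrow> 'i model" where
  "act w f = (\<lambda>(ts, u). if valid ts u
     then sgn_word (inv\<^sub>W w) ts * f (map (cj (inv\<^sub>W w)) ts, inv\<^sub>W w \<star> u) else f (ts, u))"

text \<open>On indicator functions of valid pairs, \<open>t\<close> in \<open>W\<close> is put in
  front of the word, and the result is 0 when the word already begins with \<open>t\<close>. This is
  left multiplication by X_t on words modulo the relations that the squares vanish.\<close>

definition opX :: "'i gword set \<Rightarrow> 'i model \<Rightarrow> 'i model" where
  "opX t f = (\<lambda>(ts, u). if valid ts u \<and> ts \<noteq> [] \<and> hd ts = t \<and> (tl ts = [] \<or> hd (tl ts) \<noteq> t)
     then f (tl ts, u) else 0)"

definition opD :: "'i gword set \<Rightarrow> 'i model \<Rightarrow> 'i model" where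
  "opD t f = (\<lambda>x. (f x - act t f x) / 2 + opX t f x)"

lemma cj_closed [simp]: "w \<in> carrier W \<Longrightarrow> t \<in> carrier W \<Longrightarrow> cj w t \<in> carrier W"
  by (simp add: cj_def)

lemma cj_cj: "v \<in> carrier W \<Longrightarrow> w \<in> carrier W \<Longrightarrow> t \<in> carrier W \<Longrightarrow> cj v (cj w t) = cj (v \<star> w) t"
  by (simp add: cj_def W.inv_mult_group W.m_assoc)

lemma cj_one [simp]: "t \<in> carrier W \<Longrightarrow> cj \<one>\<^sub>W t = t"
  by (simp add: cj_def)

lemma cj_inv_eq_iff:
  "w \<in> carrier W \<Longrightarrow> t \<in> carrier W \<Longrightarrow> r \<in> carrier W \<Longrightarrow> cj (inv\<^sub>W w) r = t \<longleftrightarrow> r = cj w t"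
  by (auto simp: cj_cj)

lemma neg_inv_cj: "w \<in> carrier W \<Longrightarrow> t \<in> carrier W \<Longrightarrow> neg (inv\<^sub>W w) (cj w t) \<longleftrightarrow> neg w t"
  unfolding cj_def by (rule neg_inv)

lemma sgn_word_mult:
  assumes "v \<in> carrier W" "w \<in> carrier W" "set ts \<subseteq> carrier W"
  shows "sgn_word (v \<star> w) ts = sgn_word w ts * sgn_word v (map (cj w) ts)"
  using assms(3)
  by (induction ts) (use assms(1,2) in \<open>auto simp: sgn_word_def neg_mult cj_def[symmetric]\<close>)

lemma act_one: "act \<one>\<^sub>W f = f"
proof -
  have "sgn_word \<one>\<^sub>W ts = 1" "map (cj \<one>\<^sub>W) ts = ts" if "set ts \<subseteq> carrier W" for ts
    using that by (induction ts) (auto simp: sgn_word_def)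
  then show ?thesis by (auto simp: act_def fun_eq_iff valid_def)
qed

lemma act_mult:
  assumes "v \<in> carrier W" "w \<in> carrier W"
  shows "act v (act w f) = act (v \<star> w) f"
proof (intro ext, clarify)
  fix ts u
  show "act v (act w f) (ts, u) = act (v \<star> w) f (ts, u)"
  proof (cases "valid ts u")
    case True
    let ?v = "inv\<^sub>W v" and ?w = "inv\<^sub>W w"
    have ts: "set ts \<subseteq> carrier W" and u: "u \<in> carrier W" using True by (auto simp: valid_def)
    have "valid (map (cj ?v) ts) (?v \<star> u)" using True assms by (auto simp: valid_def)
    moreover have "map (cj ?w) (map (cj ?v) ts) = map (cj (?w \<star> ?v)) ts"
      using ts assms by (auto simp: cj_cj subset_iff)
    moreover have "inv\<^sub>W (v \<star> w) = ?w \<star> ?v" using assms by (rule W.inv_mult_group)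
    moreover have "?w \<star> (?v \<star> u) = ?w \<star> ?v \<star> u" using u assms by (simp add: W.m_assoc)
    ultimately show ?thesis using True sgn_word_mult[of ?w ?v ts] assms ts
      by (simp add: act_def mult.assoc del: map_map)
  qed (simp add: act_def)
qed

lemma act_comp:
  "v \<in> carrier W \<Longrightarrow> w \<in> carrier W \<Longrightarrow> act v \<circ> act w = act (v \<star> w)" "act \<one>\<^sub>W = id"
  by (rule ext, simp add: act_mult, rule ext, simp add: act_one)

text \<open>The sign of a word is a product over its letters, and the letter \<open>cj w t\<close>
  contributes the sign of \<open>w\<close> at \<open>t\<close>, by
  \<open>neg_inv_cj\<close>.\<close>

lemma act_opX:
  assumes "w \<in> carrier W" "t \<in> carrier W"
  shows "act w (opX t f) = (\<lambda>x. (if neg w t then - 1 else 1) * opX (cj w t) (act w f) x)"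
proof (intro ext, clarify)
  fix ts u
  let ?w = "inv\<^sub>W w"
  show "act w (opX t f) (ts, u) = (if neg w t then - 1 else 1) * opX (cj w t) (act w f) (ts, u)"
  proof (cases "valid ts u")
    case True
    then have vm: "valid (map (cj ?w) ts) (?w \<star> u)" using assms by (auto simp: valid_def)
    show ?thesis
    proof (cases ts)
      case (Cons r rs)
      have r: "r \<in> carrier W" "set rs \<subseteq> carrier W" and vr: "valid rs u"
        using True Cons by (auto simp: valid_def)
      have e1: "cj ?w r = t \<longleftrightarrow> r = cj w t" using cj_inv_eq_iff assms r by blast
      have e2: "(map (cj ?w) rs = [] \<or> hd (map (cj ?w) rs) \<noteq> t) \<longleftrightarrow> (rs = [] \<or> hd rs \<noteq> cj w t)"
        using r cj_inv_eq_iff[OF assms] by (cases rs) auto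
      have "sgn_word ?w (r # rs) = (if neg w t then - 1 else 1) * sgn_word ?w rs" if "r = cj w t"
        using that neg_inv_cj[OF assms] by (simp add: sgn_word_def)
      then show ?thesis using True vm vr e1 e2 Cons by (auto simp: act_def opX_def)
    qed (simp add: act_def opX_def)
  qed (simp add: act_def opX_def)
qed

lemma opX_opX: "opX t (opX t f) x = 0"
  by (cases x) (auto simp: opX_def)

lemma act_linear: "act w (\<lambda>x. (f x - g x) / 2 + h x) = (\<lambda>x. (act w f x - act w g x) / 2 + act w h x)"
  by (auto simp: act_def fun_eq_iff algebra_simps)

lemma opX_linear: "opX w (\<lambda>x. (f x - g x) / 2 + h x) = (\<lambda>x. (opX w f x - opX w g x) / 2 + opX w h x)"
  by (auto simp: opX_def fun_eq_iff)

lemma act_opD: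
  assumes "w \<in> carrier W" "t \<in> carrier W" "\<not> neg w t"
  shows "act w (opD t f) = opD (cj w t) (act w f)"
proof -
  have "cj w t \<star> w = w \<star> t" using assms by (simp add: cj_def W.m_assoc)
  then show ?thesis unfolding opD_def act_linear act_opX[OF assms(1,2)]
    using assms by (simp add: act_mult)
qed

text \<open>With \<open>A\<close> for the action of \<open>s i\<close> and \<open>X\<close> for its
  operator, A A = 1, A X = - X A and X X = 0. So (1 - A) / 2 is idempotent and its two mixed
  products with \<open>X\<close> add up to \<open>X\<close>, which gives idempotency; in the other
  relation the terms with \<open>X\<close> cancel.\<close>

lemma opD_s:
  assumes "i \<in> I"
  shows "opD (s i) (opD (s i) f) x = opD (s i) f x"
    "act (s i) (opD (s i) f) x + opD (s i) (act (s i) f) x = act (s i) f x - f x"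
proof -
  let ?A = "act (s i)" and ?X = "opX (s i)"
  have AA: "?A (?A f) = f" using assms by (simp add: act_mult act_one)
  have "cj (s i) (s i) = s i" using assms by (simp add: cj_def)
  then have AX: "?A (?X f) x = - ?X (?A f) x" for x using act_opX[of "s i" "s i" f] assms by simp
  have XX: "?X (?X f) x = 0" by (rule opX_opX)
  have "?A (opD (s i) f) x = (?A f x - f x) / 2 - ?X (?A f) x"
    unfolding opD_def act_linear AA AX by simp
  moreover have "?X (opD (s i) f) x = (?X f x - ?X (?A f) x) / 2"
    unfolding opD_def opX_linear XX by simp
  moreover have "opD (s i) (?A f) x = (?A f x - f x) / 2 + ?X (?A f) x"
    unfolding opD_def AA by simp
  ultimately show "opD (s i) (opD (s i) f) x = opD (s i) f x"
    "act (s i) (opD (s i) f) x + opD (s i) (act (s i) f) x = act (s i) f x - f x"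
    unfolding opD_def[of "s i" "opD (s i) f"] by (simp_all add: opD_def field_simps)
qed

lemma act_end: "act w \<in> carrier end_ring" and opD_end: "opD w \<in> carrier end_ring"
proof -
  have 1: "act w (f + g) = act w f + act w g" for f g
    by (auto simp: act_def fun_eq_iff algebra_simps)
  moreover have "opX w (f + g) = opX w f + opX w g" for f g
    by (auto simp: opX_def fun_eq_iff)
  ultimately have "opD w (f + g) = opD w f + opD w g" for f g
    by (auto simp: opD_def fun_eq_iff add_divide_distrib diff_divide_distrib)
  then show "act w \<in> carrier end_ring" "opD w \<in> carrier end_ring"
    using 1 by (simp_all add: end_ring_simps)
qed

text \<open>The first claim is the braid relation. A negative sign would yield, by
  \<open>neg_witness\<close>, two alternating words of equal positive length below
  \<open>m i j\<close> with different first letters and the same value, contrary to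
  \<open>word_alt_eq_iff\<close>.\<close>

lemma alt_pos:
  assumes ij: "i \<in> I" "j \<in> I" "i \<noteq> j" and n: "m i j = Suc n"
  defines "k \<equiv> if even n then j else i"
  shows "word (alt j i n) \<star> s k = s i \<star> word (alt j i n)" "\<not> neg (word (alt j i n)) (s k)"
proof -
  have k: "k \<in> I" using ij by (simp add: k_def)
  have snoc: "alt j i (Suc n) = alt j i n @ [k]" unfolding k_def by (rule alt_snoc)
  have "word (alt i j (Suc n)) = word (alt j i (Suc n))"
    using word_alt_eq_iff[OF ij(1,2), of "Suc n"] unfolding n by (simp only: dvd_refl)
  then have "s i \<star> word (alt j i n) = word (alt j i n @ [k])" unfolding snoc by simp
  then show "word (alt j i n) \<star> s k = s i \<star> word (alt j i n)" using ij k by simp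
  show "\<not> neg (word (alt j i n)) (s k)"
  proof
    assume "neg (word (alt j i n)) (s k)"
    then obtain y a z where x: "alt j i n = y @ a # z" and eq: "word z \<star> s k = s a \<star> word z"
      using neg_witness[of "alt j i n" "s k"] ij k by auto
    have len: "n = length y + Suc (length z)" using arg_cong[OF x, of length] by simp
    define l where "l = length z"
    \<comment> \<open>Appending \<open>k\<close> keeps the word alternating, so its part from
      \<open>a\<close> on alternates as well, with a first letter given by the parity of the length
      of \<open>y\<close>.\<close>
    have "alt j i (Suc n) = y @ (a # z @ [k])" unfolding snoc x by simp
    moreover have "alt j i (Suc n) = alt j i (length y) @
        (if even (length y) then alt j i (Suc (Suc l)) else alt i j (Suc (Suc l)))"
      using alt_append[of j i "length y" "Suc (Suc l)"] len by (simp add: l_def del: alt.simps)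
    ultimately have "y @ (a # z @ [k]) = alt j i (length y) @
        (if even (length y) then alt j i (Suc (Suc l)) else alt i j (Suc (Suc l)))" by (rule trans[OF sym])
    then have "a # z @ [k] = (if even (length y) then alt j i (Suc (Suc l)) else alt i j (Suc (Suc l)))"
      by (subst (asm) append_eq_append_conv) (simp_all only: length_alt simp_thms)
    then have dj: "a # z @ [k] = alt j i (Suc (Suc l)) \<or> a # z @ [k] = alt i j (Suc (Suc l))"
      by (cases "even (length y)") (simp_all only: if_True if_False simp_thms)
    obtain p q where pq: "{p, q} = {i, j}" "a # z @ [k] = alt p q (Suc (Suc l))"
      using dj that[of i j, OF refl] that[of j i, OF insert_commute] by blast
    have "(a # z) @ [k] = alt p q (Suc l) @ [if even (Suc l) then p else q]"
      using pq(2) alt_snoc[of p q "Suc l"] by simp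
    then have az: "a # z = alt p q (Suc l)" by blast
    have zk: "z @ [k] = alt q p (Suc l)" using pq(2) by simp
    have pqI: "p \<in> I" "q \<in> I" and mpq: "m p q = m i j" using pq(1) ij m_sym[of i j] by (auto simp: doubleton_eq_iff)
    have z: "z \<in> lists I" using alt_lists[OF pqI, of "Suc l"] az by (metis Cons_in_lists_iff)
    have "word (alt p q (Suc l)) = word (alt q p (Suc l))"
      unfolding az[symmetric] zk[symmetric] using eq z k by simp
    then have "m i j dvd Suc l" using word_alt_eq_iff[OF pqI, of "Suc l"] mpq by simp
    then show False using n len by (auto dest!: dvd_imp_le simp: l_def)
  qed
qed

text \<open>Relations (i) are \<open>opD_s\<close>, relations (ii) hold since \<open>act\<close> is
  an action, and (iii) is \<open>act_opD\<close> for the alternating words, which are positive by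
  \<open>alt_pos\<close>. The formula for a general reflection follows by conjugating with a
  positive \<open>w\<close>.\<close>

lemma representation:
  obtains \<rho> where "\<rho> \<in> ring_hom H end_ring" "\<And>w. w \<in> carrier W \<Longrightarrow> \<rho> (U w) = act w"
    "\<And>t. t \<in> T \<Longrightarrow> \<rho> (D t) = opD t"
proof -
  interpret E: ring "end_ring :: ('i model \<Rightarrow> 'i model) ring" by (rule ring_end_ring)
  have fold: "foldr (\<lambda>k a. act (s k) \<otimes>\<^bsub>end_ring\<^esub> a) x \<one>\<^bsub>end_ring\<^esub> = act (word x)" if "x \<in> lists I" for x
    using that by (induction x) (simp_all add: end_ring_simps act_comp act_mult)
  have pow: "(act (s i) \<otimes>\<^bsub>end_ring\<^esub> act (s j)) [^]\<^bsub>end_ring\<^esub> n = act ((s i \<star> s j) [^]\<^sub>W n)"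
    if "i \<in> I" "j \<in> I" for i j and n :: nat
    using that by (induction n) (simp_all add: end_ring_simps act_comp act_mult)
  obtain \<rho> where \<rho>: "\<rho> \<in> ring_hom H end_ring" "\<And>i. i \<in> I \<Longrightarrow> \<rho> (hs i) = act (s i)"
    "\<And>i. i \<in> I \<Longrightarrow> \<rho> (hD i) = opD (s i)"
  proof (rule H_lift[OF ring_end_ring, of "\<lambda>i. act (s i)" "\<lambda>i. opD (s i)"])
    fix i assume i: "i \<in> I"
    show "act (s i) \<otimes>\<^bsub>end_ring\<^esub> act (s i) = \<one>\<^bsub>end_ring\<^esub>"
      using i by (simp add: end_ring_simps fun_eq_iff act_mult act_one)
    show "opD (s i) \<otimes>\<^bsub>end_ring\<^esub> opD (s i) = opD (s i)"
      using i by (simp add: end_ring_simps fun_eq_iff opD_s)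
    show "act (s i) \<otimes>\<^bsub>end_ring\<^esub> opD (s i) \<oplus>\<^bsub>end_ring\<^esub> opD (s i) \<otimes>\<^bsub>end_ring\<^esub> act (s i) =
        act (s i) \<ominus>\<^bsub>end_ring\<^esub> \<one>\<^bsub>end_ring\<^esub>"
      unfolding end_ring_minus[OF act_end E.one_closed]
      using i by (simp add: end_ring_simps fun_eq_iff opD_s)
    fix j assume j: "j \<in> I"
    show "(act (s i) \<otimes>\<^bsub>end_ring\<^esub> act (s j)) [^]\<^bsub>end_ring\<^esub> m i j = \<one>\<^bsub>end_ring\<^esub>"
      unfolding pow[OF i j] braid[OF i j] act_comp(2) end_ring_simps(3) ..
    fix n assume n: "i \<noteq> j" "m i j = Suc n"
    let ?v = "word (alt j i n)" and ?k = "if even n then j else i"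
    have v: "?v \<in> carrier W" and k: "?k \<in> I" using i j by simp_all
    note ap = alt_pos[OF i j n]
    have "cj ?v (s ?k) = s i" using ap(1) v i by (simp add: cj_def W.m_assoc)
    then have comm: "act ?v \<circ> opD (s ?k) = opD (s i) \<circ> act ?v"
      using act_opD[OF v s_closed[OF k] ap(2)] by (simp only: fun_eq_iff comp_apply simp_thms)
    show "opD (s i) \<otimes>\<^bsub>end_ring\<^esub> foldr (\<lambda>k a. act (s k) \<otimes>\<^bsub>end_ring\<^esub> a) (alt j i n) \<one>\<^bsub>end_ring\<^esub> =
      foldr (\<lambda>k a. act (s k) \<otimes>\<^bsub>end_ring\<^esub> a) (alt j i n) \<one>\<^bsub>end_ring\<^esub> \<otimes>\<^bsub>end_ring\<^esub> opD (s ?k)"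
      unfolding fold[OF alt_lists[OF j i]] unfolding end_ring_simps(2) using comm by (rule sym)
  qed (auto simp: act_end opD_end)
  have U: "\<rho> (U w) = act w" if "w \<in> carrier W" for w
    using that
  proof (induction w rule: W_induct)
    case one then show ?case using ring_hom_one[OF \<rho>(1)] by (simp add: end_ring_simps fun_eq_iff act_one)
  next
    case (mult i w)
    then show ?case using ring_hom_mult[OF \<rho>(1), of "hs i" "U w"] \<rho>(2)
      by (simp add: U_mult end_ring_simps act_comp)
  qed
  have "\<rho> (D t) = opD t" if "t \<in> T" for t
  proof -
    obtain w i where w: "w \<in> carrier W" "i \<in> I" "t = w \<star> s i \<star> inv\<^sub>W w" "\<not> neg w (s i)"
      by (rule T_positive[OF \<open>t \<in> T\<close>])
    have t: "t = cj w (s i)" using w by (simp add: cj_def)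
    have "D t = U w \<cdot> hD i \<cdot> U (inv\<^sub>W w)" using D_refl_spec(2) w by simp
    then have "\<rho> (D t) = act w \<circ> opD (s i) \<circ> act (inv\<^sub>W w)"
      using w ring_hom_mult[OF \<rho>(1)] \<rho>(3) U by (simp add: end_ring_simps)
    then show ?thesis using act_opD[OF w(1) s_closed[OF w(2)] w(4)] w t
      by (simp add: fun_eq_iff act_mult act_one)
  qed
  then show ?thesis using that[OF \<rho>(1) U] by blast
qed

section \<open>The decomposition of \<open>hat H(W)\<close>\<close>

abbreviation DD :: "'i hat set" where "DD \<equiv> hat_D I m (carrier W)"

lemma hat_D_carrier: "hat_D I m G \<subseteq> carrier H"
  unfolding hat_D_def by (rule H.generate_ring_incl) auto

lemma DD_carrier: "x \<in> DD \<Longrightarrow> x \<in> carrier H"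
  using hat_D_carrier by blast

lemma DD_ring [simp]:
  "\<one>\<^sub>H \<in> DD" "\<zero>\<^sub>H \<in> DD" "x \<in> DD \<Longrightarrow> \<ominus>\<^sub>H x \<in> DD" "x \<in> DD \<Longrightarrow> y \<in> DD \<Longrightarrow> x \<oplus>\<^sub>H y \<in> DD"
  "x \<in> DD \<Longrightarrow> y \<in> DD \<Longrightarrow> x \<cdot> y \<in> DD" "t \<in> T \<Longrightarrow> D t \<in> DD"
  unfolding hat_D_def
  by (auto intro: generate_ring.intros H.zero_in_generate dest: T_carrier)

lemma DD_additive: "additive_subgroup DD H"
proof (rule additive_subgroupI, rule H.add.subgroupI)
  show "DD \<noteq> {}" using DD_ring(1) by blast
qed (auto intro: DD_carrier)

text \<open>For \<open>t \<noteq> s i\<close> the generator D_t moves past s_i as a single term; for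
  \<open>t = s i\<close> relation (i) gives s_i D_t = (1 - D_t) s_i - 1. The shape with two terms is
  inherited by sums and products.\<close>

lemma hs_DD:
  assumes "i \<in> I" "a \<in> DD"
  shows "\<exists>a'\<in>DD. \<exists>a''\<in>DD. hs i \<cdot> a = a' \<cdot> hs i \<oplus>\<^sub>H a''"
  using assms(2) unfolding hat_D_def[of I m "carrier W"]
proof (induction rule: generate_ring.induct)
  case one
  show ?case by (intro bexI[of _ "\<one>\<^sub>H"] bexI[of _ "\<zero>\<^sub>H"]) (use assms(1) in \<open>simp_all flip: hat_D_def\<close>)
next
  case (incl h)
  then obtain t where t: "t \<in> T" "h = D t" by auto
  show ?case
  proof (cases "t = s i")
    case True
    have h: "h \<in> carrier H" "h = hD i" using t True assms by auto
    have "hs i \<cdot> h = (hs i \<cdot> h \<oplus>\<^sub>H h \<cdot> hs i) \<ominus>\<^sub>H h \<cdot> hs i"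
      using h(1) hs_closed[OF assms(1)] by algebra
    also have "\<dots> = (\<one>\<^sub>H \<ominus>\<^sub>H h) \<cdot> hs i \<oplus>\<^sub>H \<ominus>\<^sub>H \<one>\<^sub>H"
      unfolding h(2) hs_hd[OF assms(1)] using hd_closed[OF assms(1)] hs_closed[OF assms(1)] by algebra
    finally show ?thesis using t
      by (intro bexI[of _ "\<one>\<^sub>H \<ominus>\<^sub>H h"] bexI[of _ "\<ominus>\<^sub>H \<one>\<^sub>H"])
        (simp_all add: a_minus_def flip: hat_D_def)
  next
    case False
    then have "D (s i \<star> t \<star> inv\<^sub>W s i) = hs i \<cdot> D t \<cdot> hs i"
      using D_conj[OF t(1) s_closed[OF assms(1)]] assms(1) T_carrier[OF t(1)] by simp
    then have "D (s i \<star> t \<star> inv\<^sub>W s i) \<cdot> hs i = hs i \<cdot> h"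
      using t assms(1) by (simp add: H.m_assoc)
    moreover have "s i \<star> t \<star> inv\<^sub>W s i \<in> T" using T_conj[of t "s i"] t(1) assms(1) by simp
    ultimately show ?thesis using t assms(1)
      by (intro bexI[of _ "D (s i \<star> t \<star> inv\<^sub>W s i)"] bexI[of _ "\<zero>\<^sub>H"]) (simp_all flip: hat_D_def)
  qed
next
  case (a_inv h)
  then obtain a b where ab: "a \<in> DD" "b \<in> DD" "hs i \<cdot> h = a \<cdot> hs i \<oplus>\<^sub>H b" "h \<in> DD"
    unfolding hat_D_def by blast
  then have "hs i \<cdot> \<ominus>\<^sub>H h = (\<ominus>\<^sub>H a) \<cdot> hs i \<oplus>\<^sub>H (\<ominus>\<^sub>H b)"
    using assms(1) by (simp add: DD_carrier H.r_minus H.l_minus H.minus_add)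
  then show ?case using ab unfolding hat_D_def[symmetric]
    by (intro bexI[of _ "\<ominus>\<^sub>H a"] bexI[of _ "\<ominus>\<^sub>H b"] DD_ring(3))
next
  case (eng_add h h')
  then obtain a b a' b' where ab: "a \<in> DD" "b \<in> DD" "hs i \<cdot> h = a \<cdot> hs i \<oplus>\<^sub>H b" "h \<in> DD"
    "a' \<in> DD" "b' \<in> DD" "hs i \<cdot> h' = a' \<cdot> hs i \<oplus>\<^sub>H b'" "h' \<in> DD"
    unfolding hat_D_def by blast
  then have "hs i \<cdot> (h \<oplus>\<^sub>H h') = (a \<oplus>\<^sub>H a') \<cdot> hs i \<oplus>\<^sub>H (b \<oplus>\<^sub>H b')"
    using assms(1) by (simp add: DD_carrier H.r_distr H.l_distr H.a_ac)
  then show ?case using ab unfolding hat_D_def[symmetric]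
    by (intro bexI[of _ "a \<oplus>\<^sub>H a'"] bexI[of _ "b \<oplus>\<^sub>H b'"] DD_ring(4))
next
  case (eng_mult h h')
  then obtain a b a' b' where ab: "a \<in> DD" "b \<in> DD" "hs i \<cdot> h = a \<cdot> hs i \<oplus>\<^sub>H b" "h \<in> DD"
    "a' \<in> DD" "b' \<in> DD" "hs i \<cdot> h' = a' \<cdot> hs i \<oplus>\<^sub>H b'" "h' \<in> DD"
    unfolding hat_D_def by blast
  have "hs i \<cdot> (h \<cdot> h') = (a \<cdot> hs i \<oplus>\<^sub>H b) \<cdot> h'"
    using ab assms(1) by (simp add: DD_carrier flip: H.m_assoc)
  also have "\<dots> = a \<cdot> (hs i \<cdot> h') \<oplus>\<^sub>H b \<cdot> h'"
    using ab(1,2,4,5,6,8) assms(1) by (simp add: DD_carrier H.l_distr H.m_assoc)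
  also have "\<dots> = a \<cdot> (a' \<cdot> hs i \<oplus>\<^sub>H b') \<oplus>\<^sub>H b \<cdot> h'" by (simp only: ab(7))
  also have "\<dots> = (a \<cdot> a') \<cdot> hs i \<oplus>\<^sub>H (a \<cdot> b' \<oplus>\<^sub>H b \<cdot> h')"
    using ab(1,2,4,5,6,8) assms(1) by (simp add: DD_carrier H.r_distr H.m_assoc H.a_assoc)
  finally show ?case unfolding hat_D_def[symmetric] using ab
    by (intro bexI[of _ "a \<cdot> a'"] bexI[of _ "a \<cdot> b' \<oplus>\<^sub>H b \<cdot> h'"] DD_ring(4,5))
qed

lemma U_funcset: "U \<in> carrier W \<rightarrow> carrier H"
  by simp

text \<open>The right-hand side contains 1 and is closed under left multiplication by
  \<open>hs i\<close>, because of \<open>hs_DD\<close>, and by \<open>hD i\<close>, which lies in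
  hat D(W).\<close>

lemma hat_span: "carrier H \<subseteq> comb H DD U (carrier W)"
proof
  note ci = H.comb_induct[OF _ hat_D_carrier U_funcset]
  note add = H.comb_add[OF DD_additive U_funcset]
  note incl = H.comb_incl[OF _ _ hat_D_carrier U_funcset, of _ "carrier W"]
  have neg: "\<ominus>\<^sub>H x \<in> comb H DD U (carrier W)" if "x \<in> comb H DD U (carrier W)" for x
    using that
  proof (rule ci)
    fix d w assume d: "d \<in> DD" "w \<in> carrier W"
    have "\<ominus>\<^sub>H (d \<cdot> U w) = (\<ominus>\<^sub>H d) \<cdot> U w" using d by (simp add: DD_carrier H.l_minus)
    then show "\<ominus>\<^sub>H (d \<cdot> U w) \<in> comb H DD U (carrier W)" using d incl by simp
  next
    fix x y assume "x \<in> carrier H" "y \<in> carrier H" "\<ominus>\<^sub>H x \<in> comb H DD U (carrier W)" "\<ominus>\<^sub>H y \<in> comb H DD U (carrier W)"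
    then show "\<ominus>\<^sub>H (x \<oplus>\<^sub>H y) \<in> comb H DD U (carrier W)" using add by (simp add: H.minus_add)
  qed (simp add: H.comb_zero)
  fix x assume "x \<in> carrier H"
  then show "x \<in> comb H DD U (carrier W)"
  proof (induction x rule: H_induct)
    case zero show ?case by (rule H.comb_zero)
  next
    case one show ?case using incl[of "\<one>\<^sub>H" "\<one>\<^sub>W"] by simp
  next
    case (diff x y) then show ?case using add neg by (simp add: a_minus_def)
  next
    case (hs i x)
    show ?case using hs(3)
    proof (rule ci)
      fix d w assume d: "d \<in> DD" "w \<in> carrier W"
      obtain a b where ab: "a \<in> DD" "b \<in> DD" "hs i \<cdot> d = a \<cdot> hs i \<oplus>\<^sub>H b"
        using hs_DD[OF hs(1) d(1)] by blast
      have "hs i \<cdot> (d \<cdot> U w) = (a \<cdot> hs i \<oplus>\<^sub>H b) \<cdot> U w"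
        using hs(1) d by (simp add: DD_carrier flip: H.m_assoc ab(3))
      also have "\<dots> = a \<cdot> U (s i \<star> w) \<oplus>\<^sub>H b \<cdot> U w"
        using hs(1) ab(1,2) d by (simp add: DD_carrier H.l_distr H.m_assoc U_mult)
      finally show "hs i \<cdot> (d \<cdot> U w) \<in> comb H DD U (carrier W)"
        using add incl ab d hs(1) by simp
    qed (use hs(1) in \<open>simp_all add: H.comb_zero H.r_distr add\<close>)
  next
    case (hd i x)
    show ?case using hd(3)
    proof (rule ci)
      fix d w assume d: "d \<in> DD" "w \<in> carrier W"
      have "hD i \<cdot> (d \<cdot> U w) = (D (s i) \<cdot> d) \<cdot> U w"
        using hd(1) d by (simp add: DD_carrier H.m_assoc)
      then show "hD i \<cdot> (d \<cdot> U w) \<in> comb H DD U (carrier W)"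
        using incl d hd(1) by (simp del: D_s)
    qed (use hd(1) in \<open>simp_all add: H.comb_zero H.r_distr add\<close>)
  qed
qed

section \<open>Linear independence of products of the D_s over \<open>W\<close>\<close>

definition Dword :: "'i gword set list \<Rightarrow> 'i hat" where
  "Dword ts = foldr (\<lambda>t a. D t \<cdot> a) ts \<one>\<^sub>H"

lemma Dword_simps [simp]: "Dword [] = \<one>\<^sub>H" "Dword (t # ts) = D t \<cdot> Dword ts"
  by (simp_all add: Dword_def)

lemma Dword_closed [simp]: "ts \<in> lists T \<Longrightarrow> Dword ts \<in> carrier H"
  by (induction ts) auto

lemma Dword_closed_set [simp]: "\<forall>t\<in>set ts. t \<in> T \<Longrightarrow> Dword ts \<in> carrier H"
  by (simp add: in_lists_conv_set)

text \<open>As each D_t is idempotent, words without equal neighbours suffice to span hat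
  D(W).\<close>

definition redwords :: "'i gword set list set" where
  "redwords = {ts. ts \<in> lists T \<and> distinct_adj ts}"

text \<open>\<open>D\<^sub>t\<close> and \<open>X\<^sub>t\<close> agree up to terms of lower degree.\<close>

lemma leading_term:
  assumes "\<rho> \<in> ring_hom H end_ring" "\<And>w. w \<in> carrier W \<Longrightarrow> \<rho> (U w) = act w"
    "\<And>t. t \<in> T \<Longrightarrow> \<rho> (D t) = opD t"
    and "ts \<in> redwords" "w \<in> carrier W" "length ts \<le> length r"
  defines "v0 \<equiv> \<lambda>x. if x = ([], \<one>\<^sub>W) then 1 else 0"
  shows "\<rho> (Dword ts \<cdot> U w) v0 (r, u) = (if (r, u) = (ts, w) then 1 else 0)"
  using assms(4,6)
proof (induction ts arbitrary: r u)
  case Nil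
  have "\<rho> (Dword [] \<cdot> U w) = act w" using assms by simp
  moreover have "act w v0 (r, u) = (if (r, u) = ([], w) then 1 else 0)"
  proof (cases "valid r u")
    case True
    have "inv\<^sub>W w \<star> u = \<one>\<^sub>W \<longleftrightarrow> u = w"
    proof
      assume "inv\<^sub>W w \<star> u = \<one>\<^sub>W"
      then have "w \<star> (inv\<^sub>W w \<star> u) = w" using assms(5) by simp
      moreover have "u \<in> carrier W" using True by (simp add: valid_def)
      ultimately show "u = w" using W.m_assoc[of w "inv\<^sub>W w" u] assms(5) by simp
    qed (use assms(5) in simp)
    then show ?thesis using True by (simp add: act_def v0_def sgn_word_def)
  next
    case False
    have "valid [] w" "valid [] \<one>\<^sub>W" using assms(5) by (simp_all add: valid_def)
    then have "(r, u) \<noteq> ([], w)" "(r, u) \<noteq> ([], \<one>\<^sub>W)" using False by blast+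
    then show ?thesis using False by (simp add: act_def v0_def)
  qed
  ultimately show ?case by simp
next
  case (Cons t ts)
  have t: "t \<in> T" "ts \<in> lists T" "ts \<in> redwords" "ts = [] \<or> hd ts \<noteq> t" "set ts \<subseteq> carrier W" "t \<in> carrier W"
    using Cons.prems T_carrier by (auto simp: redwords_def distinct_adj_Cons in_lists_conv_set)
  define G where "G = \<rho> (Dword ts \<cdot> U w) v0"
  have IH: "G (r, u) = (if (r, u) = (ts, w) then 1 else 0)" if "length ts \<le> length r" for r u
    unfolding G_def using Cons.IH t that by blast
  have "\<rho> (Dword (t # ts) \<cdot> U w) v0 = opD t G"
    using ring_hom_mult[OF assms(1), of "D t" "Dword ts \<cdot> U w"] t assms(3,5)
    by (simp add: H.m_assoc end_ring_simps G_def)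
  moreover have "opD t G (r, u) = (if (r, u) = (t # ts, w) then 1 else 0)"
  proof -
    have len: "length r > length ts" using Cons.prems by simp
    \<comment> \<open>\<open>act\<close> preserves the length of words, and \<open>G\<close>
      vanishes on all words as long as \<open>r\<close>, as these are longer than \<open>ts\<close>;
      so only the \<open>opX\<close> part of \<open>opD t\<close> contributes.\<close>
    have G0: "G (r', u') = 0" if "length r' = length r" for r' u'
    proof -
      have "r' \<noteq> ts" using that len by auto
      then show ?thesis using IH[of r' u'] that len by simp
    qed
    then have "G (r, u) = 0" by blast
    moreover have "act t G (r, u) = 0" by (simp add: act_def G0)
    moreover have "opX t G (r, u) = (if (r, u) = (t # ts, w) then 1 else 0)"
    proof (cases r)
      case (Cons a r')
      then have G: "G (r', u) = (if (r', u) = (ts, w) then 1 else 0)" using len by (intro IH) simp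
      show ?thesis
      proof (cases "a = t \<and> r' = ts \<and> u = w")
        case True
        moreover have "valid (t # ts) w" using t(5,6) assms(5) by (simp add: valid_def)
        ultimately show ?thesis using G t(4) by (simp add: opX_def Cons)
      next
        case False
        then have "a = t \<Longrightarrow> G (r', u) = 0" using G by auto
        then show ?thesis using False by (auto simp: opX_def Cons)
      qed
    qed (use len in simp)
    ultimately show ?thesis by (simp add: opD_def)
  qed
  ultimately show ?case by simp
qed

text \<open>\<open>\<Phi>\<close> maps the free abelian group on pairs of a word in
  \<open>redwords\<close> and an element of \<open>W\<close> to hat H(W), and is injective by
  leading terms. Each \<open>\<delta> w \<cdot> U w\<close> is the image of an element supported on
  words paired with \<open>w\<close>. These supports are disjoint for different \<open>w\<close>, so
  a vanishing sum forces each part to vanish.\<close>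

lemma hat_direct:
  assumes F: "finite F" "F \<subseteq> carrier W" "\<delta> \<in> F \<rightarrow> DD" "(\<Oplus>\<^bsub>H\<^esub>w\<in>F. \<delta> w \<cdot> U w) = \<zero>\<^sub>H"
  shows "\<forall>w\<in>F. \<delta> w = \<zero>\<^sub>H"
proof -
  let ?S = "redwords \<times> carrier W"
  let ?b = "\<lambda>(ts, w). Dword ts \<cdot> U w"
  have "?b ` ?S \<subseteq> carrier (add_monoid H)" by (auto simp: redwords_def)
  note univ = comm_group.free_Abelian_group_universal[OF H.a_comm_group this]
  obtain \<Phi> where \<Phi>: "\<Phi> \<in> hom (free_Abelian_group ?S) (add_monoid H)"
    and \<Phi>_of: "\<And>p. p \<in> ?S \<Longrightarrow> \<Phi> (frag_of p) = ?b p" using univ by blast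
  interpret \<Phi>: group_hom "free_Abelian_group ?S" "add_monoid H" \<Phi>
    by (rule group_hom.intro[OF group_free_Abelian_group H.a_group group_hom_axioms.intro[OF \<Phi>]])
  note \<Phi>d = additive_diff[OF H.is_abelian_group \<Phi>]
  have \<Phi>0: "\<Phi> 0 = \<zero>\<^sub>H" by (rule additive_zero[OF H.is_abelian_group \<Phi>])
  have \<Phi>c: "\<Phi> c \<in> carrier H" if "keys c \<subseteq> ?S" for c
    using \<Phi>.hom_closed[of c] that by simp
  obtain \<rho> where \<rho>: "\<rho> \<in> ring_hom H end_ring" "\<And>w. w \<in> carrier W \<Longrightarrow> \<rho> (U w) = act w"
    "\<And>t. t \<in> T \<Longrightarrow> \<rho> (D t) = opD t" by (rule representation) blast
  interpret E: ring "end_ring :: ('i model \<Rightarrow> 'i model) ring" by (rule ring_end_ring)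
  interpret \<rho>: ring_hom_ring H "end_ring :: ('i model \<Rightarrow> 'i model) ring" \<rho>
    by (rule ring_hom_ringI2[OF H.ring_axioms ring_end_ring \<rho>(1)])
  define v0 :: "'i model" where "v0 = (\<lambda>x. if x = ([], \<one>\<^sub>W) then 1 else 0)"
  have \<rho>d: "\<rho> (x \<ominus>\<^sub>H y) v0 = \<rho> x v0 - \<rho> y v0" if "x \<in> carrier H" "y \<in> carrier H" for x y
  proof -
    have "\<rho> (x \<ominus>\<^sub>H y) = \<rho> x \<ominus>\<^bsub>end_ring\<^esub> \<rho> y" using that by (simp add: a_minus_def)
    then show ?thesis using that by (simp add: end_ring_minus)
  qed
  \<comment> \<open>At a pair whose word is at least as long as every word occurring in
    \<open>c\<close>, the model reads off the coefficient of \<open>c\<close>.\<close>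
  have coeff: "keys c \<subseteq> ?S \<and> \<rho> (\<Phi> c) v0 p = of_int (poly_mapping.lookup c p)"
    if "keys c \<subseteq> {(ts, w). (ts, w) \<in> ?S \<and> length ts \<le> length (fst p)}" for c p
    using that
  proof (induction c rule: frag_induction)
    case zero then show ?case using \<rho>.hom_zero by (simp add: \<Phi>0 end_ring_simps)
  next
    case (one q)
    obtain ts w where q: "q = (ts, w)" by force
    have "\<rho> (Dword ts \<cdot> U w) v0 (fst p, snd p) = (if (fst p, snd p) = (ts, w) then 1 else 0)"
      unfolding v0_def by (rule leading_term[OF \<rho>]) (use one q in auto)
    then show ?case using one q \<Phi>_of[of q] by (auto simp: lookup_frag_of)
  next
    case (diff a b)
    then show ?case using keys_diff[of a b] by (auto simp: \<Phi>d \<rho>d \<Phi>c lookup_minus)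
  qed
  have inj: "c = 0" if c: "keys c \<subseteq> ?S" "\<Phi> c = \<zero>\<^sub>H" for c
  proof (rule ccontr)
    assume "c \<noteq> 0"
    then have ne: "keys c \<noteq> {}" by simp
    define N where "N = Max ((\<lambda>p. length (fst p)) ` keys c)"
    have "N \<in> (\<lambda>p. length (fst p)) ` keys c" unfolding N_def using ne by (intro Max_in) auto
    then obtain p where p: "p \<in> keys c" "length (fst p) = N" by auto
    have "length (fst q) \<le> N" if "q \<in> keys c" for q
      unfolding N_def using that by (intro Max_ge) auto
    then have "keys c \<subseteq> {(ts, w). (ts, w) \<in> ?S \<and> length ts \<le> length (fst p)}"
      using c(1) p(2) by fastforce
    then have "\<rho> (\<Phi> c) v0 p = of_int (poly_mapping.lookup c p)" using coeff by blast
    then have "poly_mapping.lookup c p = 0" using c(2) \<rho>.hom_zero by (simp add: end_ring_simps)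
    then show False using p(1) by (simp add: in_keys_iff)
  qed
  define L where "L w = \<Phi> ` {c. keys c \<subseteq> redwords \<times> {w}}" for w
  have LI: "\<Phi> c \<in> L w" if "keys c \<subseteq> redwords \<times> {w}" for c w
    unfolding L_def using that by blast
  have LS: "keys c \<subseteq> ?S" if "keys c \<subseteq> redwords \<times> {w}" "w \<in> carrier W"
    for c :: "'i gword set list \<times> 'i gword set \<Rightarrow>\<^sub>0 int" and w using that by blast
  have L: "x \<ominus>\<^sub>H y \<in> L w" if xy: "x \<in> L w" "y \<in> L w" and w: "w \<in> carrier W" for x y w
  proof -
    obtain c d where cd: "x = \<Phi> c" "y = \<Phi> d" "keys c \<subseteq> redwords \<times> {w}"
      "keys d \<subseteq> redwords \<times> {w}" using xy by (auto simp: L_def)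
    moreover have "keys (c - d) \<subseteq> redwords \<times> {w}" using cd keys_diff[of c d] by blast
    ultimately show ?thesis using \<Phi>d[OF LS[OF cd(3) w] LS[OF cd(4) w]] LI[of "c - d" w] by simp
  qed
  have L0: "\<zero>\<^sub>H \<in> L w" for w using LI[of 0 w] \<Phi>0 by simp
  have Lc: "x \<in> carrier H" if "x \<in> L w" "w \<in> carrier W" for x w
    using that \<Phi>c[OF LS] unfolding L_def by blast
  have Lof: "Dword ts \<cdot> U w \<in> L w" if "ts \<in> redwords" "w \<in> carrier W" for ts w
    using LI[of "frag_of (ts, w)" w] that \<Phi>_of[of "(ts, w)"] by simp
  \<comment> \<open>The letter \<open>t\<close> is either absorbed by an equal first letter, as D_t
    is idempotent, or lengthens the word.\<close>
  have LD: "D t \<cdot> x \<in> L w" if "t \<in> T" and xL: "x \<in> L w" and "w \<in> carrier W" for t x w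
  proof -
    obtain c where c: "x = \<Phi> c" "keys c \<subseteq> redwords \<times> {w}" using xL by (auto simp: L_def)
    have "keys c \<subseteq> redwords \<times> {w} \<and> D t \<cdot> \<Phi> c \<in> L w"
      using c(2)
    proof (induction c rule: frag_induction)
      case zero then show ?case using that by (simp add: \<Phi>0 L0)
    next
      case (one q)
      then obtain ts where q: "q = (ts, w)" "ts \<in> redwords" by auto
      have ts: "ts \<in> lists T" using q by (simp add: redwords_def)
      have "D t \<cdot> (Dword ts \<cdot> U w) \<in> L w"
      proof (cases "ts \<noteq> [] \<and> hd ts = t")
        case True
        then obtain ts' where ts': "ts = t # ts'" by (cases ts) auto
        then have "D t \<cdot> (Dword ts \<cdot> U w) = (D t \<cdot> D t) \<cdot> (Dword ts' \<cdot> U w)"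
          using ts that by (simp add: H.m_assoc)
        also have "\<dots> = Dword ts \<cdot> U w" using ts ts' that by (simp add: D_idem H.m_assoc)
        finally show ?thesis using Lof q that by simp
      next
        case False
        then have "t # ts \<in> redwords" using q that by (auto simp: redwords_def distinct_adj_Cons)
        from Lof[OF this that(3)] show ?thesis using ts that by (simp add: H.m_assoc)
      qed
      then show ?case using q that \<Phi>_of[of q] one by simp
    next
      case (diff a b)
      have "keys a \<subseteq> ?S" "keys b \<subseteq> ?S" using diff that(3) by auto
      then have "D t \<cdot> \<Phi> (a - b) = D t \<cdot> \<Phi> a \<ominus>\<^sub>H D t \<cdot> \<Phi> b"
        using that(1) \<Phi>c by (simp add: \<Phi>d a_minus_def H.r_distr H.r_minus)
      then show ?case using diff L[of "D t \<cdot> \<Phi> a" w "D t \<cdot> \<Phi> b"] that keys_diff[of a b] by auto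
    qed
    then show ?thesis using c by simp
  qed
  have LDD: "\<delta> \<cdot> x \<in> L w" if w: "w \<in> carrier W" and "\<delta> \<in> DD" "x \<in> L w" for \<delta> x w
    using that(2,3) unfolding hat_D_def
  proof (induction arbitrary: x rule: generate_ring.induct)
    case one then show ?case using Lc w by simp
  next
    case (incl h) then show ?case using LD w by auto
  next
    case (a_inv h)
    have "h \<in> carrier H" using a_inv.hyps DD_carrier by (simp add: hat_D_def)
    then have "\<ominus>\<^sub>H h \<cdot> x = \<zero>\<^sub>H \<ominus>\<^sub>H h \<cdot> x" using Lc[OF a_inv.prems w] by (simp add: a_minus_def H.l_minus)
    then show ?case using L L0 a_inv w by simp
  next
    case (eng_add h h')
    have h: "h \<in> carrier H" "h' \<in> carrier H" using eng_add.hyps DD_carrier by (simp_all add: hat_D_def)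
    have x: "x \<in> carrier H" using Lc[OF eng_add.prems w] .
    have "(h \<oplus>\<^sub>H h') \<cdot> x = h \<cdot> x \<ominus>\<^sub>H (\<zero>\<^sub>H \<ominus>\<^sub>H h' \<cdot> x)"
      using h x by (simp add: a_minus_def H.l_distr)
    then show ?case using L L0 eng_add w by simp
  next
    case (eng_mult h h')
    have h: "h \<in> carrier H" "h' \<in> carrier H" using eng_mult.hyps DD_carrier by (simp_all add: hat_D_def)
    then show ?case using eng_mult Lc[OF eng_mult.prems w] by (simp add: H.m_assoc)
  qed
  have "\<exists>c. keys c \<subseteq> redwords \<times> {w} \<and> \<Phi> c = \<delta> w \<cdot> U w" if "w \<in> F" for w
  proof -
    have w: "w \<in> carrier W" "\<delta> w \<in> DD" using that F by auto
    have "U w \<in> L w" using Lof[of "[]" w] w by (simp add: redwords_def)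
    then have "\<delta> w \<cdot> U w \<in> L w" using LDD w by blast
    then show ?thesis unfolding L_def by auto
  qed
  then obtain c where c: "\<And>w. w \<in> F \<Longrightarrow> keys (c w) \<subseteq> redwords \<times> {w}"
    "\<And>w. w \<in> F \<Longrightarrow> \<Phi> (c w) = \<delta> w \<cdot> U w" by metis
  have cS: "keys (c w) \<subseteq> ?S" if "w \<in> F" for w using c(1)[OF that] F(2) that by blast
  have sum: "keys (sum c F) \<subseteq> ?S" "\<Phi> (sum c F) = (\<Oplus>\<^bsub>H\<^esub>w\<in>F. \<Phi> (c w))"
    by (rule additive_sum[OF H.is_abelian_group \<Phi> F(1)], erule cS)+
  have "\<Phi> (sum c F) = (\<Oplus>\<^bsub>H\<^esub>w\<in>F. \<delta> w \<cdot> U w)"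
    unfolding sum(2) using c(2) F(2,3) DD_carrier by (intro H.finsum_cong') (auto simp: Pi_iff subset_iff)
  then have "sum c F = 0" using sum(1) F(4) by (intro inj) auto
  have cw: "c w = 0" if "w \<in> F" for w
  proof (rule poly_mapping_eqI)
    fix p
    show "poly_mapping.lookup (c w) p = poly_mapping.lookup 0 p"
    proof (cases "snd p = w")
      case True
      have "poly_mapping.lookup (c v) p = 0" if "v \<in> F - {w}" for v
      proof -
        have "p \<notin> keys (c v)" using c(1)[of v] that True by auto
        then show ?thesis by (simp add: in_keys_iff)
      qed
      then have "(\<Sum>v\<in>F. poly_mapping.lookup (c v) p) = poly_mapping.lookup (c w) p"
        using F(1) \<open>w \<in> F\<close> by (simp add: sum.remove)
      moreover have "(\<Sum>v\<in>F. poly_mapping.lookup (c v) p) = poly_mapping.lookup (sum c F) p"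
        by (simp add: lookup_sum)
      ultimately show ?thesis using \<open>sum c F = 0\<close> by simp
    next
      case False
      then have "p \<notin> keys (c w)" using c(1)[OF that] by auto
      then show ?thesis by (simp add: in_keys_iff)
    qed
  qed
  show ?thesis
  proof
    fix w assume w: "w \<in> F"
    then have wc: "w \<in> carrier W" "\<delta> w \<in> carrier H" using F DD_carrier by auto
    have "\<delta> w \<cdot> U w = \<zero>\<^sub>H" using c(2)[OF w] cw[OF w] \<Phi>0 by simp
    then have "\<delta> w \<cdot> U w \<cdot> U (inv\<^sub>W w) = \<zero>\<^sub>H" using wc by simp
    then show "\<delta> w = \<zero>\<^sub>H" using wc by (simp add: H.m_assoc)
  qed
qed

section \<open>Quotients by ideals generated inside \<open>K(W)\<close>\<close>

text \<open>This is K(W) turned into a condition on elements: to lie in every conjugate of hat D(W)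
  is to have all conjugates in hat D(W).\<close>

definition KK :: "'i hat set" where
  "KK = {x \<in> DD. \<forall>w\<in>carrier W. U w \<cdot> x \<cdot> U (inv\<^sub>W w) \<in> DD}"

lemma hat_K_conj:
  assumes "x \<in> hat_K I m G" "G \<subseteq> carrier W" "w \<in> G" "inv\<^sub>W w \<in> G"
  shows "U w \<cdot> x \<cdot> U (inv\<^sub>W w) \<in> hat_D I m G"
proof -
  have "x \<in> (\<lambda>x. U (inv\<^sub>W w) \<cdot> x \<cdot> U (inv\<^sub>W (inv\<^sub>W w))) ` hat_D I m G"
    using assms(1,4) unfolding hat_K_def by blast
  then obtain y where y: "y \<in> hat_D I m G" "x = U (inv\<^sub>W w) \<cdot> y \<cdot> U w"
    using assms(2,3) by auto
  have "w \<in> carrier W" "y \<in> carrier H" using assms(2,3) y(1) hat_D_carrier by auto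
  then show ?thesis using y by (simp add: H.m_assoc)
qed

lemma hat_K_subset_KK: "hat_K I m (carrier W) \<subseteq> KK"
proof
  fix x assume x: "x \<in> hat_K I m (carrier W)"
  have c: "U w \<cdot> x \<cdot> U (inv\<^sub>W w) \<in> DD" if "w \<in> carrier W" for w
    using hat_K_conj[OF x subset_refl that] that by simp
  have "x \<in> (\<lambda>x. U \<one>\<^sub>W \<cdot> x \<cdot> U (inv\<^sub>W \<one>\<^sub>W)) ` DD"
    using x W.one_closed unfolding hat_K_def by blast
  then have "x \<in> DD" using DD_carrier by auto
  then show "x \<in> KK" using c by (simp add: KK_def)
qed

lemma parabolic_eq:
  assumes "J \<subseteq> I"
  shows "parabolic I m J = word ` lists J"
proof
  show "parabolic I m J \<subseteq> word ` lists J"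
  proof
    fix w assume "w \<in> parabolic I m J"
    then show "w \<in> word ` lists J" unfolding parabolic_def
    proof (induction rule: generate.induct)
      case one show ?case by (rule image_eqI[of _ _ "[]"]) simp_all
    next
      case (incl h)
      then obtain j where "j \<in> J" "j \<in> I" "h = s j" using assms by auto
      then show ?case by (intro image_eqI[of _ _ "[j]"]) simp_all
    next
      case (inv h)
      then obtain j where "j \<in> J" "j \<in> I" "h = s j" using assms by auto
      then show ?case by (intro image_eqI[of _ _ "[j]"]) simp_all
    next
      case (eng v w) then show ?case using word_lists_closed(1)[OF assms] by blast
    qed
  qed
  show "word ` lists J \<subseteq> parabolic I m J"
  proof (rule image_subsetI)
    fix x assume "x \<in> lists J"
    then show "word x \<in> parabolic I m J" unfolding parabolic_def
      by (induction x) (auto intro: generate.intros)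
  qed
qed

text \<open>Write \<open>w = u v\<close> with \<open>u\<close> minimal in its coset: then \<open>v\<close> preserves \<open>hat D(W\<^sub>J)\<close> on the given
  element, and \<open>u\<close> maps each \<open>D\<^sub>t\<close>, \<open>t \<in> W\<^sub>J\<close>, to \<open>D\<close> of the conjugate reflection.\<close>

lemma hat_K_parabolic_subset_KK:
  assumes "J \<subseteq> I"
  shows "hat_K I m (parabolic I m J) \<subseteq> KK"
proof
  let ?G = "word ` lists J"
  note cl = word_lists_closed[OF assms]
  fix x assume "x \<in> hat_K I m (parabolic I m J)"
  then have x: "x \<in> hat_K I m ?G" using parabolic_eq[OF assms] by simp
  have GW: "?G \<subseteq> carrier W" using cl(3) by blast
  have c: "U w \<cdot> x \<cdot> U (inv\<^sub>W w) \<in> hat_D I m ?G" if "w \<in> ?G" for w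
    by (rule hat_K_conj[OF x GW that cl(2)[OF that that]])
  have one: "\<one>\<^sub>W \<in> ?G" by (rule image_eqI[of _ _ "[]"]) simp_all
  have "x \<in> (\<lambda>x. U \<one>\<^sub>W \<cdot> x \<cdot> U (inv\<^sub>W \<one>\<^sub>W)) ` hat_D I m ?G"
    using x one unfolding hat_K_def by blast
  then obtain y where "y \<in> hat_D I m ?G" "x = \<one>\<^sub>H \<cdot> y \<cdot> \<one>\<^sub>H" by auto
  then have xG: "x \<in> hat_D I m ?G" using subsetD[OF hat_D_carrier[of ?G]] by simp
  then have xH: "x \<in> carrier H" using hat_D_carrier by blast
  have conj: "U u \<cdot> y \<cdot> U (inv\<^sub>W u) \<in> DD"
    if u: "u \<in> carrier W" "\<And>t. t \<in> ?G \<Longrightarrow> \<not> neg u t" and y: "y \<in> hat_D I m ?G" for u y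
    using y unfolding hat_D_def[of I m ?G]
  proof (induction rule: generate_ring.induct)
    case one then show ?case using u(1) by simp
  next
    case (incl h)
    then obtain t where t: "t \<in> T" "t \<in> ?G" "h = D t" by blast
    then have "U u \<cdot> h \<cdot> U (inv\<^sub>W u) = D (u \<star> t \<star> inv\<^sub>W u)" using D_conj[OF t(1) u(1) u(2)[OF t(2)]] by simp
    then show ?case using T_conj[OF t(1) u(1)] by simp
  next
    case (a_inv h)
    have "h \<in> carrier H" using a_inv.hyps hat_D_carrier unfolding hat_D_def by blast
    then have "U u \<cdot> \<ominus>\<^sub>H h \<cdot> U (inv\<^sub>W u) = \<ominus>\<^sub>H (U u \<cdot> h \<cdot> U (inv\<^sub>W u))"
      using u(1) by (simp add: H.r_minus H.l_minus)
    then show ?case using a_inv.IH by simp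
  next
    case (eng_add h h')
    have "h \<in> carrier H" "h' \<in> carrier H" using eng_add.hyps hat_D_carrier unfolding hat_D_def by blast+
    then have "U u \<cdot> (h \<oplus>\<^sub>H h') \<cdot> U (inv\<^sub>W u) =
        U u \<cdot> h \<cdot> U (inv\<^sub>W u) \<oplus>\<^sub>H U u \<cdot> h' \<cdot> U (inv\<^sub>W u)"
      using u(1) by (simp add: H.r_distr H.l_distr)
    then show ?case using eng_add.IH by simp
  next
    case (eng_mult h h')
    have "h \<in> carrier H" "h' \<in> carrier H" using eng_mult.hyps hat_D_carrier unfolding hat_D_def by blast+
    then have "U u \<cdot> (h \<cdot> h') \<cdot> U (inv\<^sub>W u) =
        (U u \<cdot> h \<cdot> U (inv\<^sub>W u)) \<cdot> (U u \<cdot> h' \<cdot> U (inv\<^sub>W u))"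
      using u(1) by (simp add: H.m_assoc)
    then show ?case using eng_mult.IH by simp
  qed
  have "U w \<cdot> x \<cdot> U (inv\<^sub>W w) \<in> DD" if w: "w \<in> carrier W" for w
  proof -
    obtain u v z where uv: "w = u \<star> v" "u \<in> carrier W" "v \<in> ?G" "\<And>t. t \<in> ?G \<Longrightarrow> \<not> neg u t"
      by (rule min_coset[OF assms w]) blast
    have v: "v \<in> carrier W" using GW uv(3) by blast
    have "U u \<cdot> (U v \<cdot> x \<cdot> U (inv\<^sub>W v)) \<cdot> U (inv\<^sub>W u) \<in> DD"
      by (rule conj[OF uv(2,4) c[OF uv(3)]])
    moreover have "U u \<cdot> (U v \<cdot> x \<cdot> U (inv\<^sub>W v)) \<cdot> U (inv\<^sub>W u) = U w \<cdot> x \<cdot> U (inv\<^sub>W w)"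
      using uv(2) v xH by (simp add: uv(1) W.inv_mult_group U_mult H.m_assoc)
    ultimately show ?thesis by simp
  qed
  moreover have "x \<in> DD"
  proof -
    have "hat_D I m ?G \<subseteq> DD" unfolding hat_D_def
      by (rule H.mono_generate_ring) (use GW in auto)
    then show ?thesis using xG by blast
  qed
  ultimately show "x \<in> KK" by (simp add: KK_def)
qed

text \<open>Let \<open>Y\<close> be the set of conjugates of \<open>Z\<close> and \<open>N\<close>
  the span of the products a y h with a in hat D(W), y in \<open>Y\<close> and h arbitrary. It is a
  right ideal, and also a left one, because s_i a = b s_i + c gives s_i a y = b (s_i y s_i) s_i + c
  y; so it contains the ideal generated by \<open>Z\<close>. Expanding h by \<open>hat_span\<close>
  into terms d w leaves the coefficients a y d, which lie both in the ideal and in hat D(W).\<close>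

lemma ideal_comb:
  assumes "Z \<subseteq> KK"
  shows "Idl\<^bsub>H\<^esub> Z \<subseteq> comb H (Idl\<^bsub>H\<^esub> Z \<inter> DD) U (carrier W)"
proof -
  let ?J = "Idl\<^bsub>H\<^esub> Z"
  have ZH: "Z \<subseteq> carrier H" using assms DD_carrier by (auto simp: KK_def)
  interpret J: ideal ?J H by (rule H.genideal_ideal[OF ZH])
  define Y where "Y = {U w \<cdot> x \<cdot> U (inv\<^sub>W w) | w x. w \<in> carrier W \<and> x \<in> Z}"
  have ZJ: "x \<in> ?J" if "x \<in> Z" for x using H.genideal_self[OF ZH] that by blast
  have Y: "y \<in> ?J \<inter> DD" if yY: "y \<in> Y" for y
  proof -
    obtain w x where wx: "y = U w \<cdot> x \<cdot> U (inv\<^sub>W w)" "w \<in> carrier W" "x \<in> Z"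
      using yY unfolding Y_def by blast
    then have "x \<in> KK" using assms by blast
    then show ?thesis using wx ZJ[OF wx(3)] by (simp add: KK_def J.I_l_closed J.I_r_closed)
  qed
  have YH: "y \<in> carrier H" if "y \<in> Y" for y using Y[OF that] DD_carrier by blast
  have sY: "hs i \<cdot> y \<cdot> hs i \<in> Y" if i: "i \<in> I" and yY: "y \<in> Y" for i y
  proof -
    obtain w x where wx: "y = U w \<cdot> x \<cdot> U (inv\<^sub>W w)" "w \<in> carrier W" "x \<in> Z"
      using yY unfolding Y_def by blast
    have "hs i \<cdot> y \<cdot> hs i = U (s i \<star> w) \<cdot> x \<cdot> U (inv\<^sub>W (s i \<star> w))"
      using wx i ZH by (simp add: U_mult W.inv_mult_group H.m_assoc subset_iff)
    then show ?thesis unfolding Y_def using wx(2,3) W.m_closed[OF s_closed[OF i] wx(2)] by blast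
  qed
  define N where "N = generate (add_monoid H) {a \<cdot> y \<cdot> h | a y h. a \<in> DD \<and> y \<in> Y \<and> h \<in> carrier H}"
  have gen: "{a \<cdot> y \<cdot> h | a y h. a \<in> DD \<and> y \<in> Y \<and> h \<in> carrier H} \<subseteq> carrier (add_monoid H)"
    using DD_carrier YH by auto
  have Nsub: "subgroup N (add_monoid H)"
    unfolding N_def by (rule group.generate_is_subgroup[OF H.a_group gen])
  interpret N: additive_subgroup N H using Nsub by (rule additive_subgroup.intro)
  have Nincl: "a \<cdot> y \<cdot> h \<in> N" if "a \<in> DD" "y \<in> Y" "h \<in> carrier H" for a y h
    unfolding N_def using that by (blast intro: generate.incl)
  have Nind: "P n" if n: "n \<in> N" and zero: "P \<zero>\<^sub>H"
    and inc: "\<And>a y h. a \<in> DD \<Longrightarrow> y \<in> Y \<Longrightarrow> h \<in> carrier H \<Longrightarrow> P (a \<cdot> y \<cdot> h)"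
    and add: "\<And>x y. x \<in> carrier H \<Longrightarrow> y \<in> carrier H \<Longrightarrow> P x \<Longrightarrow> P y \<Longrightarrow> P (x \<oplus>\<^sub>H y)" for n P
    using n unfolding N_def
  proof (induction rule: generate.induct)
    case one show ?case using zero by simp
  next
    case (incl n) then show ?case using inc by blast
  next
    case (inv n)
    then obtain a y h where ayh: "n = a \<cdot> y \<cdot> h" "a \<in> DD" "y \<in> Y" "h \<in> carrier H" by blast
    have "inv\<^bsub>add_monoid H\<^esub> n = \<ominus>\<^sub>H n" by (simp add: a_inv_def)
    also have "\<dots> = a \<cdot> y \<cdot> (\<ominus>\<^sub>H h)"
      using ayh DD_carrier YH by (simp add: H.r_minus)
    finally show ?case using inc[OF ayh(2,3) H.a_inv_closed[OF ayh(4)]] by simp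
  next
    case (eng n n')
    then show ?case using add N.a_subset unfolding N_def by auto
  qed
  have Nr: "n \<cdot> x \<in> N" if "n \<in> N" "x \<in> carrier H" for n x
    using that(1)
  proof (rule Nind)
    fix a y h assume "a \<in> DD" "y \<in> Y" "h \<in> carrier H"
    then show "a \<cdot> y \<cdot> h \<cdot> x \<in> N" using Nincl[of a y "h \<cdot> x"] that(2) DD_carrier YH by (simp add: H.m_assoc)
  qed (use that(2) in \<open>simp_all add: H.l_distr\<close>)
  have Ns: "hs i \<cdot> n \<in> N" if nN: "n \<in> N" and i: "i \<in> I" for n i
    using nN
  proof (rule Nind)
    fix a y h assume ayh: "a \<in> DD" "y \<in> Y" "h \<in> carrier H"
    obtain b c where bc: "b \<in> DD" "c \<in> DD" "hs i \<cdot> a = b \<cdot> hs i \<oplus>\<^sub>H c"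
      using hs_DD[OF i ayh(1)] by blast
    note H = DD_carrier[OF ayh(1)] DD_carrier[OF bc(1)] DD_carrier[OF bc(2)] YH[OF ayh(2)] ayh(3) hs_closed[OF i]
    have "hs i \<cdot> (a \<cdot> y \<cdot> h) = (b \<cdot> hs i \<oplus>\<^sub>H c) \<cdot> y \<cdot> h"
      using H by (simp add: bc(3)[symmetric] H.m_assoc)
    also have "\<dots> = b \<cdot> hs i \<cdot> y \<cdot> h \<oplus>\<^sub>H c \<cdot> y \<cdot> h"
      using H by (simp add: H.l_distr)
    \<comment> \<open>Inserting the square of \<open>hs i\<close> behind \<open>y\<close> replaces
      \<open>y\<close> by a conjugate, at the cost of changing \<open>h\<close>, which is
      arbitrary.\<close>
    also have "b \<cdot> hs i \<cdot> y \<cdot> h = b \<cdot> (hs i \<cdot> y \<cdot> hs i) \<cdot> (hs i \<cdot> h)"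
    proof -
      have "hs i \<cdot> (hs i \<cdot> h) = h" using H i by (simp flip: H.m_assoc)
      then show ?thesis using H by (simp add: H.m_assoc)
    qed
    finally show "hs i \<cdot> (a \<cdot> y \<cdot> h) \<in> N"
      using Nincl[OF bc(1) sY[OF i ayh(2)]] Nincl[OF bc(2) ayh(2,3)] H by simp
  qed (use i in \<open>simp_all add: H.r_distr\<close>)
  have Nd: "hD i \<cdot> n \<in> N" if "n \<in> N" "i \<in> I" for n i
    using that(1)
  proof (rule Nind)
    fix a y h assume ayh: "a \<in> DD" "y \<in> Y" "h \<in> carrier H"
    have "D (s i) \<cdot> a \<in> DD" using ayh(1) that(2) by (simp del: D_s)
    then show "hD i \<cdot> (a \<cdot> y \<cdot> h) \<in> N" using Nincl[of "D (s i) \<cdot> a" y h] ayh that(2) DD_carrier YH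
      by (simp add: H.m_assoc)
  qed (use that(2) in \<open>simp_all add: H.r_distr\<close>)
  have Nc: "n \<in> carrier H" if "n \<in> N" for n using N.a_subset that by blast
  have Nl: "x \<cdot> n \<in> N" if "n \<in> N" "x \<in> carrier H" for n x
    using that(2)
  proof (induction x rule: H_induct)
    case (diff x y)
    then show ?case using Nc[OF that(1)] by (simp add: a_minus_def H.l_distr H.l_minus)
  next
    case (hs i x) then show ?case using Ns[OF hs(3,1)] Nc[OF that(1)] by (simp add: H.m_assoc)
  next
    case (hd i x) then show ?case using Nd[OF hd(3,1)] Nc[OF that(1)] by (simp add: H.m_assoc)
  qed (use that(1) Nc in simp_all)
  have "ideal N H" by (rule idealI[OF H.ring_axioms Nsub Nl Nr])
  moreover have "Z \<subseteq> N"
  proof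
    fix x assume x: "x \<in> Z"
    then have xH: "x \<in> carrier H" using ZH by blast
    have "x \<in> Y" unfolding Y_def using x xH by (intro CollectI exI[of _ "\<one>\<^sub>W"] exI[of _ x]) simp
    then show "x \<in> N" using Nincl[of "\<one>\<^sub>H" x "\<one>\<^sub>H"] xH by simp
  qed
  ultimately have "?J \<subseteq> N" by (rule H.genideal_minimal)
  also have "N \<subseteq> comb H (?J \<inter> DD) U (carrier W)"
  proof
    have JD: "additive_subgroup (?J \<inter> DD) H"
      by (intro additive_subgroup.intro H.add.subgroups_Inter_pair J.a_subgroup
          additive_subgroup.a_subgroup[OF DD_additive])
    have JDc: "?J \<inter> DD \<subseteq> carrier H" using DD_carrier by blast
    note add = H.comb_add[OF JD U_funcset]
    fix n assume "n \<in> N"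
    then show "n \<in> comb H (?J \<inter> DD) U (carrier W)"
    proof (rule Nind)
      fix a y h assume ayh: "a \<in> DD" "y \<in> Y" "h \<in> carrier H"
      then have "h \<in> comb H DD U (carrier W)" using hat_span by blast
      then show "a \<cdot> y \<cdot> h \<in> comb H (?J \<inter> DD) U (carrier W)"
      proof (rule H.comb_induct[OF _ hat_D_carrier U_funcset])
        fix d w assume d: "d \<in> DD" "w \<in> carrier W"
        have y: "y \<in> ?J" "y \<in> DD" using Y[OF ayh(2)] by auto
        have "a \<cdot> y \<cdot> d \<in> ?J \<inter> DD"
          using y ayh(1) d(1) DD_carrier by (simp add: J.I_l_closed J.I_r_closed)
        from H.comb_incl[OF this d(2) JDc U_funcset]
        show "a \<cdot> y \<cdot> (d \<cdot> U w) \<in> comb H (?J \<inter> DD) U (carrier W)"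
          using y ayh(1) d DD_carrier by (simp add: H.m_assoc)
      next
        show "a \<cdot> y \<cdot> \<zero>\<^sub>H \<in> comb H (?J \<inter> DD) U (carrier W)"
          using ayh DD_carrier YH H.comb_zero by simp
      next
        fix x z assume xz: "x \<in> carrier H" "z \<in> carrier H" "a \<cdot> y \<cdot> x \<in> comb H (?J \<inter> DD) U (carrier W)"
          "a \<cdot> y \<cdot> z \<in> comb H (?J \<inter> DD) U (carrier W)"
        have "a \<cdot> y \<cdot> (x \<oplus>\<^sub>H z) = a \<cdot> y \<cdot> x \<oplus>\<^sub>H a \<cdot> y \<cdot> z"
          using xz(1,2) ayh DD_carrier YH by (simp add: H.r_distr)
        then show "a \<cdot> y \<cdot> (x \<oplus>\<^sub>H z) \<in> comb H (?J \<inter> DD) U (carrier W)" using add xz(3,4) by simp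
      qed
    qed (simp_all add: H.comb_zero add)
  qed
  finally show ?thesis .
qed

text \<open>Spanning passes to the quotient. For directness a relation in the quotient is lifted:
  the sum then lies in \<open>J\<close>, so by \<open>ideal_comb\<close> it also has an expansion
  with coefficients in \<open>J \<inter> DD\<close>. Coefficients over \<open>W\<close> are unique
  by \<open>hat_direct\<close>, so the original ones lie in \<open>J\<close>.\<close>

lemma factorization_quotient:
  assumes "Z \<subseteq> KK"
  defines "J \<equiv> Idl\<^bsub>H\<^esub> Z"
  shows "factorization (H Quot J) (quot_D I m J) (ZW I m) (quot_ZW I m J)"
proof -
  have ZH: "Z \<subseteq> carrier H" using assms(1) DD_carrier by (auto simp: KK_def)
  interpret J: ideal J H unfolding J_def by (rule H.genideal_ideal[OF ZH])
  let ?Q = "H Quot J" and ?p = "\<lambda>x. J +>\<^bsub>H\<^esub> x"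
  interpret Q: ring ?Q by (rule J.quotient_is_ring)
  interpret p: ring_hom_ring H ?Q ?p by (rule J.rcos_ring_hom_ring)
  have zQ: "\<zero>\<^bsub>?Q\<^esub> = J" by (simp only: FactRing_def ring.simps)
  have p0: "x \<in> J" if "x \<in> carrier H" "?p x = \<zero>\<^bsub>?Q\<^esub>" for x
    by (rule J.rcos_const_imp_mem[OF that(1) that(2)[unfolded zQ]])
  have p0': "?p x = \<zero>\<^bsub>?Q\<^esub>" if "x \<in> J" for x
    unfolding zQ by (rule H.a_rcos_zero[OF J.is_ideal that])
  have sur: "\<exists>x\<in>carrier H. c = ?p x" if "c \<in> carrier ?Q" for c
    using that unfolding FactRing_def A_RCOSETS_def' by (simp only: partial_object.simps UN_iff) blast
  have t: "\<And>i. i \<in> I \<Longrightarrow> ?p (hs i) \<in> carrier ?Q"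
    "\<And>i. i \<in> I \<Longrightarrow> ?p (hs i) \<otimes>\<^bsub>?Q\<^esub> ?p (hs i) = \<one>\<^bsub>?Q\<^esub>"
    "\<And>i j. i \<in> I \<Longrightarrow> j \<in> I \<Longrightarrow> (?p (hs i) \<otimes>\<^bsub>?Q\<^esub> ?p (hs j)) [^]\<^bsub>?Q\<^esub> m i j = \<one>\<^bsub>?Q\<^esub>"
  proof -
    show 1: "?p (hs i) \<in> carrier ?Q" if "i \<in> I" for i using that by simp
    show "?p (hs i) \<otimes>\<^bsub>?Q\<^esub> ?p (hs i) = \<one>\<^bsub>?Q\<^esub>" if "i \<in> I" for i
      using p.hom_mult[of "hs i" "hs i"] that by simp
    show "(?p (hs i) \<otimes>\<^bsub>?Q\<^esub> ?p (hs j)) [^]\<^bsub>?Q\<^esub> m i j = \<one>\<^bsub>?Q\<^esub>" if "i \<in> I" "j \<in> I" for i j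
      using p.hom_nat_pow[of "hs i \<cdot> hs j" "m i j"] that hs_braid[OF that] by simp
  qed
  have \<phi>: "quot_ZW I m J \<in> ring_hom (ZW I m) ?Q"
    unfolding quot_ZW_def using ZW_map_props[OF Q.ring_axioms t] by blast
  have comp: "?p \<circ> ZW_map I m H hs \<in> ring_hom (ZW I m) ?Q"
    using ring_hom_trans[OF hat_ZW_hom J.rcos_ring_hom] .
  have comp_s: "(?p \<circ> ZW_map I m H hs) (frag_of (s i)) = ?p (hs i)" if "i \<in> I" for i
    using hat_ZW that by simp
  \<comment> \<open>By uniqueness on the generators, the map from the group ring to the quotient is
    the projection of the one to hat H(W).\<close>
  have \<phi>w: "quot_ZW I m J (frag_of w) = ?p (U w)" if "w \<in> carrier W" for w
  proof -
    have "ZW_map I m ?Q (\<lambda>i. ?p (hs i)) (frag_of w) = (?p \<circ> ZW_map I m H hs) (frag_of w)"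
    proof (rule ZW_map_eqI[OF Q.ring_axioms _ _ _ comp])
      show "?p (hs i) \<in> carrier ?Q" if "i \<in> I" for i by (rule t(1)[OF that])
      show "?p (hs i) \<otimes>\<^bsub>?Q\<^esub> ?p (hs i) = \<one>\<^bsub>?Q\<^esub>" if "i \<in> I" for i by (rule t(2)[OF that])
      show "(?p (hs i) \<otimes>\<^bsub>?Q\<^esub> ?p (hs j)) [^]\<^bsub>?Q\<^esub> m i j = \<one>\<^bsub>?Q\<^esub>" if "i \<in> I" "j \<in> I" for i j
        by (rule t(3)[OF that])
      show "(?p \<circ> ZW_map I m H hs) (frag_of (s i)) = ?p (hs i)" if "i \<in> I" for i by (rule comp_s[OF that])
      show "frag_of w \<in> carrier (ZW I m)" using that by (simp add: monoid_ring_simps)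
    qed
    then show ?thesis unfolding quot_ZW_def hat_w_def by simp
  qed
  have DQ: "quot_D I m J = ?p ` DD" by (simp add: quot_D_def)
  have DQI: "?p d \<in> quot_D I m J" if "d \<in> DD" for d unfolding DQ using that by (rule imageI)
  have DQc: "quot_D I m J \<subseteq> carrier ?Q"
    unfolding DQ by (rule image_subsetI) (rule p.hom_closed[OF DD_carrier])
  have Dadd: "additive_subgroup (quot_D I m J) ?Q"
  proof (rule additive_subgroup.intro)
    interpret p: group_hom "add_monoid H" "add_monoid ?Q" ?p by (rule p.a_group_hom)
    show "subgroup (quot_D I m J) (add_monoid ?Q)"
      unfolding DQ by (rule p.subgroup_img_is_subgroup[OF additive_subgroup.a_subgroup[OF DD_additive]])
  qed
  have uQ: "(\<lambda>w. quot_ZW I m J (frag_of w)) \<in> carrier W \<rightarrow> carrier ?Q" by (simp add: \<phi>w)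
  let ?C = "comb ?Q (quot_D I m J) (\<lambda>w. quot_ZW I m J (frag_of w)) (carrier W)"
  show ?thesis
  proof (rule Q.factorization_monoid_ringI[OF Dadd W.is_monoid \<phi>])
    show "carrier ?Q \<subseteq> ?C"
    proof
      fix c assume "c \<in> carrier ?Q"
      then obtain x where x: "x \<in> carrier H" "c = ?p x" using sur by blast
      have "x \<in> comb H DD U (carrier W)" using hat_span x(1) by blast
      then have "?p x \<in> ?C"
      proof (rule H.comb_induct[OF _ hat_D_carrier U_funcset])
        show "?p \<zero>\<^sub>H \<in> ?C"
          using Q.comb_zero by simp
        fix d w assume d: "d \<in> DD" "w \<in> carrier W"
        from Q.comb_incl[OF DQI[OF d(1)] d(2) DQc uQ]
        show "?p (d \<cdot> U w) \<in> ?C"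
          using d DD_carrier by (simp add: \<phi>w)
      next
        fix x y assume "x \<in> carrier H" "y \<in> carrier H"
          "?p x \<in> ?C"
          "?p y \<in> ?C"
        then show "?p (x \<oplus>\<^sub>H y) \<in> ?C"
          using Q.comb_add[OF Dadd uQ] by simp
      qed
      then show "c \<in> ?C" using x by simp
    qed
  next
    fix F \<delta>
    assume F: "finite F" "F \<subseteq> carrier W" "\<delta> \<in> F \<rightarrow> quot_D I m J"
      and z: "(\<Oplus>\<^bsub>?Q\<^esub>w\<in>F. \<delta> w \<otimes>\<^bsub>?Q\<^esub> quot_ZW I m J (frag_of w)) = \<zero>\<^bsub>?Q\<^esub>"
    have "\<forall>w\<in>F. \<exists>d\<in>DD. \<delta> w = ?p d" using F(3) DQ by blast
    then obtain d where d: "\<And>w. w \<in> F \<Longrightarrow> d w \<in> DD" "\<And>w. w \<in> F \<Longrightarrow> \<delta> w = ?p (d w)" by metis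
    have dH: "d w \<in> carrier H" "U w \<in> carrier H" if "w \<in> F" for w
      using d(1)[OF that] DD_carrier F(2) that by auto
    let ?x = "\<Oplus>\<^bsub>H\<^esub>w\<in>F. d w \<cdot> U w"
    have xH: "?x \<in> carrier H" using dH by (intro H.finsum_closed) auto
    have "?p ?x = (\<Oplus>\<^bsub>?Q\<^esub>w\<in>F. ?p (d w \<cdot> U w))"
      using dH by (subst p.hom_finsum) (auto simp: comp_def)
    also have "\<dots> = (\<Oplus>\<^bsub>?Q\<^esub>w\<in>F. \<delta> w \<otimes>\<^bsub>?Q\<^esub> quot_ZW I m J (frag_of w))"
      by (rule Q.finsum_cong') (use dH d(2) F(2) \<phi>w in auto)
    finally have "?x \<in> J" using p0[OF xH] z by simp
    then have "?x \<in> comb H (J \<inter> DD) U (carrier W)" using ideal_comb[OF assms(1)] unfolding J_def by blast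
    then obtain G e where G: "finite G" "G \<subseteq> carrier W" "e \<in> G \<rightarrow> J \<inter> DD" "?x = (\<Oplus>\<^bsub>H\<^esub>w\<in>G. e w \<cdot> U w)"
      unfolding comb_def by blast
    let ?d = "\<lambda>w. if w \<in> F then d w else \<zero>\<^sub>H" and ?e = "\<lambda>w. if w \<in> G then e w else \<zero>\<^sub>H"
    have eD: "e w \<in> J" "e w \<in> DD" if "w \<in> G" for w using G(3) that by auto
    have UH: "U \<in> F \<union> G \<rightarrow> carrier H" using F(2) G(2) by auto
    have UW: "U w \<in> carrier H" if "w \<in> F \<union> G" for w using UH that by blast
    have DD: "?d w \<in> DD" "?e w \<in> DD" for w using d(1) eD by auto
    have DC: "?d w \<in> carrier H" "?e w \<in> carrier H" for w using DD DD_carrier by blast+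
    have x1: "?x = (\<Oplus>\<^bsub>H\<^esub>w\<in>F \<union> G. ?d w \<cdot> U w)"
      by (rule H.finsum_extend_zero) (use F G UH dH in auto)
    have x2: "?x = (\<Oplus>\<^bsub>H\<^esub>w\<in>F \<union> G. ?e w \<cdot> U w)"
      unfolding G(4) by (rule H.finsum_extend_zero) (use F G UH eD DD_carrier in auto)
    \<comment> \<open>The difference of the two expansions of \<open>?x\<close> is a combination
      with coefficients in hat D(W) that adds up to zero.\<close>
    have "(\<Oplus>\<^bsub>H\<^esub>w\<in>F \<union> G. (?d w \<oplus>\<^sub>H \<ominus>\<^sub>H ?e w) \<cdot> U w) \<oplus>\<^sub>H (\<Oplus>\<^bsub>H\<^esub>w\<in>F \<union> G. ?e w \<cdot> U w) =
      (\<Oplus>\<^bsub>H\<^esub>w\<in>F \<union> G. (?d w \<oplus>\<^sub>H \<ominus>\<^sub>H ?e w) \<cdot> U w \<oplus>\<^sub>H ?e w \<cdot> U w)"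
      by (rule H.finsum_addf[symmetric]; intro funcsetI H.m_closed H.a_closed H.a_inv_closed DC UW)
    also have "\<dots> = (\<Oplus>\<^bsub>H\<^esub>w\<in>F \<union> G. ?d w \<cdot> U w)"
    proof (rule H.finsum_cong')
      show "(\<lambda>w. ?d w \<cdot> U w) \<in> F \<union> G \<rightarrow> carrier H" by (intro funcsetI H.m_closed DC UW)
      fix w assume "w \<in> F \<union> G"
      have cancel: "(a \<oplus>\<^sub>H \<ominus>\<^sub>H b) \<cdot> u \<oplus>\<^sub>H b \<cdot> u = a \<cdot> u"
        if "a \<in> carrier H" "b \<in> carrier H" "u \<in> carrier H" for a b u
        using that by algebra
      show "(?d w \<oplus>\<^sub>H \<ominus>\<^sub>H ?e w) \<cdot> U w \<oplus>\<^sub>H ?e w \<cdot> U w = ?d w \<cdot> U w"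
        by (rule cancel[OF DC UW]) fact
    qed simp
    finally have "(\<Oplus>\<^bsub>H\<^esub>w\<in>F \<union> G. (?d w \<oplus>\<^sub>H \<ominus>\<^sub>H ?e w) \<cdot> U w) \<oplus>\<^sub>H ?x = ?x"
      unfolding x2[symmetric] x1[symmetric] .
    moreover have "(\<Oplus>\<^bsub>H\<^esub>w\<in>F \<union> G. (?d w \<oplus>\<^sub>H \<ominus>\<^sub>H ?e w) \<cdot> U w) \<in> carrier H"
      by (intro H.finsum_closed funcsetI H.m_closed H.a_closed H.a_inv_closed DC UW)
    ultimately have "(\<Oplus>\<^bsub>H\<^esub>w\<in>F \<union> G. (?d w \<oplus>\<^sub>H \<ominus>\<^sub>H ?e w) \<cdot> U w) = \<zero>\<^sub>H"
      using xH H.add.r_cancel_one by blast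
    then have *: "\<forall>w\<in>F \<union> G. ?d w \<oplus>\<^sub>H \<ominus>\<^sub>H ?e w = \<zero>\<^sub>H"
    proof (intro hat_direct)
      show "finite (F \<union> G)" "F \<union> G \<subseteq> carrier W" using F(1,2) G(1,2) by auto
      show "(\<lambda>w. ?d w \<oplus>\<^sub>H \<ominus>\<^sub>H ?e w) \<in> F \<union> G \<rightarrow> DD" by (intro funcsetI DD_ring(3,4) DD)
    qed
    show "\<forall>w\<in>F. \<delta> w = \<zero>\<^bsub>?Q\<^esub>"
    proof
      fix w assume w: "w \<in> F"
      then have "?d w \<oplus>\<^sub>H \<ominus>\<^sub>H ?e w = \<zero>\<^sub>H" using * by blast
      then have "?d w = ?e w" by (rule H.r_right_minus_eq[OF DC, unfolded a_minus_def, THEN iffD1])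
      moreover have "?e w \<in> J" using eD by simp
      ultimately have "d w \<in> J" using w by simp
      then show "\<delta> w = \<zero>\<^bsub>?Q\<^esub>" using d(2)[OF w] p0' by simp
    qed
  qed
qed

end

theorem theorem1p28:
  fixes I :: "'i set" and m :: "'i \<Rightarrow> 'i \<Rightarrow> nat"
  assumes "coxeter_matrix I m"
  shows "factorization (lower_H I m) (quot_D I m (lower_J I m))
           (ZW I m) (quot_ZW I m (lower_J I m)) \<and>
         factorization (hecke_H I m) (quot_D I m (hecke_J I m))
           (ZW I m) (quot_ZW I m (hecke_J I m))"
proof -
  interpret coxeter I m by unfold_locales (rule assms)
  have "hat_K I m (carrier W) \<inter> ker_counit I m \<subseteq> KK" by (rule le_infI1[OF hat_K_subset_KK])
  \<comment> \<open>Each \<open>K_pair\<close> lies in K of a parabolic subgroup of rank two, hence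
    in \<open>KK\<close>.\<close>
  moreover have "(\<Union>i\<in>I. \<Union>j\<in>I - {i}. K_pair I m i j) \<subseteq> KK"
    unfolding K_pair_def by (intro UN_least le_infI1 hat_K_parabolic_subset_KK) simp
  ultimately show ?thesis
    unfolding lower_H_def lower_J_def hecke_H_def hecke_J_def
    by (intro conjI factorization_quotient)
qed

end
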